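(* Let $X$ be a locally wep-connected space. Then the monodromy functor $\mathscr{M}\colon \mathbf{SCov}(X)\to \mathbf{TopFunc}(\pi^{\tau}X,\mathbf{Set})$ is an isomorphism of categories.
   Context: Conventions: "map" means continuous function; $I=[0,1]$; mapping spaces carry the compact-open topology. $\mathcal{P}X$ is the space of paths $I\to X$; $(\mathcal{P}X)_x$ is the subspace of paths starting at $x$; $\mathcal{P}X(x_1,x_2)$ is the subspace of paths from $x_1$ to $x_2$. Semicoverings. Let $\Delta_2=\{(s,t)\in I^2: s+t\le 1\}$, $e_1=\{(0,t): t\in I\}$, and let $(\Phi X)_x$ be the space of maps $\phi\colon\Delta_2\to X$ with $\phi(e_1)=\{x\}$. A map $p\colon Y\to X$ has continuous lifting of paths (resp. homotopies) if for each $y\in Y$ the map $(\mathcal{P}Y)_y\to(\mathcal{P}X)_{p(y)}$, $\alpha\mapsto p\circ\alpha$ (resp. $(\Phi Y)_y\to(\Phi X)_{p(y)}$, $\phi\mapsto p\circ\phi$) is a homeomorphism. A semicovering map is a local homeomorphism with continuous lifting of paths and homotopies (the empty map $\emptyset\to X$ is allowed). $\mathbf{SCov}(X)$ is the category of semicoverings of $X$; a morphism from $p\colon Y\to X$ to $p'\colon Y'\to X$ is a map $f\colon Y\to Y'$ with $p'\circ f=p$. If $p(y)=\alpha(0)$, then $\tilde\alpha_y$ denotes the unique lift of the path $\alpha$ starting at $y$, and $y\cdot[\alpha]=\tilde\alpha_y(1)$. The fundamental $\mathbf{Top}$-groupoid. A quasitopological group is a group with a topology such that inversion and all left and right translations are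 continuous. For a quasitopological group $G$, $\tau(G)$ is the topological group with underlying group $G$ and the quotient topology with respect to the homomorphism $F_M(G)\to G$ induced by the identity of $G$, where $F_M(G)$ is the free (Markov) topological group on the underlying space of $G$. Let $\pi X$ be the fundamental groupoid (composition written in the order of concatenation). $\pi^{qtop}X$ is $\pi X$ with each hom-set $\pi X(x_1,x_2)$ given the quotient topology from $\mathcal{P}X(x_1,x_2)$. $\pi^{\tau}X$ is $\pi X$ with vertex groups $\pi^\tau X(x,x)=\tau(\pi^{qtop}X(x,x))$ and, for $x_1\neq x_2$, with $\pi^{\tau}X(x_1,x_2)$ having the topology generated by the sets $Ug=\{ug: u\in U\}$, $g\in\pi X(x_1,x_2)$, $U$ open in $\pi^\tau X(x_1,x_1)$. This makes $\pi^\tau X$ a groupoid enriched over $\mathbf{Top}$, the category of topological spaces. Enriched functors. $\mathbf{Set}$ is enriched over $\mathbf{Top}$ by giving each set the discrete topology and $\mathbf{Set}(A,B)$ the topology of pointwise convergence. A $\mathbf{Top}$-functor is a functor that is continuous on each hom-space. $\mathbf{TopFunc}(\pi^\tau X,\mathbf{Set})$ is the category of $\mathbf{Top}$-functors $F\colon \pi^\tau X\to\mathbf{Set}$ and $\mathbf{Top}$-natural transformations (that is, natural transformations of the underlying functors). The monodromy $\mathscr{M}p$ of a semicovering $p$ sends $x\in X$ to $p^{-1}(x)$ and $[\alpha]\in\pi X(x_1,x_2)$ to the function $p^{-1}(x_1)\to p^{-1}(x_2)$, $y\mapsto y\cdot[\alpha]$; for a morphism $f$ of semicoverings from $p$ to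 $p'$, $\mathscr{M}f$ is the natural transformation with components the restrictions $f\colon p^{-1}(x)\to(p')^{-1}(x)$. Locally wep-connected spaces. A path $\alpha\colon I\to X$ is well-ended if for every open neighborhood $U$ of $\alpha$ in $\mathcal{P}X$ there are open neighborhoods $V_0,V_1$ of $\alpha(0),\alpha(1)$ in $X$ respectively such that for every $a\in V_0$, $b\in V_1$ there is a path $\beta\in U$ with $\beta(0)=a$, $\beta(1)=b$. It is locally well-ended if the same holds with $\beta$ required in addition to be well-ended. $X$ is locally wep-connected if every pair of points of $X$ can be connected by a locally well-ended path.
   Formalization: Fibres are pairwise disjoint, so a functor constant at one point is not literally a monodromy; the isomorphism is onto functors with disjoint values F(x), and each F has a unique semicovering with monodromy x ↦ {x}×F(x), naturally isomorphic to F. *)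

theory Defs
  imports "HOL-Analysis.Analysis" "HOL-Algebra.Group"
begin

section \<open>Categories, functors and topologically enriched functors\<close>

text \<open>
  Hom-sets are indexed by source and target and need not be disjoint.  Composition is written in
  diagrammatic order: \<open>Comp C a b c f g\<close> is \<open>f : a \<rightarrow> b\<close> followed by \<open>g : b \<rightarrow> c\<close>.
\<close>

record ('o, 'm) cat_struct =
  Obj :: "'o set"
  Hom :: "'o \<Rightarrow> 'o \<Rightarrow> 'm set"
  Ident :: "'o \<Rightarrow> 'm"
  Comp :: "'o \<Rightarrow> 'o \<Rightarrow> 'o \<Rightarrow> 'm \<Rightarrow> 'm \<Rightarrow> 'm"

record ('o, 'm) top_cat_struct = "('o, 'm) cat_struct" +
  HomTop :: "'o \<Rightarrow> 'o \<Rightarrow> 'm topology"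

definition category :: "('o, 'm, 'z) cat_struct_scheme \<Rightarrow> bool" where
  "category C \<longleftrightarrow>
     (\<forall>a\<in>Obj C. Ident C a \<in> Hom C a a) \<and>
     (\<forall>a\<in>Obj C. \<forall>b\<in>Obj C. \<forall>c\<in>Obj C. \<forall>f\<in>Hom C a b. \<forall>g\<in>Hom C b c.
        Comp C a b c f g \<in> Hom C a c) \<and>
     (\<forall>a\<in>Obj C. \<forall>b\<in>Obj C. \<forall>f\<in>Hom C a b.
        Comp C a a b (Ident C a) f = f \<and> Comp C a b b f (Ident C b) = f) \<and>
     (\<forall>a\<in>Obj C. \<forall>b\<in>Obj C. \<forall>c\<in>Obj C. \<forall>d\<in>Obj C. \<forall>f\<in>Hom C a b. \<forall>g\<in>Hom C b c. \<forall>h\<in>Hom C c d.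
        Comp C a c d (Comp C a b c f g) h = Comp C a b d f (Comp C b c d g h))"

definition arrows :: "('o, 'm, 'z) cat_struct_scheme \<Rightarrow> ('o \<times> 'o \<times> 'm) set" where
  "arrows C = {(a, b, f). a \<in> Obj C \<and> b \<in> Obj C \<and> f \<in> Hom C a b}"

definition full_subcategory :: "('o, 'm) cat_struct \<Rightarrow> ('o \<Rightarrow> bool) \<Rightarrow> ('o, 'm) cat_struct" where
  "full_subcategory C P = C\<lparr>Obj := {a \<in> Obj C. P a}\<rparr>"

record ('o, 'm, 'p, 'n) functor_struct =
  fobj :: "'o \<Rightarrow> 'p"
  farr :: "'o \<times> 'o \<times> 'm \<Rightarrow> 'n"

definition is_functor ::
  "('o, 'm, 'y) cat_struct_scheme \<Rightarrow> ('p, 'n, 'z) cat_struct_scheme \<Rightarrow>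
   ('o, 'm, 'p, 'n) functor_struct \<Rightarrow> bool" where
  "is_functor C D F \<longleftrightarrow>
     (\<forall>a\<in>Obj C. fobj F a \<in> Obj D) \<and>
     (\<forall>a\<in>Obj C. \<forall>b\<in>Obj C. \<forall>f\<in>Hom C a b. farr F (a, b, f) \<in> Hom D (fobj F a) (fobj F b)) \<and>
     (\<forall>a\<in>Obj C. farr F (a, a, Ident C a) = Ident D (fobj F a)) \<and>
     (\<forall>a\<in>Obj C. \<forall>b\<in>Obj C. \<forall>c\<in>Obj C. \<forall>f\<in>Hom C a b. \<forall>g\<in>Hom C b c.
        farr F (a, c, Comp C a b c f g) =
        Comp D (fobj F a) (fobj F b) (fobj F c) (farr F (a, b, f)) (farr F (b, c, g)))"

definition isomorphism_of_categories ::
  "('o, 'm, 'y) cat_struct_scheme \<Rightarrow> ('p, 'n, 'z) cat_struct_scheme \<Rightarrow>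
   ('o, 'm, 'p, 'n) functor_struct \<Rightarrow> bool" where
  "isomorphism_of_categories C D F \<longleftrightarrow>
     category C \<and> category D \<and> is_functor C D F \<and>
     (\<exists>G. is_functor D C G \<and>
        (\<forall>a\<in>Obj C. fobj G (fobj F a) = a) \<and>
        (\<forall>(a, b, f)\<in>arrows C. farr G (fobj F a, fobj F b, farr F (a, b, f)) = f) \<and>
        (\<forall>a\<in>Obj D. fobj F (fobj G a) = a) \<and>
        (\<forall>(a, b, f)\<in>arrows D. farr F (fobj G a, fobj G b, farr G (a, b, f)) = f))"

definition is_top_functor ::
  "('o, 'm, 'y) top_cat_struct_scheme \<Rightarrow> ('p, 'n, 'z) top_cat_struct_scheme \<Rightarrow>
   ('o, 'm, 'p, 'n) functor_struct \<Rightarrow> bool" where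
  "is_top_functor C D F \<longleftrightarrow>
     is_functor C D F \<and>
     (\<forall>a\<in>Obj C. \<forall>b\<in>Obj C.
        continuous_map (HomTop C a b) (HomTop D (fobj F a) (fobj F b)) (\<lambda>f. farr F (a, b, f)))"

definition natural_transformations ::
  "('o, 'm, 'y) cat_struct_scheme \<Rightarrow> ('p, 'n, 'z) cat_struct_scheme \<Rightarrow>
   ('o, 'm, 'p, 'n) functor_struct \<Rightarrow> ('o, 'm, 'p, 'n) functor_struct \<Rightarrow> ('o \<Rightarrow> 'n) set" where
  "natural_transformations C D F G =
     {\<eta> \<in> \<Pi>\<^sub>E a\<in>Obj C. Hom D (fobj F a) (fobj G a).
        \<forall>a\<in>Obj C. \<forall>b\<in>Obj C. \<forall>f\<in>Hom C a b.
          Comp D (fobj F a) (fobj F b) (fobj G b) (farr F (a, b, f)) (\<eta> b) =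
          Comp D (fobj F a) (fobj G a) (fobj G b) (\<eta> a) (farr G (a, b, f))}"

text \<open>
  The objects are required to be extensional, so that two functors are equal as soon as they agree
  on the objects and arrows of the source.
\<close>

definition TopFunc ::
  "('o, 'm, 'y) top_cat_struct_scheme \<Rightarrow> ('p, 'n, 'z) top_cat_struct_scheme \<Rightarrow>
   (('o, 'm, 'p, 'n) functor_struct, 'o \<Rightarrow> 'n) cat_struct" where
  "TopFunc C D =
     \<lparr>Obj = {F. is_top_functor C D F \<and>
                fobj F \<in> extensional (Obj C) \<and> farr F \<in> extensional (arrows C)},
      Hom = natural_transformations C D,
      Ident = (\<lambda>F. \<lambda>a\<in>Obj C. Ident D (fobj F a)),
      Comp = (\<lambda>F G H \<eta> \<theta>. \<lambda>a\<in>Obj C. Comp D (fobj F a) (fobj G a) (fobj H a) (\<eta> a) (\<theta> a))\<rparr>"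

text \<open>
  The category of all sets of elements of \<open>'b\<close>.  The product topology of copies of the discrete
  space \<open>B\<close> indexed by \<open>A\<close> is the topology of pointwise convergence on \<open>A \<rightarrow>\<^sub>E B\<close>.
\<close>

definition TopSet :: "('b set, 'b \<Rightarrow> 'b) top_cat_struct" where
  "TopSet =
     \<lparr>Obj = UNIV,
      Hom = (\<lambda>A B. A \<rightarrow>\<^sub>E B),
      Ident = (\<lambda>A. \<lambda>x\<in>A. x),
      Comp = (\<lambda>A B C f g. compose A g f),
      HomTop = (\<lambda>A B. product_topology (\<lambda>_. discrete_topology B) A)\<rparr>"

text \<open>
  Natural isomorphisms between set-valued functors; the values of the two functors may consist of
  elements of different types.
\<close>

definition set_natural_iso ::
  "('o, 'm, 'z) cat_struct_scheme \<Rightarrow> ('o, 'm, 'b set, 'b \<Rightarrow> 'b) functor_struct \<Rightarrow>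
   ('o, 'm, 'c set, 'c \<Rightarrow> 'c) functor_struct \<Rightarrow> ('o \<Rightarrow> 'b \<Rightarrow> 'c) \<Rightarrow> bool" where
  "set_natural_iso C F G \<eta> \<longleftrightarrow>
     (\<forall>a\<in>Obj C. bij_betw (\<eta> a) (fobj F a) (fobj G a)) \<and>
     (\<forall>a\<in>Obj C. \<forall>b\<in>Obj C. \<forall>f\<in>Hom C a b. \<forall>u\<in>fobj F a.
        \<eta> b (farr F (a, b, f) u) = farr G (a, b, f) (\<eta> a u))"

section \<open>Mapping spaces and quotient spaces\<close>

text \<open>
  The compact-open topology; continuous maps are represented by functions that are \<open>undefined\<close>
  outside the domain, so that maps which agree on the domain are equal.
\<close>

definition maps :: "'a topology \<Rightarrow> 'b topology \<Rightarrow> ('a \<Rightarrow> 'b) set" where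
  "maps A X = {f \<in> extensional (topspace A). continuous_map A X f}"

definition mapping_space :: "'a topology \<Rightarrow> 'b topology \<Rightarrow> ('a \<Rightarrow> 'b) topology" where
  "mapping_space A X =
     topology_generated_by {{f \<in> maps A X. f ` K \<subseteq> U} |K U. compactin A K \<and> openin X U}"

lemma topspace_mapping_space: "topspace (mapping_space A X) = maps A X"
proof -
  have "{f \<in> maps A X. f ` {} \<subseteq> {}} = maps A X" "compactin A {}" "openin X {}"
    by auto
  then have "maps A X \<in> {{f \<in> maps A X. f ` K \<subseteq> U} |K U. compactin A K \<and> openin X U}"
    by blast
  then show ?thesis
    unfolding mapping_space_def topology_generated_by_topspace by blast
qed

definition quotient_topology :: "'a topology \<Rightarrow> ('a \<Rightarrow> 'b) \<Rightarrow> 'b topology" where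
  "quotient_topology X q =
     topology (\<lambda>U. U \<subseteq> q ` topspace X \<and> openin X {x \<in> topspace X. q x \<in> U})"

lemma openin_quotient_topology:
  "openin (quotient_topology X q) U \<longleftrightarrow>
     U \<subseteq> q ` topspace X \<and> openin X {x \<in> topspace X. q x \<in> U}"
proof -
  have "istopology (\<lambda>U. U \<subseteq> q ` topspace X \<and> openin X {x \<in> topspace X. q x \<in> U})"
    unfolding istopology_def
  proof (intro conjI allI impI)
    fix S T
    assume "S \<subseteq> q ` topspace X \<and> openin X {x \<in> topspace X. q x \<in> S}"
      "T \<subseteq> q ` topspace X \<and> openin X {x \<in> topspace X. q x \<in> T}"
    moreover have "{x \<in> topspace X. q x \<in> S \<inter> T} =
        {x \<in> topspace X. q x \<in> S} \<inter> {x \<in> topspace X. q x \<in> T}"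
      by blast
    ultimately show "S \<inter> T \<subseteq> q ` topspace X" "openin X {x \<in> topspace X. q x \<in> S \<inter> T}"
      by auto
  next
    fix \<K>
    assume K: "\<forall>S\<in>\<K>. S \<subseteq> q ` topspace X \<and> openin X {x \<in> topspace X. q x \<in> S}"
    have "{x \<in> topspace X. q x \<in> \<Union>\<K>} = (\<Union>S\<in>\<K>. {x \<in> topspace X. q x \<in> S})"
      by blast
    with K show "\<Union>\<K> \<subseteq> q ` topspace X" "openin X {x \<in> topspace X. q x \<in> \<Union>\<K>}"
      by auto
  qed
  then show ?thesis
    by (simp add: quotient_topology_def)
qed

lemma quotient_map_quotient_topology: "quotient_map X (quotient_topology X q) q"
proof -
  have "openin X {x \<in> topspace X. q x \<in> q ` topspace X}"
    by (metis (no_types, lifting) Collect_cong Collect_mem_eq imageI openin_topspace)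
  then have "topspace (quotient_topology X q) = q ` topspace X"
    by (metis openin_quotient_topology openin_subset openin_topspace subset_antisym subset_refl)
  then show ?thesis
    by (auto simp: quotient_map_def openin_quotient_topology)
qed

section \<open>Paths and the fundamental groupoid\<close>

abbreviation unit_interval :: "real topology" where
  "unit_interval \<equiv> top_of_set {0..1}"

definition path_space :: "'a topology \<Rightarrow> (real \<Rightarrow> 'a) topology" where
  "path_space X = mapping_space unit_interval X"

definition path_space_from :: "'a topology \<Rightarrow> 'a \<Rightarrow> (real \<Rightarrow> 'a) topology" where
  "path_space_from X x = subtopology (path_space X) {\<alpha>. \<alpha> 0 = x}"

definition path_space_between :: "'a topology \<Rightarrow> 'a \<Rightarrow> 'a \<Rightarrow> (real \<Rightarrow> 'a) topology" where
  "path_space_between X x1 x2 = subtopology (path_space X) {\<alpha>. \<alpha> 0 = x1 \<and> \<alpha> 1 = x2}"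

definition path_concat :: "(real \<Rightarrow> 'a) \<Rightarrow> (real \<Rightarrow> 'a) \<Rightarrow> real \<Rightarrow> 'a" where
  "path_concat \<alpha> \<beta> = (\<lambda>t\<in>{0..1}. if t \<le> 1/2 then \<alpha> (2 * t) else \<beta> (2 * t - 1))"

text \<open>The homotopy class of a path relative to its endpoints.\<close>

definition path_class :: "'a topology \<Rightarrow> (real \<Rightarrow> 'a) \<Rightarrow> (real \<Rightarrow> 'a) set" where
  "path_class X \<alpha> =
     {\<beta> \<in> topspace (path_space X).
        homotopic_with (\<lambda>\<gamma>. \<gamma> 0 = \<alpha> 0 \<and> \<gamma> 1 = \<alpha> 1) unit_interval X \<alpha> \<beta>}"

definition pi_hom :: "'a topology \<Rightarrow> 'a \<Rightarrow> 'a \<Rightarrow> (real \<Rightarrow> 'a) set set" where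
  "pi_hom X x1 x2 = path_class X ` topspace (path_space_between X x1 x2)"

text \<open>
  The union below is over classes that all coincide: \<open>[\<alpha>][\<beta>] = [\<alpha> \<cdot> \<beta>]\<close> for any choice of
  representatives.
\<close>

definition pi_comp ::
  "'a topology \<Rightarrow> (real \<Rightarrow> 'a) set \<Rightarrow> (real \<Rightarrow> 'a) set \<Rightarrow> (real \<Rightarrow> 'a) set" where
  "pi_comp X g h = (\<Union>\<alpha>\<in>g. \<Union>\<beta>\<in>h. path_class X (path_concat \<alpha> \<beta>))"

definition pi_one :: "'a topology \<Rightarrow> 'a \<Rightarrow> (real \<Rightarrow> 'a) set" where
  "pi_one X x = path_class X (\<lambda>t\<in>{0..1}. x)"

definition pi_group :: "'a topology \<Rightarrow> 'a \<Rightarrow> (real \<Rightarrow> 'a) set monoid" where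
  "pi_group X x = \<lparr>carrier = pi_hom X x x, mult = pi_comp X, one = pi_one X x\<rparr>"

definition pi_qtop :: "'a topology \<Rightarrow> 'a \<Rightarrow> 'a \<Rightarrow> (real \<Rightarrow> 'a) set topology" where
  "pi_qtop X x1 x2 = quotient_topology (path_space_between X x1 x2) (path_class X)"

section \<open>Free topological groups and the reflection \<open>\<tau>\<close>\<close>

definition topological_group :: "('g, 'z) monoid_scheme \<Rightarrow> 'g topology \<Rightarrow> bool" where
  "topological_group G T \<longleftrightarrow>
     group G \<and> topspace T = carrier G \<and>
     continuous_map (prod_topology T T) T (\<lambda>(g, h). g \<otimes>\<^bsub>G\<^esub> h) \<and>
     continuous_map T T (\<lambda>g. inv\<^bsub>G\<^esub> g)"

text \<open>
  Words over \<open>S\<close>: the letter \<open>(True, a)\<close> stands for the generator \<open>a\<close> and \<open>(False, a)\<close> for its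
  formal inverse.
\<close>

abbreviation words :: "'g set \<Rightarrow> (bool \<times> 'g) list set" where
  "words S \<equiv> lists (UNIV \<times> S)"

inductive word_eq :: "'g set \<Rightarrow> (bool \<times> 'g) list \<Rightarrow> (bool \<times> 'g) list \<Rightarrow> bool" for S where
  refl: "w \<in> words S \<Longrightarrow> word_eq S w w"
| sym: "word_eq S v w \<Longrightarrow> word_eq S w v"
| trans: "word_eq S u v \<Longrightarrow> word_eq S v w \<Longrightarrow> word_eq S u w"
| cancel: "u \<in> words S \<Longrightarrow> v \<in> words S \<Longrightarrow> a \<in> S \<Longrightarrow>
    word_eq S (u @ [(e, a), (\<not> e, a)] @ v) (u @ v)"

definition word_class :: "'g set \<Rightarrow> (bool \<times> 'g) list \<Rightarrow> (bool \<times> 'g) list set" where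
  "word_class S w = {v. word_eq S w v}"

definition free_group :: "'g set \<Rightarrow> (bool \<times> 'g) list set monoid" where
  "free_group S =
     \<lparr>carrier = word_class S ` words S,
      mult = (\<lambda>A B. \<Union>u\<in>A. \<Union>v\<in>B. word_class S (u @ v)),
      one = word_class S []\<rparr>"

definition free_gen :: "'g set \<Rightarrow> 'g \<Rightarrow> (bool \<times> 'g) list set" where
  "free_gen S a = word_class S [(True, a)]"

text \<open>
  The topology of the free (Markov) topological group on a space \<open>T\<close>: the finest group topology on
  the free group on the points of \<open>T\<close> for which the inclusion of generators is continuous, obtained
  as the supremum of all such topologies.  No separation axiom is imposed.
\<close>

definition markov_topology :: "'g topology \<Rightarrow> (bool \<times> 'g) list set topology" where
  "markov_topology T =
     topology_generated_by
       {U. \<exists>W. topological_group (free_group (topspace T)) W \<and>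
               continuous_map T W (free_gen (topspace T)) \<and> openin W U}"

fun word_eval :: "('g, 'z) monoid_scheme \<Rightarrow> (bool \<times> 'g) list \<Rightarrow> 'g" where
  "word_eval G [] = \<one>\<^bsub>G\<^esub>"
| "word_eval G ((e, a) # w) = (if e then a else inv\<^bsub>G\<^esub> a) \<otimes>\<^bsub>G\<^esub> word_eval G w"

text \<open>
  The homomorphism from the free group on \<open>carrier G\<close> to \<open>G\<close> induced by the identity; all words in
  a class have the same value.
\<close>

definition free_eval :: "('g, 'z) monoid_scheme \<Rightarrow> (bool \<times> 'g) list set \<Rightarrow> 'g" where
  "free_eval G A = the_elem (word_eval G ` A)"

definition tau_topology :: "('g, 'z) monoid_scheme \<Rightarrow> 'g topology \<Rightarrow> 'g topology" where
  "tau_topology G T = quotient_topology (markov_topology T) (free_eval G)"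

section \<open>The fundamental \<open>Top\<close>-groupoid\<close>

definition pi_tau_top :: "'a topology \<Rightarrow> 'a \<Rightarrow> 'a \<Rightarrow> (real \<Rightarrow> 'a) set topology" where
  "pi_tau_top X x1 x2 =
     (if x1 = x2 then tau_topology (pi_group X x1) (pi_qtop X x1 x1)
      else topology_generated_by
             {(\<lambda>u. pi_comp X u g) ` U |U g.
                openin (tau_topology (pi_group X x1) (pi_qtop X x1 x1)) U \<and> g \<in> pi_hom X x1 x2})"

definition pi_tau :: "'a topology \<Rightarrow> ('a, (real \<Rightarrow> 'a) set) top_cat_struct" where
  "pi_tau X =
     \<lparr>Obj = topspace X,
      Hom = pi_hom X,
      Ident = pi_one X,
      Comp = (\<lambda>_ _ _. pi_comp X),
      HomTop = pi_tau_top X\<rparr>"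

section \<open>Semicoverings\<close>

definition local_homeomorphism :: "'b topology \<Rightarrow> 'a topology \<Rightarrow> ('b \<Rightarrow> 'a) \<Rightarrow> bool" where
  "local_homeomorphism Y X p \<longleftrightarrow>
     continuous_map Y X p \<and>
     (\<forall>y\<in>topspace Y. \<exists>U. openin Y U \<and> y \<in> U \<and> openin X (p ` U) \<and>
        homeomorphic_map (subtopology Y U) (subtopology X (p ` U)) p)"

definition Delta2 :: "(real \<times> real) set" where
  "Delta2 = {(s, t). 0 \<le> s \<and> s \<le> 1 \<and> 0 \<le> t \<and> t \<le> 1 \<and> s + t \<le> 1}"

definition edge1 :: "(real \<times> real) set" where
  "edge1 = {(0, t) |t. 0 \<le> t \<and> t \<le> 1}"

definition Phi_from :: "'a topology \<Rightarrow> 'a \<Rightarrow> (real \<times> real \<Rightarrow> 'a) topology" where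
  "Phi_from X x = subtopology (mapping_space (top_of_set Delta2) X) {\<phi>. \<phi> ` edge1 = {x}}"

definition continuous_lifting_of_paths :: "'b topology \<Rightarrow> 'a topology \<Rightarrow> ('b \<Rightarrow> 'a) \<Rightarrow> bool" where
  "continuous_lifting_of_paths Y X p \<longleftrightarrow>
     (\<forall>y\<in>topspace Y. homeomorphic_map (path_space_from Y y) (path_space_from X (p y))
        (\<lambda>\<alpha>. compose {0..1} p \<alpha>))"

definition continuous_lifting_of_homotopies ::
  "'b topology \<Rightarrow> 'a topology \<Rightarrow> ('b \<Rightarrow> 'a) \<Rightarrow> bool" where
  "continuous_lifting_of_homotopies Y X p \<longleftrightarrow>
     (\<forall>y\<in>topspace Y. homeomorphic_map (Phi_from Y y) (Phi_from X (p y))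
        (\<lambda>\<phi>. compose Delta2 p \<phi>))"

definition semicovering :: "'b topology \<Rightarrow> 'a topology \<Rightarrow> ('b \<Rightarrow> 'a) \<Rightarrow> bool" where
  "semicovering Y X p \<longleftrightarrow>
     local_homeomorphism Y X p \<and>
     continuous_lifting_of_paths Y X p \<and> continuous_lifting_of_homotopies Y X p"

definition SCov :: "'a topology \<Rightarrow> ('b topology \<times> ('b \<Rightarrow> 'a), 'b \<Rightarrow> 'b) cat_struct" where
  "SCov X =
     \<lparr>Obj = {(Y, p). p \<in> extensional (topspace Y) \<and> semicovering Y X p},
      Hom = (\<lambda>(Y, p) (Y', p'). {f \<in> maps Y Y'. \<forall>y\<in>topspace Y. p' (f y) = p y}),
      Ident = (\<lambda>(Y, p). \<lambda>y\<in>topspace Y. y),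
      Comp = (\<lambda>(Y, p) _ _ f g. compose (topspace Y) g f)\<rparr>"

section \<open>Monodromy\<close>

definition fibre :: "'b topology \<Rightarrow> ('b \<Rightarrow> 'a) \<Rightarrow> 'a \<Rightarrow> 'b set" where
  "fibre Y p x = {y \<in> topspace Y. p y = x}"

definition path_lift :: "'b topology \<Rightarrow> ('b \<Rightarrow> 'a) \<Rightarrow> (real \<Rightarrow> 'a) \<Rightarrow> 'b \<Rightarrow> real \<Rightarrow> 'b" where
  "path_lift Y p \<alpha> y =
     (THE \<beta>. \<beta> \<in> topspace (path_space_from Y y) \<and> compose {0..1} p \<beta> = \<alpha>)"

text \<open>
  The action \<open>y \<cdot> [\<alpha>]\<close>; it does not depend on the representative because homotopies lift.
\<close>

definition monodromy_action :: "'b topology \<Rightarrow> ('b \<Rightarrow> 'a) \<Rightarrow> 'b \<Rightarrow> (real \<Rightarrow> 'a) set \<Rightarrow> 'b" where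
  "monodromy_action Y p y g = path_lift Y p (SOME \<alpha>. \<alpha> \<in> g) y 1"

definition monodromy_functor ::
  "'a topology \<Rightarrow> 'b topology \<times> ('b \<Rightarrow> 'a) \<Rightarrow>
   ('a, (real \<Rightarrow> 'a) set, 'b set, 'b \<Rightarrow> 'b) functor_struct" where
  "monodromy_functor X = (\<lambda>(Y, p).
     \<lparr>fobj = (\<lambda>x\<in>topspace X. fibre Y p x),
      farr = (\<lambda>(x1, x2, g)\<in>arrows (pi_tau X). \<lambda>y\<in>fibre Y p x1. monodromy_action Y p y g)\<rparr>)"

definition monodromy ::
  "'a topology \<Rightarrow>
   ('b topology \<times> ('b \<Rightarrow> 'a), 'b \<Rightarrow> 'b,
    ('a, (real \<Rightarrow> 'a) set, 'b set, 'b \<Rightarrow> 'b) functor_struct, 'a \<Rightarrow> 'b \<Rightarrow> 'b) functor_struct" where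
  "monodromy X =
     \<lparr>fobj = monodromy_functor X,
      farr = (\<lambda>((Y, p), _, f). \<lambda>x\<in>topspace X. restrict f (fibre Y p x))\<rparr>"

text \<open>
  The fibres of a map are pairwise disjoint, while the values \<open>F(x)\<close> of a set-valued functor may
  overlap (a constant functor, say).  On the level of objects the monodromy functor can therefore
  reach a general \<open>F\<close> only after each \<open>F(x)\<close> has been replaced by the copy \<open>{x} \<times> F(x)\<close>.
\<close>

definition disjoint_values ::
  "'a topology \<Rightarrow> ('a, 'm, 'b set, 'n) functor_struct \<Rightarrow> bool" where
  "disjoint_values X F \<longleftrightarrow> disjoint_family_on (fobj F) (topspace X)"

section \<open>Locally wep-connected spaces\<close>

definition well_ended :: "'a topology \<Rightarrow> (real \<Rightarrow> 'a) \<Rightarrow> bool" where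
  "well_ended X \<alpha> \<longleftrightarrow>
     \<alpha> \<in> topspace (path_space X) \<and>
     (\<forall>U. openin (path_space X) U \<and> \<alpha> \<in> U \<longrightarrow>
        (\<exists>V0 V1. openin X V0 \<and> \<alpha> 0 \<in> V0 \<and> openin X V1 \<and> \<alpha> 1 \<in> V1 \<and>
           (\<forall>a\<in>V0. \<forall>b\<in>V1. \<exists>\<beta>\<in>U. \<beta> 0 = a \<and> \<beta> 1 = b)))"

definition locally_well_ended :: "'a topology \<Rightarrow> (real \<Rightarrow> 'a) \<Rightarrow> bool" where
  "locally_well_ended X \<alpha> \<longleftrightarrow>
     \<alpha> \<in> topspace (path_space X) \<and>
     (\<forall>U. openin (path_space X) U \<and> \<alpha> \<in> U \<longrightarrow>
        (\<exists>V0 V1. openin X V0 \<and> \<alpha> 0 \<in> V0 \<and> openin X V1 \<and> \<alpha> 1 \<in> V1 \<and>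
           (\<forall>a\<in>V0. \<forall>b\<in>V1. \<exists>\<beta>\<in>U. well_ended X \<beta> \<and> \<beta> 0 = a \<and> \<beta> 1 = b)))"

definition locally_wep_connected :: "'a topology \<Rightarrow> bool" where
  "locally_wep_connected X \<longleftrightarrow>
     (\<forall>x\<in>topspace X. \<forall>y\<in>topspace X. \<exists>\<alpha>. locally_well_ended X \<alpha> \<and> \<alpha> 0 = x \<and> \<alpha> 1 = y)"

end

theory Submission
  imports Defs
begin

text \<open>
  Let \<open>F\<close> be a \<open>Top\<close>-functor with pairwise disjoint values.  The disjoint union of the values is given
  the finest topology for which all maps \<open>\<alpha> \<mapsto> u\<cdot>[\<alpha>]\<close>, \<open>u \<in> F(x)\<close>, on the space of paths starting at
  \<open>x\<close> are continuous.  That \<open>\<delta>\<cdot>\<gamma>\<^sup>-\<close> takes \<open>u\<close> to \<open>v\<close> is an open condition on \<open>\<delta>\<close> and \<open>\<gamma>\<close>; if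
  \<open>\<alpha>\<close> is a locally well-ended path, this makes \<open>u\<cdot>[\<gamma>]\<close> a function of the endpoint of \<open>\<gamma>\<close> for
  \<open>\<gamma>\<close> near \<open>\<alpha>\<close>, and the image of the resulting local section is open.  Hence the projection is a
  local homeomorphism; its fibres are separated by disjoint sheets, so the lift
  \<open>t \<mapsto> u\<cdot>[\<alpha>|[0,t]]\<close> is unique and depends continuously on \<open>\<alpha>\<close>.  Conversely, well-ended paths show
  that every semicovering of \<open>X\<close> carries this topology, so that it is recovered from its monodromy and
  natural transformations are continuous.

  The topology \<open>\<tau>\<close> enters only through two facts: it is coarser than the quotient topology, and it
  contains the stabilizer topology of every action with open point-to-point transporters, because that
  topology pulls back to a group topology on the free group.
\<close>

section \<open>Mapping spaces, paths and the fundamental groupoid\<close>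

lemma continuous_map_in_topspace:
  "continuous_map X Y f \<Longrightarrow> x \<in> topspace X \<Longrightarrow> f x \<in> topspace Y"
  by (auto simp: continuous_map_def)

lemma openin_mapping_space:
  assumes "compactin A K" "openin X U"
  shows "openin (mapping_space A X) {f \<in> maps A X. f ` K \<subseteq> U}"
  unfolding mapping_space_def by (rule topology_generated_by_Basis) (use assms in blast)

lemma continuous_map_apply:
  assumes A: "compact_space A" "Hausdorff_space A"
    and F: "continuous_map Z (mapping_space A X) F" and g: "continuous_map Z A g"
  shows "continuous_map Z X (\<lambda>z. F z (g z))"
proof -
  have Fm: "F z \<in> maps A X" if "z \<in> topspace Z" for z
    using F that by (metis continuous_map_image_subset_topspace image_subset_iff topspace_mapping_space)
  have gm: "g z \<in> topspace A" if "z \<in> topspace Z" for z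
    using continuous_map_image_subset_topspace[OF g] that by blast
  have "openin Z {z \<in> topspace Z. F z (g z) \<in> U}" if U: "openin X U" for U
  proof (subst openin_subopen, clarify)
    fix z assume z: "z \<in> topspace Z" "F z (g z) \<in> U"
    define N where "N = {a \<in> topspace A. F z a \<in> U}"
    have "openin A N"
      using Fm[OF z(1)] U unfolding N_def maps_def by (auto intro: openin_continuous_map_preimage)
    moreover have "g z \<in> N" using z gm by (auto simp: N_def)
    moreover have "regular_space A"
      using A by (simp add: compact_Hausdorff_or_regular_imp_normal_space normal_t1_imp_regular_space Hausdorff_imp_t1_space
          compact_Hausdorff_imp_regular_space)
    ultimately obtain V C where VC: "openin A V" "closedin A C" "g z \<in> V" "V \<subseteq> C" "C \<subseteq> N"
      by (metis neighbourhood_base_of neighbourhood_base_of_closedin)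
    have C: "compactin A C" using A VC by (simp add: closedin_compact_space)
    define T where "T = {w \<in> topspace Z. F w \<in> {f \<in> maps A X. f ` C \<subseteq> U}} \<inter> {w \<in> topspace Z. g w \<in> V}"
    have "openin Z T"
      unfolding T_def
      by (intro openin_Int openin_continuous_map_preimage[OF F] openin_continuous_map_preimage[OF g]
          openin_mapping_space C U VC(1))
    moreover have "z \<in> T" using z VC Fm unfolding T_def N_def by auto
    moreover have "T \<subseteq> {z \<in> topspace Z. F z (g z) \<in> U}" using VC unfolding T_def by auto
    ultimately show "\<exists>T. openin Z T \<and> z \<in> T \<and> T \<subseteq> {z \<in> topspace Z. F z (g z) \<in> U}" by blast
  qed
  moreover have "F z (g z) \<in> topspace X" if "z \<in> topspace Z" for z
    using Fm[OF that] gm[OF that] by (auto simp: maps_def continuous_map_def)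
  ultimately show ?thesis by (auto simp: continuous_map_def)
qed

lemma continuous_map_fst_compose:
  "continuous_map Z W H \<Longrightarrow> continuous_map (prod_topology Z V) W (\<lambda>q. H (fst q))"
  using continuous_map_compose[OF continuous_map_fst] by (fastforce simp: o_def)

lemma continuous_map_snd_compose:
  "continuous_map Z W H \<Longrightarrow> continuous_map (prod_topology V Z) W (\<lambda>q. H (snd q))"
  using continuous_map_compose[OF continuous_map_snd] by (fastforce simp: o_def)

lemma continuous_map_curry:
  assumes h: "continuous_map (prod_topology Z A) X h"
  shows "continuous_map Z (mapping_space A X) (\<lambda>z. \<lambda>a\<in>topspace A. h (z, a))"
proof -
  let ?f = "\<lambda>z. \<lambda>a\<in>topspace A. h (z, a)"
  have fm: "?f z \<in> maps A X" if "z \<in> topspace Z" for z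
  proof -
    have "continuous_map A X (h \<circ> (\<lambda>a. (z, a)))"
      by (rule continuous_map_compose[OF _ h]) (use that in \<open>simp add: continuous_map_pairedI\<close>)
    then have "continuous_map A X (?f z)" by (rule continuous_map_eq) simp
    then show ?thesis by (simp add: maps_def)
  qed
  have "openin Z (?f -` {f \<in> maps A X. f ` K \<subseteq> U} \<inter> topspace Z)"
    if K: "compactin A K" and U: "openin X U" for K U
  proof -
    have KA: "K \<subseteq> topspace A" using K by (simp add: compactin_subset_topspace)
    define C where "C = {q \<in> topspace (prod_topology Z (subtopology A K)). h q \<in> topspace X - U}"
    have "continuous_map (prod_topology Z (subtopology A K)) X h"
      using h by (metis continuous_map_from_subtopology prod_topology_subtopology(2))
    then have "closedin (prod_topology Z (subtopology A K)) C"
      unfolding C_def by (rule closedin_continuous_map_preimage) (use U in auto)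
    then have "closedin Z (fst ` C)"
      using closed_map_fst[of "subtopology A K" Z] K by (auto simp: compact_space_subtopology closed_map_def)
    moreover have "?f -` {f \<in> maps A X. f ` K \<subseteq> U} \<inter> topspace Z = topspace Z - fst ` C"
    proof -
      have "h (z, a) \<in> topspace X" if "z \<in> topspace Z" "a \<in> K" for z a
        using continuous_map_image_subset_topspace[OF h] that KA by auto
      then show ?thesis using fm KA by (force simp: C_def image_iff subset_iff)
    qed
    ultimately show ?thesis by auto
  qed
  moreover have "?f ` topspace Z \<subseteq> \<Union> {{f \<in> maps A X. f ` K \<subseteq> U} |K U. compactin A K \<and> openin X U}"
    using fm topspace_mapping_space[of A X] unfolding mapping_space_def topology_generated_by_topspace by auto
  ultimately show ?thesis
    unfolding mapping_space_def by (intro continuous_on_generated_topo) auto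
qed

abbreviation paths :: "'a topology \<Rightarrow> (real \<Rightarrow> 'a) set" where
  "paths X \<equiv> maps unit_interval X"

definition path_rev :: "(real \<Rightarrow> 'a) \<Rightarrow> real \<Rightarrow> 'a" where
  "path_rev \<alpha> = (\<lambda>t\<in>{0..1}. \<alpha> (1 - t))"

lemma paths_iff: "\<alpha> \<in> paths X \<longleftrightarrow> \<alpha> \<in> extensional {0..1} \<and> continuous_map unit_interval X \<alpha>"
  by (simp add: maps_def)

lemma topspace_path_space [simp]: "topspace (path_space X) = paths X"
  by (simp add: path_space_def topspace_mapping_space)

lemma topspace_path_space_from [simp]:
  "topspace (path_space_from X x) = {\<alpha> \<in> paths X. \<alpha> 0 = x}"
  by (auto simp: path_space_from_def)

lemma topspace_path_space_between [simp]:
  "topspace (path_space_between X x y) = {\<alpha> \<in> paths X. \<alpha> 0 = x \<and> \<alpha> 1 = y}"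
  by (auto simp: path_space_between_def)

lemma path_in_topspace: "\<alpha> \<in> paths X \<Longrightarrow> t \<in> {0..1} \<Longrightarrow> \<alpha> t \<in> topspace X"
  by (auto simp: paths_iff continuous_map_def)

lemma continuous_map_into_path_space_from:
  "continuous_map Z (path_space_from X x) F \<longleftrightarrow>
     continuous_map Z (path_space X) F \<and> (\<forall>z\<in>topspace Z. F z 0 = x)"
  by (auto simp: path_space_from_def continuous_map_in_subtopology)

lemma continuous_map_into_path_space_between:
  "continuous_map Z (path_space_between X x y) F \<longleftrightarrow>
     continuous_map Z (path_space X) F \<and> (\<forall>z\<in>topspace Z. F z 0 = x \<and> F z 1 = y)"
  by (auto simp: path_space_between_def continuous_map_in_subtopology)

lemma continuous_map_from_path_space_from:
  "continuous_map (path_space_from X x) (path_space X) (\<lambda>\<alpha>. \<alpha>)"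
  by (simp add: path_space_from_def continuous_map_from_subtopology)

lemma continuous_map_from_path_space_between:
  "continuous_map (path_space_between X x y) (path_space X) (\<lambda>\<alpha>. \<alpha>)"
  by (simp add: path_space_between_def continuous_map_from_subtopology)

lemma continuous_map_into_interval:
  "continuous_map Z (top_of_set S) f \<longleftrightarrow>
     continuous_map Z euclidean f \<and> (\<forall>z\<in>topspace Z. f z \<in> S)"
  by (auto simp: continuous_map_in_subtopology)

lemma compact_unit_interval: "compact_space unit_interval"
  by (simp add: compact_space_subtopology)

lemma continuous_map_path_apply:
  assumes "continuous_map Z (path_space X) F" "continuous_map Z unit_interval g"
  shows "continuous_map Z X (\<lambda>z. F z (g z))"
  by (rule continuous_map_apply[OF compact_unit_interval])
    (use assms in \<open>auto simp: path_space_def Hausdorff_space_subtopology\<close>)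

lemma continuous_map_path_curry:
  assumes "continuous_map (prod_topology Z unit_interval) X (\<lambda>(z, t). h z t)"
  shows "continuous_map Z (path_space X) (\<lambda>z. \<lambda>t\<in>{0..1}. h z t)"
  using continuous_map_curry[OF assms] by (simp add: path_space_def)

lemma continuous_map_path_eval:
  assumes "continuous_map Z (path_space X) F" "t \<in> {0..1}"
  shows "continuous_map Z X (\<lambda>z. F z t)"
  by (rule continuous_map_path_apply[OF assms(1)]) (use assms in auto)

lemma continuous_map_path_reparam:
  assumes F: "continuous_map Z (path_space X) F"
    and \<phi>: "continuous_map (prod_topology Z unit_interval) unit_interval (\<lambda>(z, t). \<phi> z t)"
  shows "continuous_map Z (path_space X) (\<lambda>z. \<lambda>t\<in>{0..1}. F z (\<phi> z t))"
proof (rule continuous_map_path_curry)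
  have "continuous_map (prod_topology Z unit_interval) X (\<lambda>q. F (fst q) ((\<lambda>(z, t). \<phi> z t) q))"
    by (rule continuous_map_path_apply[OF continuous_map_fst_compose[OF F] \<phi>])
  then show "continuous_map (prod_topology Z unit_interval) X (\<lambda>(z, t). F z (\<phi> z t))"
    by (simp add: case_prod_unfold)
qed

lemma continuous_map_path_concat:
  assumes F: "continuous_map Z (path_space X) F" and G: "continuous_map Z (path_space X) G"
    and eq: "\<And>z. z \<in> topspace Z \<Longrightarrow> F z 1 = G z 0"
  shows "continuous_map Z (path_space X) (\<lambda>z. path_concat (F z) (G z))"
  unfolding path_concat_def
proof (rule continuous_map_path_curry)
  let ?ZI = "prod_topology Z unit_interval"
  have fst: "continuous_map (subtopology ?ZI S) (path_space X) (\<lambda>q. H (fst q))"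
    if "continuous_map Z (path_space X) H" for S H
    by (rule continuous_map_from_subtopology) (rule continuous_map_fst_compose[OF that])
  have snd: "continuous_map (subtopology ?ZI S) euclideanreal snd" for S
    using continuous_map_snd[of Z unit_interval]
    by (intro continuous_map_from_subtopology) (auto simp: continuous_map_in_subtopology)
  have snd': "continuous_map ?ZI euclideanreal snd"
    using continuous_map_snd[of Z unit_interval] by (auto simp: continuous_map_in_subtopology)
  have "continuous_map ?ZI X (\<lambda>q. if snd q \<le> 1/2 then F (fst q) (2 * snd q) else G (fst q) (2 * snd q - 1))"
  proof (rule continuous_map_cases_le)
    show "continuous_map (subtopology ?ZI {x \<in> topspace ?ZI. snd x \<le> 1/2}) X (\<lambda>x. F (fst x) (2 * snd x))"
      by (rule continuous_map_path_apply[OF fst[OF F]])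
        (auto simp: continuous_map_into_interval intro!: continuous_intros snd)
    show "continuous_map (subtopology ?ZI {x \<in> topspace ?ZI. 1/2 \<le> snd x}) X (\<lambda>x. G (fst x) (2 * snd x - 1))"
      by (rule continuous_map_path_apply[OF fst[OF G]])
        (auto simp: continuous_map_into_interval intro!: continuous_intros snd)
    show "F (fst x) (2 * snd x) = G (fst x) (2 * snd x - 1)" if "x \<in> topspace ?ZI" "snd x = 1/2" for x
      using eq[of "fst x"] that by (auto simp: mult.commute)
  qed (use snd' in auto)
  then show "continuous_map ?ZI X (\<lambda>(z, t). if t \<le> 1 / 2 then F z (2 * t) else G z (2 * t - 1))"
    by (simp add: case_prod_unfold)
qed

lemma continuous_map_snd_real: "continuous_map (prod_topology Z (top_of_set S)) euclidean snd"
  using continuous_map_snd[of Z "top_of_set S"] by (auto simp: continuous_map_in_subtopology)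

lemma continuous_map_fst_real: "continuous_map (prod_topology (top_of_set S) Z) euclidean fst"
  using continuous_map_fst[of "top_of_set S" Z] by (auto simp: continuous_map_in_subtopology)

lemma continuous_map_path_rev:
  assumes "continuous_map Z (path_space X) F"
  shows "continuous_map Z (path_space X) (\<lambda>z. path_rev (F z))"
  unfolding path_rev_def
  by (rule continuous_map_path_reparam[OF assms])
    (auto simp: continuous_map_into_interval case_prod_unfold
       intro!: continuous_intros continuous_map_snd_real)

lemma path_concat_in_paths:
  assumes "\<alpha> \<in> paths X" "\<beta> \<in> paths X" "\<alpha> 1 = \<beta> 0"
  shows "path_concat \<alpha> \<beta> \<in> paths X"
  using continuous_map_in_topspace[OF continuous_map_path_concat[of "discrete_topology UNIV" X "\<lambda>_::unit. \<alpha>" "\<lambda>_. \<beta>"]] assms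
  by simp

lemma path_rev_in_paths: "\<alpha> \<in> paths X \<Longrightarrow> path_rev \<alpha> \<in> paths X"
  using continuous_map_in_topspace[OF continuous_map_path_rev[of "discrete_topology UNIV" X "\<lambda>_::unit. \<alpha>"]]
  by simp

lemma const_in_paths: "x \<in> topspace X \<Longrightarrow> (\<lambda>t\<in>{0..1}. x) \<in> paths X"
proof -
  assume "x \<in> topspace X"
  then have "continuous_map unit_interval X (\<lambda>_. x)" by simp
  then have "continuous_map unit_interval X (\<lambda>t\<in>{0..1}. x)" by (rule continuous_map_eq) simp
  then show ?thesis by (simp add: paths_iff)
qed

lemma reparam_in_paths:
  assumes "\<alpha> \<in> paths X" "continuous_map unit_interval unit_interval \<phi>"
  shows "(\<lambda>t\<in>{0..1}. \<alpha> (\<phi> t)) \<in> paths X"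
proof -
  have "continuous_map unit_interval X (\<alpha> \<circ> \<phi>)"
    by (rule continuous_map_compose) (use assms paths_iff in blast)+
  then have "continuous_map unit_interval X (\<lambda>t\<in>{0..1}. \<alpha> (\<phi> t))" by (rule continuous_map_eq) simp
  then show ?thesis by (simp add: paths_iff)
qed

lemma path_concat_ends [simp]:
  "path_concat \<alpha> \<beta> 0 = \<alpha> 0" "path_concat \<alpha> \<beta> 1 = \<beta> 1"
  by (simp_all add: path_concat_def)

lemma path_rev_ends [simp]: "path_rev \<alpha> 0 = \<alpha> 1" "path_rev \<alpha> 1 = \<alpha> 0"
  by (simp_all add: path_rev_def)

lemma path_rev_rev: "\<alpha> \<in> paths X \<Longrightarrow> path_rev (path_rev \<alpha>) = \<alpha>"
  by (rule ext) (auto simp: path_rev_def paths_iff extensional_def)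

lemma mem_path_class_iff:
  assumes \<alpha>: "\<alpha> \<in> paths X"
  shows "\<beta> \<in> path_class X \<alpha> \<longleftrightarrow>
    (\<exists>H. continuous_map unit_interval (path_space_between X (\<alpha> 0) (\<alpha> 1)) H \<and> H 0 = \<alpha> \<and> H 1 = \<beta>)"
proof
  assume "\<beta> \<in> path_class X \<alpha>"
  then obtain h where \<beta>: "\<beta> \<in> paths X"
    and h: "continuous_map (prod_topology unit_interval unit_interval) X h"
      "\<forall>x. h (0, x) = \<alpha> x" "\<forall>x. h (1, x) = \<beta> x" "\<forall>t\<in>{0..1}. h (t, 0) = \<alpha> 0 \<and> h (t, 1) = \<alpha> 1"
    by (auto simp: path_class_def homotopic_with_def)
  have "continuous_map unit_interval (path_space X) (\<lambda>t. \<lambda>s\<in>{0..1}. h (t, s))"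
    by (rule continuous_map_path_curry) (use h(1) in \<open>simp only: case_prod_eta\<close>)
  moreover have "(\<lambda>s\<in>{0..1}. h (0, s)) = \<alpha>" "(\<lambda>s\<in>{0..1}. h (1, s)) = \<beta>"
    using \<alpha> \<beta> h(2,3) by (auto simp: paths_iff intro: extensional_restrict)
  ultimately show "\<exists>H. continuous_map unit_interval (path_space_between X (\<alpha> 0) (\<alpha> 1)) H \<and> H 0 = \<alpha> \<and> H 1 = \<beta>"
    using h(4)
    by (intro exI[of _ "\<lambda>t. \<lambda>s\<in>{0..1}. h (t, s)"]) (simp add: continuous_map_into_path_space_between)
next
  assume "\<exists>H. continuous_map unit_interval (path_space_between X (\<alpha> 0) (\<alpha> 1)) H \<and> H 0 = \<alpha> \<and> H 1 = \<beta>"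
  then obtain H where H: "continuous_map unit_interval (path_space X) H" "H 0 = \<alpha>" "H 1 = \<beta>"
    "\<forall>t\<in>{0..1}. H t 0 = \<alpha> 0 \<and> H t 1 = \<alpha> 1"
    unfolding continuous_map_into_path_space_between topspace_euclidean_subtopology by blast
  have "continuous_map (prod_topology unit_interval unit_interval) X (\<lambda>q. H (fst q) (snd q))"
    by (rule continuous_map_path_apply[OF continuous_map_fst_compose[OF H(1)] continuous_map_snd])
  moreover have "\<beta> \<in> paths X" using continuous_map_in_topspace[OF H(1), of 1] H(3) by simp
  ultimately show "\<beta> \<in> path_class X \<alpha>"
    using H(2-4) unfolding path_class_def homotopic_with_def
    by (intro CollectI conjI exI[of _ "\<lambda>q. H (fst q) (snd q)"]) simp_all
qed

lemma path_class_refl: "\<alpha> \<in> paths X \<Longrightarrow> \<alpha> \<in> path_class X \<alpha>"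
  by (subst mem_path_class_iff) (auto simp: continuous_map_into_path_space_between intro!: exI[of _ "\<lambda>_. \<alpha>"])

lemma path_class_subset: "path_class X \<alpha> \<subseteq> paths X"
  by (auto simp: path_class_def)

lemma path_class_ends: "\<beta> \<in> path_class X \<alpha> \<Longrightarrow> \<beta> 0 = \<alpha> 0 \<and> \<beta> 1 = \<alpha> 1"
  by (auto simp: path_class_def dest: homotopic_with_imp_property)

lemma path_class_eq:
  assumes "\<beta> \<in> path_class X \<alpha>"
  shows "path_class X \<beta> = path_class X \<alpha>"
proof -
  have \<beta>: "homotopic_with (\<lambda>\<gamma>. \<gamma> 0 = \<alpha> 0 \<and> \<gamma> 1 = \<alpha> 1) unit_interval X \<alpha> \<beta>" "\<beta> 0 = \<alpha> 0" "\<beta> 1 = \<alpha> 1"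
    using assms path_class_ends[OF assms] by (simp_all add: path_class_def)
  then show ?thesis
    unfolding path_class_def \<beta>(2,3)
    using homotopic_with_trans[OF \<beta>(1)] homotopic_with_trans[OF homotopic_with_symD[OF \<beta>(1)]] by blast
qed

lemma path_class_eqI:
  assumes H: "continuous_map unit_interval (path_space_between X x y) H"
  shows "path_class X (H 0) = path_class X (H 1)"
proof -
  have "H 0 \<in> topspace (path_space_between X x y)"
    using continuous_map_image_subset_topspace[OF H] by force
  then have "H 1 \<in> path_class X (H 0)" using H by (auto simp: mem_path_class_iff)
  then show ?thesis using path_class_eq by blast
qed

lemma path_class_eqE:
  assumes "path_class X \<alpha> = path_class X \<beta>" "\<alpha> \<in> paths X" "\<beta> \<in> paths X"
  obtains H where "continuous_map unit_interval (path_space_between X (\<alpha> 0) (\<alpha> 1)) H"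
    "H 0 = \<alpha>" "H 1 = \<beta>"
proof -
  have "\<beta> \<in> path_class X \<alpha>" using path_class_refl[OF assms(3)] assms(1) by simp
  then show ?thesis using that mem_path_class_iff[OF assms(2)] by blast
qed

lemma path_class_eq_ends:
  assumes "path_class X \<alpha> = path_class X \<beta>" "\<alpha> \<in> paths X" 
  shows "\<alpha> 0 = \<beta> 0 \<and> \<alpha> 1 = \<beta> 1"
  using assms path_class_ends path_class_refl by metis

lemma path_class_concat_cong:
  assumes "path_class X \<alpha> = path_class X \<alpha>'" "path_class X \<beta> = path_class X \<beta>'"
    and "\<alpha> \<in> paths X" "\<alpha>' \<in> paths X" "\<beta> \<in> paths X" "\<beta>' \<in> paths X" "\<alpha> 1 = \<beta> 0"
  shows "path_class X (path_concat \<alpha> \<beta>) = path_class X (path_concat \<alpha>' \<beta>')"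
proof -
  obtain H where H: "continuous_map unit_interval (path_space_between X (\<alpha> 0) (\<alpha> 1)) H"
    "H 0 = \<alpha>" "H 1 = \<alpha>'" using path_class_eqE[OF assms(1,3,4)] .
  obtain K where K: "continuous_map unit_interval (path_space_between X (\<beta> 0) (\<beta> 1)) K"
    "K 0 = \<beta>" "K 1 = \<beta>'" using path_class_eqE[OF assms(2,5,6)] .
  have "continuous_map unit_interval (path_space_between X (\<alpha> 0) (\<beta> 1)) (\<lambda>t. path_concat (H t) (K t))"
    using H(1) K(1) assms(7) unfolding continuous_map_into_path_space_between
    by (auto intro!: continuous_map_path_concat)
  from path_class_eqI[OF this] show ?thesis by (simp add: H(2,3) K(2,3))
qed

text \<open>The interval is convex; every groupoid law below is an instance of this lemma.\<close>

lemma path_class_reparam: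
  assumes \<alpha>: "\<alpha> \<in> paths X"
    and \<phi>: "continuous_map unit_interval unit_interval \<phi>" and \<psi>: "continuous_map unit_interval unit_interval \<psi>"
    and eq: "\<phi> 0 = \<psi> 0" "\<phi> 1 = \<psi> 1"
  shows "path_class X (\<lambda>t\<in>{0..1}. \<alpha> (\<phi> t)) = path_class X (\<lambda>t\<in>{0..1}. \<alpha> (\<psi> t))"
proof -
  define H where "H = (\<lambda>s. \<lambda>t\<in>{0..1}. \<alpha> ((1 - s) * \<phi> t + s * \<psi> t))"
  have r: "\<phi> t \<in> {0..1}" "\<psi> t \<in> {0..1}" if "t \<in> {0..1}" for t
    using \<phi> \<psi> that by (auto simp: continuous_map_into_interval)
  have "continuous_map (prod_topology unit_interval unit_interval) euclideanreal (\<lambda>q. f (snd q))"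
    if "continuous_map unit_interval unit_interval f" for f
    by (rule continuous_map_snd_compose) (use that continuous_map_into_interval in blast)
  note c = this[OF \<phi>] this[OF \<psi>]
  have in01: "(1 - s) * \<phi> t + s * \<psi> t \<in> {0..1}" if "s \<in> {0..1}" "t \<in> {0..1}" for s t
    using convexD[OF convex_real_interval(5)[of 0 1] r[OF that(2)], of "1 - s" s] that by auto
  have "continuous_map unit_interval (path_space X) H"
    unfolding H_def
  proof (rule continuous_map_path_reparam)
    show "continuous_map unit_interval (path_space X) (\<lambda>s. \<alpha>)" using \<alpha> by simp
    show "continuous_map (prod_topology unit_interval unit_interval) unit_interval
       (\<lambda>(s, t). (1 - s) * \<phi> t + s * \<psi> t)"
      unfolding continuous_map_into_interval case_prod_unfold
      by (intro conjI ballI continuous_intros continuous_map_fst_real c) (use in01 in auto)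
  qed
  moreover have "H s 0 = \<alpha> (\<phi> 0)" "H s 1 = \<alpha> (\<phi> 1)" for s
    by (auto simp: H_def eq algebra_simps)
  ultimately have "continuous_map unit_interval (path_space_between X (\<alpha> (\<phi> 0)) (\<alpha> (\<phi> 1))) H"
    by (simp add: continuous_map_into_path_space_between)
  from path_class_eqI[OF this] show ?thesis by (simp add: H_def)
qed

lemma path_eq_reparam_id: "\<alpha> \<in> paths X \<Longrightarrow> (\<lambda>t\<in>{0..1}. \<alpha> t) = \<alpha>"
  by (auto simp: paths_iff extensional_def fun_eq_iff)

lemma path_class_assoc:
  assumes "\<alpha> \<in> paths X" "\<beta> \<in> paths X" "\<gamma> \<in> paths X" "\<alpha> 1 = \<beta> 0" "\<beta> 1 = \<gamma> 0"
  shows "path_class X (path_concat (path_concat \<alpha> \<beta>) \<gamma>) = path_class X (path_concat \<alpha> (path_concat \<beta> \<gamma>))"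
proof -
  let ?\<omega> = "path_concat \<alpha> (path_concat \<beta> \<gamma>)" and ?\<phi> = "\<lambda>t::real. min (2 * t) (min (t + 1/4) ((t + 1) / 2))"
  have \<omega>: "?\<omega> \<in> paths X" using assms by (intro path_concat_in_paths) auto
  have "path_concat (path_concat \<alpha> \<beta>) \<gamma> = (\<lambda>t\<in>{0..1}. ?\<omega> (?\<phi> t))"
  proof
    fix t :: real
    consider "t < 0" | "t > 1" | "0 \<le> t" "t \<le> 1/4" | "1/4 < t" "t \<le> 1/2" | "1/2 < t" "t \<le> 1" by linarith
    then show "path_concat (path_concat \<alpha> \<beta>) \<gamma> t = (\<lambda>t\<in>{0..1}. ?\<omega> (?\<phi> t)) t"
    proof cases
      case 3
      then have "?\<phi> t = 2 * t" by auto
      with 3 show ?thesis by (simp add: path_concat_def)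
    next
      case 4
      then have "?\<phi> t = t + 1/4" by auto
      with 4 show ?thesis by (simp add: path_concat_def algebra_simps)
    next
      case 5
      obtain u where u: "t = 2 * u - 1" by (rule that[of "(t + 1) / 2"]) (simp add: field_simps)
      with 5 have "?\<phi> t = u" by auto
      with 5 show ?thesis by (simp add: path_concat_def u)
    qed (auto simp: path_concat_def)
  qed
  moreover have "path_class X (\<lambda>t\<in>{0..1}. ?\<omega> (?\<phi> t)) = path_class X (\<lambda>t\<in>{0..1}. ?\<omega> t)"
    by (rule path_class_reparam[OF \<omega>]) (auto simp: continuous_map_into_interval min_le_iff_disj intro!: continuous_intros)
  ultimately show ?thesis by (simp add: path_eq_reparam_id[OF \<omega>])
qed

lemma path_class_const_left:
  assumes \<alpha>: "\<alpha> \<in> paths X" and x: "\<alpha> 0 = x"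
  shows "path_class X (path_concat (\<lambda>t\<in>{0..1}. x) \<alpha>) = path_class X \<alpha>"
proof -
  have "path_concat (\<lambda>t\<in>{0..1}. x) \<alpha> = (\<lambda>t\<in>{0..1}. \<alpha> (max 0 (2 * t - 1)))"
  proof
    fix t :: real
    consider "t < 1/2" | "t = 1/2" | "t > 1/2" by linarith
    then show "path_concat (\<lambda>t\<in>{0..1}. x) \<alpha> t = (\<lambda>t\<in>{0..1}. \<alpha> (max 0 (2 * t - 1))) t"
    proof cases
      case 2
      then show ?thesis using x by (auto simp: path_concat_def)
    qed (use x in \<open>auto simp: path_concat_def max_def\<close>)
  qed
  moreover have "path_class X (\<lambda>t\<in>{0..1}. \<alpha> (max 0 (2 * t - 1))) = path_class X (\<lambda>t\<in>{0..1}. \<alpha> t)"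
    by (rule path_class_reparam[OF \<alpha>]) (auto simp: continuous_map_into_interval intro!: continuous_intros)
  ultimately show ?thesis by (simp add: path_eq_reparam_id[OF \<alpha>])
qed

lemma path_class_rev_right:
  assumes \<alpha>: "\<alpha> \<in> paths X"
  shows "path_class X (path_concat \<alpha> (path_rev \<alpha>)) = path_class X (\<lambda>t\<in>{0..1}. \<alpha> 0)"
proof -
  have "path_concat \<alpha> (path_rev \<alpha>) = (\<lambda>t\<in>{0..1}. \<alpha> (min (2 * t) (2 - 2 * t)))"
  proof
    fix t :: real
    show "path_concat \<alpha> (path_rev \<alpha>) t = (\<lambda>t\<in>{0..1}. \<alpha> (min (2 * t) (2 - 2 * t))) t"
      by (cases "t \<le> 1/2") (auto simp: path_concat_def path_rev_def min_def algebra_simps)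
  qed
  moreover have "path_class X (\<lambda>t\<in>{0..1}. \<alpha> (min (2 * t) (2 - 2 * t))) = path_class X (\<lambda>t\<in>{0..1}. \<alpha> 0)"
    by (rule path_class_reparam[OF \<alpha>]) (auto simp: continuous_map_into_interval intro!: continuous_intros)
  ultimately show ?thesis by simp
qed

lemma path_class_rev_left:
  assumes \<alpha>: "\<alpha> \<in> paths X"
  shows "path_class X (path_concat (path_rev \<alpha>) \<alpha>) = path_class X (\<lambda>t\<in>{0..1}. \<alpha> 1)"
  using path_class_rev_right[OF path_rev_in_paths[OF \<alpha>]] by (simp add: path_rev_rev[OF \<alpha>])

lemma path_class_in_pi_hom: "\<alpha> \<in> paths X \<Longrightarrow> path_class X \<alpha> \<in> pi_hom X (\<alpha> 0) (\<alpha> 1)"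
  by (auto simp: pi_hom_def)

lemma pi_homE:
  assumes "g \<in> pi_hom X x y"
  obtains \<alpha> where "\<alpha> \<in> paths X" "\<alpha> 0 = x" "\<alpha> 1 = y" "g = path_class X \<alpha>"
  using assms by (auto simp: pi_hom_def)

lemma pi_comp_path_class:
  assumes "\<alpha> \<in> paths X" "\<beta> \<in> paths X" "\<alpha> 1 = \<beta> 0"
  shows "pi_comp X (path_class X \<alpha>) (path_class X \<beta>) = path_class X (path_concat \<alpha> \<beta>)"
proof -
  have "path_class X (path_concat \<alpha>' \<beta>') = path_class X (path_concat \<alpha> \<beta>)"
    if "\<alpha>' \<in> path_class X \<alpha>" "\<beta>' \<in> path_class X \<beta>" for \<alpha>' \<beta>'
    using that path_class_ends[OF that(1)] path_class_ends[OF that(2)] assms path_class_subset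
    by (intro path_class_concat_cong) (auto simp: path_class_eq)
  then show ?thesis using path_class_refl assms unfolding pi_comp_def by blast
qed

lemma pi_comp_in_pi_hom:
  assumes "g \<in> pi_hom X x y" "h \<in> pi_hom X y z"
  shows "pi_comp X g h \<in> pi_hom X x z"
proof -
  obtain \<alpha> where \<alpha>: "\<alpha> \<in> paths X" "\<alpha> 0 = x" "\<alpha> 1 = y" "g = path_class X \<alpha>" by (rule pi_homE[OF assms(1)])
  obtain \<beta> where \<beta>: "\<beta> \<in> paths X" "\<beta> 0 = y" "\<beta> 1 = z" "h = path_class X \<beta>" by (rule pi_homE[OF assms(2)])
  show ?thesis
    using path_class_in_pi_hom[OF path_concat_in_paths[of \<alpha> X \<beta>]] \<alpha> \<beta> by (simp add: pi_comp_path_class)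
qed

lemma pi_comp_assoc:
  assumes "g \<in> pi_hom X x y" "h \<in> pi_hom X y z" "k \<in> pi_hom X z w"
  shows "pi_comp X (pi_comp X g h) k = pi_comp X g (pi_comp X h k)"
proof -
  obtain \<alpha> where \<alpha>: "\<alpha> \<in> paths X" "\<alpha> 0 = x" "\<alpha> 1 = y" "g = path_class X \<alpha>" by (rule pi_homE[OF assms(1)])
  obtain \<beta> where \<beta>: "\<beta> \<in> paths X" "\<beta> 0 = y" "\<beta> 1 = z" "h = path_class X \<beta>" by (rule pi_homE[OF assms(2)])
  obtain \<gamma> where \<gamma>: "\<gamma> \<in> paths X" "\<gamma> 0 = z" "\<gamma> 1 = w" "k = path_class X \<gamma>" by (rule pi_homE[OF assms(3)])
  show ?thesis using \<alpha> \<beta> \<gamma> by (simp add: pi_comp_path_class path_concat_in_paths path_class_assoc)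
qed

lemma pi_one_in_pi_hom: "x \<in> topspace X \<Longrightarrow> pi_one X x \<in> pi_hom X x x"
  using path_class_in_pi_hom[OF const_in_paths] by (fastforce simp: pi_one_def)

lemma pi_comp_one_left:
  assumes "g \<in> pi_hom X x y"
  shows "pi_comp X (pi_one X x) g = g"
proof -
  obtain \<alpha> where \<alpha>: "\<alpha> \<in> paths X" "\<alpha> 0 = x" "\<alpha> 1 = y" "g = path_class X \<alpha>" by (rule pi_homE[OF assms])
  moreover have "x \<in> topspace X" using path_in_topspace[of \<alpha> X 0] \<alpha> by simp
  ultimately show ?thesis
    by (simp add: pi_one_def pi_comp_path_class const_in_paths path_class_const_left)
qed

lemma pi_hom_inverse:
  assumes "g \<in> pi_hom X x y"
  shows "\<exists>h\<in>pi_hom X y x. pi_comp X h g = pi_one X y \<and> pi_comp X g h = pi_one X x"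
proof -
  obtain \<alpha> where \<alpha>: "\<alpha> \<in> paths X" "\<alpha> 0 = x" "\<alpha> 1 = y" "g = path_class X \<alpha>" by (rule pi_homE[OF assms])
  then show ?thesis
    using path_class_in_pi_hom[OF path_rev_in_paths[OF \<alpha>(1)]]
    by (intro bexI[of _ "path_class X (path_rev \<alpha>)"])
      (auto simp: pi_one_def pi_comp_path_class path_rev_in_paths path_class_rev_left path_class_rev_right)
qed

lemma group_pi_group:
  assumes "x \<in> topspace X"
  shows "group (pi_group X x)"
proof (rule groupI; unfold pi_group_def monoid.simps partial_object.simps)
  show "pi_comp X g h \<in> pi_hom X x x" if "g \<in> pi_hom X x x" "h \<in> pi_hom X x x" for g h
    using that by (rule pi_comp_in_pi_hom)
  show "pi_one X x \<in> pi_hom X x x" using assms by (rule pi_one_in_pi_hom)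
  show "pi_comp X (pi_comp X g h) k = pi_comp X g (pi_comp X h k)"
    if "g \<in> pi_hom X x x" "h \<in> pi_hom X x x" "k \<in> pi_hom X x x" for g h k
    using that by (rule pi_comp_assoc)
  show "pi_comp X (pi_one X x) g = g" if "g \<in> pi_hom X x x" for g
    using that by (rule pi_comp_one_left)
  show "\<exists>h\<in>pi_hom X x x. pi_comp X h g = pi_one X x" if "g \<in> pi_hom X x x" for g
    using pi_hom_inverse[OF that] by blast
qed

section \<open>Free groups and the topology \<open>\<tau>\<close>\<close>

lemma word_eq_words: "word_eq S u v \<Longrightarrow> u \<in> words S \<and> v \<in> words S"
  by (induction rule: word_eq.induct) auto

lemma word_eq_append_right:
  "word_eq S u v \<Longrightarrow> w \<in> words S \<Longrightarrow> word_eq S (u @ w) (v @ w)"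
proof (induction rule: word_eq.induct)
  case (cancel u v a e)
  then show ?case using word_eq.cancel[of u S "v @ w" a e] by simp
next
  case (refl u)
  then show ?case by (intro word_eq.refl) simp
qed (blast intro: word_eq.intros)+

lemma word_eq_append_left:
  "word_eq S u v \<Longrightarrow> w \<in> words S \<Longrightarrow> word_eq S (w @ u) (w @ v)"
proof (induction rule: word_eq.induct)
  case (cancel u v a e)
  then show ?case using word_eq.cancel[of "w @ u" S v a e] by simp
next
  case (refl u)
  then show ?case by (intro word_eq.refl) simp
qed (blast intro: word_eq.intros)+

lemma word_eq_append:
  assumes "word_eq S u u'" "word_eq S v v'"
  shows "word_eq S (u @ v) (u' @ v')"
  by (rule word_eq.trans[OF word_eq_append_right[OF assms(1)] word_eq_append_left[OF assms(2)]])
    (use word_eq_words assms in blast)+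

lemma word_class_eq_iff:
  "u \<in> words S \<Longrightarrow> word_class S u = word_class S v \<longleftrightarrow> word_eq S u v"
  unfolding word_class_def by (blast intro: word_eq.intros)

lemma free_group_mult:
  assumes "u \<in> words S" "v \<in> words S"
  shows "word_class S u \<otimes>\<^bsub>free_group S\<^esub> word_class S v = word_class S (u @ v)"
proof -
  have "word_class S (u' @ v') = word_class S (u @ v)"
    if "u' \<in> word_class S u" "v' \<in> word_class S v" for u' v'
    using that assms word_eq_append[of S u u' v v']
    by (metis append_in_lists_conv mem_Collect_eq word_class_def word_class_eq_iff)
  moreover have "u \<in> word_class S u" "v \<in> word_class S v"
    using assms by (auto simp: word_class_def intro: word_eq.refl)
  ultimately show ?thesis unfolding free_group_def monoid.simps by blast
qed

lemma word_eq_inverse: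
  "w \<in> words S \<Longrightarrow> word_eq S (rev (map (\<lambda>(e, a). (\<not> e, a)) w) @ w) []"
proof (induction w)
  case (Cons x w)
  obtain e a where x: "x = (e, a)" by fastforce
  let ?v = "rev (map (\<lambda>(e, a). (\<not> e, a)) w)"
  have "word_eq S (?v @ [(\<not> e, a), (\<not> \<not> e, a)] @ w) (?v @ w)"
    using Cons.prems x by (intro word_eq.cancel) auto
  with Cons x show ?case by (auto intro: word_eq.trans)
qed (auto intro: word_eq.refl)

lemma group_free_group: "group (free_group S)"
proof (rule groupI)
  have carrierE: "\<exists>w\<in>words S. A = word_class S w" if "A \<in> carrier (free_group S)" for A
    using that by (auto simp: free_group_def)
  have carrierI: "word_class S w \<in> carrier (free_group S)" if "w \<in> words S" for w
    using that by (auto simp: free_group_def)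
  have one: "\<one>\<^bsub>free_group S\<^esub> = word_class S []" by (simp add: free_group_def)
  show "A \<otimes>\<^bsub>free_group S\<^esub> B \<in> carrier (free_group S)"
    if AB: "A \<in> carrier (free_group S)" "B \<in> carrier (free_group S)" for A B
  proof -
    obtain u v where "u \<in> words S" "v \<in> words S" "A = word_class S u" "B = word_class S v"
      using AB[THEN carrierE] by blast
    then show ?thesis using carrierI[of "u @ v"] by (simp add: free_group_mult)
  qed
  show "\<one>\<^bsub>free_group S\<^esub> \<in> carrier (free_group S)" by (simp add: one carrierI)
  show "A \<otimes>\<^bsub>free_group S\<^esub> B \<otimes>\<^bsub>free_group S\<^esub> C = A \<otimes>\<^bsub>free_group S\<^esub> (B \<otimes>\<^bsub>free_group S\<^esub> C)"
    if AB: "A \<in> carrier (free_group S)" "B \<in> carrier (free_group S)" "C \<in> carrier (free_group S)" for A B C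
  proof -
    obtain u v w where "u \<in> words S" "v \<in> words S" "w \<in> words S"
      "A = word_class S u" "B = word_class S v" "C = word_class S w"
      using AB[THEN carrierE] by blast
    then show ?thesis by (simp add: free_group_mult)
  qed
  show "\<one>\<^bsub>free_group S\<^esub> \<otimes>\<^bsub>free_group S\<^esub> A = A" if A: "A \<in> carrier (free_group S)" for A
  proof -
    obtain w where "w \<in> words S" "A = word_class S w" using carrierE[OF A] by blast
    then show ?thesis using free_group_mult[of "[]" S w] by (simp add: one)
  qed
  show "\<exists>B\<in>carrier (free_group S). B \<otimes>\<^bsub>free_group S\<^esub> A = \<one>\<^bsub>free_group S\<^esub>"
    if A: "A \<in> carrier (free_group S)" for A
  proof -
    obtain w where w: "w \<in> words S" "A = word_class S w" using carrierE[OF A] by blast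
    let ?v = "rev (map (\<lambda>(e, a). (\<not> e, a)) w)"
    have v: "?v \<in> words S" using w(1) by (force simp: in_lists_conv_set)
    then have "word_class S (?v @ w) = word_class S []"
      using word_eq_inverse[OF w(1)] word_class_eq_iff[of "?v @ w" S "[]"] w(1) by simp
    then show ?thesis
      using free_group_mult[OF v w(1)] carrierI[OF v] w(2) one by auto
  qed
qed

lemma word_eval_in_carrier:
  "group G \<Longrightarrow> w \<in> words (carrier G) \<Longrightarrow> word_eval G w \<in> carrier G"
  by (induction w) (auto simp: group.is_monoid monoid.m_closed group.inv_closed)

lemma word_eval_append:
  "group G \<Longrightarrow> u \<in> words (carrier G) \<Longrightarrow> v \<in> words (carrier G) \<Longrightarrow>
     word_eval G (u @ v) = word_eval G u \<otimes>\<^bsub>G\<^esub> word_eval G v"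
proof (induction u)
  case (Cons x u)
  obtain e a where x: "x = (e, a)" by fastforce
  have "(if e then a else inv\<^bsub>G\<^esub> a) \<in> carrier G" using Cons.prems x by simp
  then show ?case
    using Cons x by (simp add: monoid.m_assoc group.is_monoid word_eval_in_carrier)
qed (simp add: group.is_monoid monoid.l_one word_eval_in_carrier)

lemma word_eval_eq:
  assumes G: "group G"
  shows "word_eq (carrier G) u v \<Longrightarrow> word_eval G u = word_eval G v"
proof (induction rule: word_eq.induct)
  case (cancel u v a e)
  interpret group G by fact
  have "word_eval G [(e, a), (\<not> e, a)] = \<one>\<^bsub>G\<^esub>" using cancel by (cases e) auto
  moreover have "word_eval G ([(e, a), (\<not> e, a)] @ v) = word_eval G [(e, a), (\<not> e, a)] \<otimes>\<^bsub>G\<^esub> word_eval G v"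
    using cancel by (intro word_eval_append G) auto
  ultimately show ?case
    using cancel word_eval_append[OF G, of u "[(e, a), (\<not> e, a)] @ v"] word_eval_append[OF G, of u v]
      word_eval_in_carrier[OF G, of v] by simp
qed auto

lemma free_eval_word_class:
  assumes "group G" "w \<in> words (carrier G)"
  shows "free_eval G (word_class (carrier G) w) = word_eval G w"
proof -
  have "word_eval G v = word_eval G w" if "v \<in> word_class (carrier G) w" for v
    using word_eval_eq[OF assms(1), of w v] that by (simp add: word_class_def)
  moreover have "w \<in> word_class (carrier G) w"
    using word_eq.refl[OF assms(2)] by (simp add: word_class_def)
  ultimately have "word_eval G ` word_class (carrier G) w = {word_eval G w}" by blast
  then show ?thesis by (simp add: free_eval_def)
qed

lemma free_eval_hom:
  assumes G: "group G"
  shows "free_eval G \<in> hom (free_group (carrier G)) G"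
proof (rule homI)
  fix A B assume A: "A \<in> carrier (free_group (carrier G))" and B: "B \<in> carrier (free_group (carrier G))"
  obtain u where u: "u \<in> words (carrier G)" "A = word_class (carrier G) u"
    using A by (auto simp: free_group_def)
  obtain v where v: "v \<in> words (carrier G)" "B = word_class (carrier G) v"
    using B by (auto simp: free_group_def)
  show "free_eval G A \<in> carrier G" using u G by (simp add: free_eval_word_class word_eval_in_carrier)
  have "u @ v \<in> words (carrier G)" using u v by simp
  then show "free_eval G (A \<otimes>\<^bsub>free_group (carrier G)\<^esub> B) = free_eval G A \<otimes>\<^bsub>G\<^esub> free_eval G B"
    using u v G by (simp add: free_eval_word_class free_group_mult word_eval_append del: append_in_lists_conv)
qed

lemma free_gen_in_carrier: "a \<in> S \<Longrightarrow> free_gen S a \<in> carrier (free_group S)"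
  by (auto simp: free_gen_def free_group_def)

lemma free_eval_free_gen: "group G \<Longrightarrow> a \<in> carrier G \<Longrightarrow> free_eval G (free_gen (carrier G) a) = a"
  by (simp add: free_gen_def free_eval_word_class group.is_monoid monoid.r_one)

definition action_topology ::
  "('g, 'z) monoid_scheme \<Rightarrow> ('g \<Rightarrow> 'b \<Rightarrow> 'b) \<Rightarrow> 'b set \<Rightarrow> 'g topology" where
  "action_topology G \<rho> B =
     topology_generated_by (insert (carrier G) {{g \<in> carrier G. \<rho> g b = c} |b c. b \<in> B \<and> c \<in> B})"

lemma topspace_action_topology: "topspace (action_topology G \<rho> B) = carrier G"
  by (auto simp: action_topology_def)

lemma openin_action_topology:
  "b \<in> B \<Longrightarrow> c \<in> B \<Longrightarrow> openin (action_topology G \<rho> B) {g \<in> carrier G. \<rho> g b = c}"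
  unfolding action_topology_def by (rule topology_generated_by_Basis) blast

lemma topological_group_action_topology:
  assumes G: "group G"
    and B: "\<And>g b. g \<in> carrier G \<Longrightarrow> b \<in> B \<Longrightarrow> \<rho> g b \<in> B"
    and mult: "\<And>g h b. g \<in> carrier G \<Longrightarrow> h \<in> carrier G \<Longrightarrow> b \<in> B \<Longrightarrow> \<rho> (g \<otimes>\<^bsub>G\<^esub> h) b = \<rho> h (\<rho> g b)"
    and one: "\<And>b. b \<in> B \<Longrightarrow> \<rho> \<one>\<^bsub>G\<^esub> b = b"
  shows "topological_group G (action_topology G \<rho> B)"
proof -
  interpret group G by fact
  let ?T = "action_topology G \<rho> B"
  have carrier: "openin ?T (carrier G)"
    using openin_topspace[of ?T] by (simp add: topspace_action_topology)
  have "continuous_map (prod_topology ?T ?T) ?T (\<lambda>(g, h). g \<otimes>\<^bsub>G\<^esub> h)"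
    unfolding action_topology_def[of G]
  proof (rule continuous_on_generated_topo; fold action_topology_def)
    fix U assume "U \<in> insert (carrier G) {{g \<in> carrier G. \<rho> g b = c} |b c. b \<in> B \<and> c \<in> B}"
    then consider "U = carrier G" | b c where "b \<in> B" "c \<in> B" "U = {g \<in> carrier G. \<rho> g b = c}" by blast
    then show "openin (prod_topology ?T ?T) ((\<lambda>(g, h). g \<otimes>\<^bsub>G\<^esub> h) -` U \<inter> topspace (prod_topology ?T ?T))"
    proof cases
      case 1
      then have "(\<lambda>(g, h). g \<otimes>\<^bsub>G\<^esub> h) -` U \<inter> topspace (prod_topology ?T ?T) = topspace (prod_topology ?T ?T)"
        by (auto simp: topspace_action_topology)
      then show ?thesis by (metis openin_topspace)
    next
      case 2
      then have "(\<lambda>(g, h). g \<otimes>\<^bsub>G\<^esub> h) -` U \<inter> topspace (prod_topology ?T ?T) =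
          (\<Union>d\<in>B. {g \<in> carrier G. \<rho> g b = d} \<times> {g \<in> carrier G. \<rho> g d = c})"
        using B by (auto simp: topspace_action_topology mult)
      moreover have "openin (prod_topology ?T ?T) \<dots>"
        using 2 by (intro openin_Union) (auto simp: openin_prod_Times_iff openin_action_topology)
      ultimately show ?thesis by simp
    qed
  qed (auto simp: topspace_action_topology)
  moreover have "continuous_map ?T ?T (\<lambda>g. inv\<^bsub>G\<^esub> g)"
    unfolding action_topology_def[of G]
  proof (rule continuous_on_generated_topo; fold action_topology_def)
    fix U assume "U \<in> insert (carrier G) {{g \<in> carrier G. \<rho> g b = c} |b c. b \<in> B \<and> c \<in> B}"
    then consider "U = carrier G" | b c where "b \<in> B" "c \<in> B" "U = {g \<in> carrier G. \<rho> g b = c}" by blast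
    then show "openin ?T ((\<lambda>g. inv\<^bsub>G\<^esub> g) -` U \<inter> topspace ?T)"
    proof cases
      case 1
      then have "(\<lambda>g. inv\<^bsub>G\<^esub> g) -` U \<inter> topspace ?T = carrier G"
        by (auto simp: topspace_action_topology)
      then show ?thesis by (simp add: carrier)
    next
      case 2
      have "\<rho> (inv\<^bsub>G\<^esub> g) b = c \<longleftrightarrow> \<rho> g c = b" if "g \<in> carrier G" for g
        using mult[of "inv\<^bsub>G\<^esub> g" g b] mult[of g "inv\<^bsub>G\<^esub> g" c] 2 one that by auto
      then have "(\<lambda>g. inv\<^bsub>G\<^esub> g) -` U \<inter> topspace ?T = {g \<in> carrier G. \<rho> g c = b}"
        using 2(3) by (auto simp: topspace_action_topology)
      then show ?thesis using 2 by (simp add: openin_action_topology)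
    qed
  qed (auto simp: topspace_action_topology)
  ultimately show ?thesis using G by (simp add: topological_group_def topspace_action_topology)
qed

lemma topspace_markov_topology_subset: "topspace (markov_topology T) \<subseteq> carrier (free_group (topspace T))"
  unfolding markov_topology_def topology_generated_by_topspace
  by (auto simp: topological_group_def dest: openin_subset)

lemma openin_markov_topology:
  assumes "topological_group (free_group (topspace T)) W" "continuous_map T W (free_gen (topspace T))"
    and "openin W U"
  shows "openin (markov_topology T) U"
  unfolding markov_topology_def by (rule topology_generated_by_Basis) (use assms in blast)

lemma topspace_markov_topology: "topspace (markov_topology T) = carrier (free_group (topspace T))"
proof
  let ?G = "free_group (topspace T)" and ?\<rho> = "\<lambda>_ b. b :: unit"
  let ?W = "action_topology ?G ?\<rho> {}"
  have W: "topological_group ?G ?W"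
    by (rule topological_group_action_topology[OF group_free_group]) auto
  have "continuous_map T ?W (free_gen (topspace T))"
    unfolding action_topology_def
  proof (rule continuous_on_generated_topo)
    fix U assume "U \<in> insert (carrier ?G) {{g \<in> carrier ?G. b = c} |b c. b \<in> {} \<and> c \<in> ({} :: unit set)}"
    then have "free_gen (topspace T) -` U \<inter> topspace T = topspace T" by (auto simp: free_gen_in_carrier)
    then show "openin T (free_gen (topspace T) -` U \<inter> topspace T)" by simp
  qed (auto simp: free_gen_in_carrier)
  moreover have "openin ?W (carrier ?G)"
    using openin_topspace[of ?W] by (simp add: topspace_action_topology)
  ultimately show "carrier ?G \<subseteq> topspace (markov_topology T)"
    by (intro openin_subset) (rule openin_markov_topology[OF W])
qed (rule topspace_markov_topology_subset)

lemma openin_free_gen_preimage: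
  assumes "openin (markov_topology T) U"
  shows "openin T {a \<in> topspace T. free_gen (topspace T) a \<in> U}"
proof -
  let ?S = "{U. \<exists>W. topological_group (free_group (topspace T)) W \<and>
               continuous_map T W (free_gen (topspace T)) \<and> openin W U}"
  have "generate_topology_on ?S U"
    using assms unfolding markov_topology_def openin_topology_generated_by_iff .
  then show ?thesis
  proof induction
    case (Int V W)
    have "{a \<in> topspace T. free_gen (topspace T) a \<in> V \<inter> W} =
      {a \<in> topspace T. free_gen (topspace T) a \<in> V} \<inter> {a \<in> topspace T. free_gen (topspace T) a \<in> W}" by blast
    with Int show ?case by auto
  next
    case (UN K)
    have "{a \<in> topspace T. free_gen (topspace T) a \<in> \<Union> K} =
      (\<Union>V\<in>K. {a \<in> topspace T. free_gen (topspace T) a \<in> V})" by blast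
    with UN show ?case by auto
  next
    case (Basis V)
    then show ?case by (auto intro: openin_continuous_map_preimage)
  qed simp
qed

lemma openin_tau_topology_subset:
  assumes G: "group G" and T: "topspace T = carrier G" and U: "openin (tau_topology G T) U"
  shows "U \<subseteq> carrier G"
proof -
  have "U \<subseteq> free_eval G ` topspace (markov_topology T)"
    using U by (simp add: tau_topology_def openin_quotient_topology)
  then show ?thesis
    using topspace_markov_topology_subset[of T] hom_in_carrier[OF free_eval_hom[OF G]] T by fastforce
qed

lemma topspace_tau_topology:
  assumes G: "group G" and T: "topspace T = carrier G"
  shows "topspace (tau_topology G T) = carrier G"
proof
  show "topspace (tau_topology G T) \<subseteq> carrier G" by (rule openin_tau_topology_subset[OF G T openin_topspace])
  have "topspace (tau_topology G T) = free_eval G ` topspace (markov_topology T)"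
    using quotient_imp_surjective_map[OF quotient_map_quotient_topology[of "markov_topology T" "free_eval G"]]
    unfolding tau_topology_def by simp
  moreover have "g \<in> free_eval G ` topspace (markov_topology T)" if "g \<in> carrier G" for g
    by (rule image_eqI[of _ _ "free_gen (carrier G) g"])
      (use that T in \<open>simp_all add: topspace_markov_topology free_gen_in_carrier free_eval_free_gen[OF G]\<close>)
  ultimately show "carrier G \<subseteq> topspace (tau_topology G T)" by blast
qed

lemma openin_tau_topologyD:
  assumes G: "group G" and T: "topspace T = carrier G" and U: "openin (tau_topology G T) U"
  shows "openin T U"
proof -
  let ?P = "{A \<in> topspace (markov_topology T). free_eval G A \<in> U}"
  have "openin (markov_topology T) ?P"
    using U by (simp add: tau_topology_def openin_quotient_topology)
  then have op: "openin T {a \<in> topspace T. free_gen (topspace T) a \<in> ?P}" by (rule openin_free_gen_preimage)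
  have "{a \<in> topspace T. free_gen (topspace T) a \<in> ?P} = U"
    using openin_tau_topology_subset[OF G T U] T
    by (auto simp: topspace_markov_topology free_gen_in_carrier free_eval_free_gen[OF G])
  with op show ?thesis by simp
qed

lemma openin_tau_topology_action:
  assumes G: "group G" and T: "topspace T = carrier G"
    and B: "\<And>g b. g \<in> carrier G \<Longrightarrow> b \<in> B \<Longrightarrow> \<rho> g b \<in> B"
    and mult: "\<And>g h b. g \<in> carrier G \<Longrightarrow> h \<in> carrier G \<Longrightarrow> b \<in> B \<Longrightarrow> \<rho> (g \<otimes>\<^bsub>G\<^esub> h) b = \<rho> h (\<rho> g b)"
    and one: "\<And>b. b \<in> B \<Longrightarrow> \<rho> \<one>\<^bsub>G\<^esub> b = b"
    and op: "\<And>b c. b \<in> B \<Longrightarrow> c \<in> B \<Longrightarrow> openin T {g \<in> carrier G. \<rho> g b = c}"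
    and bc: "b \<in> B" "c \<in> B"
  shows "openin (tau_topology G T) {g \<in> carrier G. \<rho> g b = c}"
proof -
  let ?F = "free_group (carrier G)" and ?\<sigma> = "\<lambda>A. \<rho> (free_eval G A)"
  let ?W = "action_topology ?F ?\<sigma> B"
  have hom: "free_eval G \<in> hom ?F G" by (rule free_eval_hom[OF G])
  have one': "free_eval G \<one>\<^bsub>?F\<^esub> = \<one>\<^bsub>G\<^esub>"
    by (rule hom_one[OF hom group_free_group G])
  have W: "topological_group ?F ?W"
    by (rule topological_group_action_topology[OF group_free_group])
      (use B mult one hom_in_carrier[OF hom] in \<open>simp_all add: one' hom_mult[OF hom]\<close>)
  have "continuous_map T ?W (free_gen (carrier G))"
    unfolding action_topology_def
  proof (rule continuous_on_generated_topo)
    fix U assume "U \<in> insert (carrier ?F) {{A \<in> carrier ?F. ?\<sigma> A b = c} |b c. b \<in> B \<and> c \<in> B}"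
    then consider "U = carrier ?F" | b c where "b \<in> B" "c \<in> B" "U = {A \<in> carrier ?F. ?\<sigma> A b = c}" by blast
    then show "openin T (free_gen (carrier G) -` U \<inter> topspace T)"
    proof cases
      case 1
      then have "free_gen (carrier G) -` U \<inter> topspace T = topspace T"
        using T by (auto simp: free_gen_in_carrier)
      then show ?thesis by simp
    next
      case 2
      then have "free_gen (carrier G) -` U \<inter> topspace T = {g \<in> carrier G. \<rho> g b = c}"
        using T by (auto simp: free_gen_in_carrier free_eval_free_gen[OF G])
      with op 2 show ?thesis by simp
    qed
  qed (use T in \<open>auto simp: free_gen_in_carrier\<close>)
  then have op': "openin (markov_topology T) {A \<in> carrier ?F. ?\<sigma> A b = c}"
    by (intro openin_markov_topology[of T ?W] openin_action_topology bc) (use W T in auto)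
  moreover have "{A \<in> topspace (markov_topology T). free_eval G A \<in> {g \<in> carrier G. \<rho> g b = c}} =
      {A \<in> carrier ?F. ?\<sigma> A b = c}"
    using T hom_in_carrier[OF hom] by (auto simp: topspace_markov_topology)
  moreover have "carrier G \<subseteq> free_eval G ` topspace (markov_topology T)"
    using openin_topspace[of "tau_topology G T"] unfolding topspace_tau_topology[OF G T]
    by (simp add: tau_topology_def openin_quotient_topology)
  ultimately show ?thesis unfolding tau_topology_def openin_quotient_topology by auto
qed

section \<open>Lifting of paths and homotopies\<close>

lemma continuous_map_to_discrete:
  assumes "f \<in> topspace Z \<rightarrow> B" "\<And>b. b \<in> B \<Longrightarrow> openin Z {z \<in> topspace Z. f z = b}"
  shows "continuous_map Z (discrete_topology B) f"
proof -
  have "openin Z {z \<in> topspace Z. f z \<in> V}" if "V \<subseteq> B" for V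
  proof -
    have "{z \<in> topspace Z. f z \<in> V} = (\<Union>b\<in>V. {z \<in> topspace Z. f z = b})" by blast
    moreover have "openin Z (\<Union>b\<in>V. {z \<in> topspace Z. f z = b})"
      using assms(2) that by (intro openin_Union) blast
    ultimately show ?thesis by simp
  qed
  then show ?thesis using assms(1) by (simp add: continuous_map_def)
qed

locale path_lifting =
  fixes Y :: "'b topology" and X :: "'a topology" and p :: "'b \<Rightarrow> 'a"
  assumes p: "continuous_map Y X p" and lifts: "continuous_lifting_of_paths Y X p"
begin

lemma compose_in_paths: "\<beta> \<in> paths Y \<Longrightarrow> compose {0..1} p \<beta> \<in> paths X"
proof -
  assume \<beta>: "\<beta> \<in> paths Y"
  then have "continuous_map unit_interval X (p \<circ> \<beta>)"
    by (intro continuous_map_compose[OF _ p]) (simp add: paths_iff)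
  then have "continuous_map unit_interval X (compose {0..1} p \<beta>)"
    by (rule continuous_map_eq) (simp add: compose_def)
  then show ?thesis by (simp add: paths_iff)
qed

lemma ex_inverse:
  assumes "y \<in> topspace Y"
  obtains g where "homeomorphic_maps (path_space_from Y y) (path_space_from X (p y)) (compose {0..1} p) g"
  using lifts assms unfolding continuous_lifting_of_paths_def homeomorphic_map_maps by blast

lemma path_lift_eq:
  assumes "homeomorphic_maps (path_space_from Y y) (path_space_from X (p y)) (compose {0..1} p) g"
    and "\<alpha> \<in> paths X" "\<alpha> 0 = p y"
  shows "path_lift Y p \<alpha> y = g \<alpha>"
  unfolding path_lift_def
proof (rule the_equality)
  have \<alpha>: "\<alpha> \<in> topspace (path_space_from X (p y))" using assms by simp
  show "g \<alpha> \<in> topspace (path_space_from Y y) \<and> compose {0..1} p (g \<alpha>) = \<alpha>"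
    using assms(1) \<alpha> unfolding homeomorphic_maps_def continuous_map_def by blast
  show "\<beta> = g \<alpha>" if "\<beta> \<in> topspace (path_space_from Y y) \<and> compose {0..1} p \<beta> = \<alpha>" for \<beta>
    using assms(1) that unfolding homeomorphic_maps_def by auto
qed

lemma path_lift:
  assumes "y \<in> topspace Y" "\<alpha> \<in> paths X" "\<alpha> 0 = p y"
  shows "path_lift Y p \<alpha> y \<in> paths Y" "path_lift Y p \<alpha> y 0 = y"
    "compose {0..1} p (path_lift Y p \<alpha> y) = \<alpha>"
proof -
  obtain g where g: "homeomorphic_maps (path_space_from Y y) (path_space_from X (p y)) (compose {0..1} p) g"
    using ex_inverse[OF assms(1)] .
  have "\<alpha> \<in> topspace (path_space_from X (p y))" using assms by simp
  then have "g \<alpha> \<in> topspace (path_space_from Y y)" "compose {0..1} p (g \<alpha>) = \<alpha>"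
    using g unfolding homeomorphic_maps_def continuous_map_def by blast+
  then show "path_lift Y p \<alpha> y \<in> paths Y" "path_lift Y p \<alpha> y 0 = y"
    "compose {0..1} p (path_lift Y p \<alpha> y) = \<alpha>"
    using path_lift_eq[OF g] assms by simp_all
qed

lemma path_lift_over:
  assumes "y \<in> topspace Y" "\<alpha> \<in> paths X" "\<alpha> 0 = p y" "t \<in> {0..1}"
  shows "path_lift Y p \<alpha> y t \<in> topspace Y" "p (path_lift Y p \<alpha> y t) = \<alpha> t"
  using path_in_topspace[OF path_lift(1)[OF assms(1-3)] assms(4)]
    fun_cong[OF path_lift(3)[OF assms(1-3)], of t] assms(4) by (simp_all add: compose_def)

lemma path_lift_unique:
  assumes "\<beta> \<in> paths Y"
  shows "path_lift Y p (compose {0..1} p \<beta>) (\<beta> 0) = \<beta>"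
proof -
  have y: "\<beta> 0 \<in> topspace Y" using path_in_topspace[OF assms, of 0] by simp
  obtain g where g: "homeomorphic_maps (path_space_from Y (\<beta> 0)) (path_space_from X (p (\<beta> 0))) (compose {0..1} p) g"
    using ex_inverse[OF y] .
  then show ?thesis
    using path_lift_eq[OF g] compose_in_paths[OF assms] assms unfolding homeomorphic_maps_def
    by (simp add: compose_def)
qed

lemma continuous_map_path_lift:
  assumes "y \<in> topspace Y"
  shows "continuous_map (path_space_from X (p y)) (path_space_from Y y) (\<lambda>\<alpha>. path_lift Y p \<alpha> y)"
proof -
  obtain g where g: "homeomorphic_maps (path_space_from Y y) (path_space_from X (p y)) (compose {0..1} p) g"
    using ex_inverse[OF assms] .
  then have "continuous_map (path_space_from X (p y)) (path_space_from Y y) g"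
    unfolding homeomorphic_maps_def by blast
  then show ?thesis by (rule continuous_map_eq) (simp add: path_lift_eq[OF g])
qed

lemma continuous_map_path_lift_end:
  assumes "continuous_map Z (path_space X) F" "\<And>z. z \<in> topspace Z \<Longrightarrow> F z 0 = p y" "y \<in> topspace Y"
  shows "continuous_map Z Y (\<lambda>z. path_lift Y p (F z) y 1)"
proof -
  have "continuous_map Z (path_space_from X (p y)) F"
    using assms by (simp add: continuous_map_into_path_space_from)
  from continuous_map_compose[OF this continuous_map_path_lift[OF assms(3)]]
  have "continuous_map Z (path_space Y) (\<lambda>z. path_lift Y p (F z) y)"
    by (simp add: o_def continuous_map_into_path_space_from)
  then show ?thesis by (rule continuous_map_path_eval) simp
qed

lemma path_lift_const:
  assumes "y \<in> topspace Y"
  shows "path_lift Y p (\<lambda>t\<in>{0..1}. p y) y = (\<lambda>t\<in>{0..1}. y)"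
proof -
  have "compose {0..1} p (\<lambda>t\<in>{0..1}. y) = (\<lambda>t\<in>{0..1}. p y)" by (auto simp: compose_def)
  moreover have "(\<lambda>t\<in>{0..1::real}. y) 0 = y" by simp
  ultimately show ?thesis using path_lift_unique[OF const_in_paths[OF assms]] by metis
qed

lemma path_lift_concat:
  assumes "y \<in> topspace Y" "\<alpha> \<in> paths X" "\<alpha> 0 = p y" "\<beta> \<in> paths X" "\<alpha> 1 = \<beta> 0"
  shows "path_lift Y p (path_concat \<alpha> \<beta>) y = path_concat (path_lift Y p \<alpha> y) (path_lift Y p \<beta> (path_lift Y p \<alpha> y 1))"
proof -
  let ?a = "path_lift Y p \<alpha> y" let ?b = "path_lift Y p \<beta> (?a 1)"
  note a = path_lift[OF assms(1-3)]
  have e: "?a 1 \<in> topspace Y" "\<beta> 0 = p (?a 1)" using path_lift_over[OF assms(1-3), of 1] assms(5) by auto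
  note b = path_lift[OF e(1) assms(4) e(2)]
  have "compose {0..1} p (path_concat ?a ?b) = path_concat (compose {0..1} p ?a) (compose {0..1} p ?b)"
    by (auto simp: compose_def path_concat_def fun_eq_iff)
  then show ?thesis
    using path_lift_unique[OF path_concat_in_paths[OF a(1) b(1)]] a b by simp
qed

end

lemma compact_Delta2: "compact Delta2"
proof -
  have "Delta2 = ({0..1} \<times> {0..1}) \<inter> {q. fst q + snd q \<le> 1}" by (auto simp: Delta2_def)
  moreover have "closed {q::real \<times> real. fst q + snd q \<le> 1}"
    by (intro closed_Collect_le continuous_intros)
  ultimately show ?thesis by (metis compact_Icc compact_Int_closed compact_Times)
qed

lemma continuous_map_Delta2_apply:
  assumes "continuous_map Z (mapping_space (top_of_set Delta2) X) F" "continuous_map Z (top_of_set Delta2) g"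
  shows "continuous_map Z X (\<lambda>z. F z (g z))"
  by (rule continuous_map_apply[OF _ _ assms])
    (simp_all add: compact_space_subtopology compact_Delta2 Hausdorff_space_subtopology)

lemma Delta2_scale: "(s, t) \<in> Delta2 \<Longrightarrow> r \<in> {0..1} \<Longrightarrow> (r * s, t) \<in> Delta2"
  using mult_left_le_one_le[of s r] by (auto simp: Delta2_def)

definition segment_path :: "(real \<times> real \<Rightarrow> 'c) \<Rightarrow> real \<times> real \<Rightarrow> real \<Rightarrow> 'c" where
  "segment_path \<phi> q = (\<lambda>r\<in>{0..1}. \<phi> (r * fst q, snd q))"

lemma segment_path_ends [simp]:
  "segment_path \<phi> q 0 = \<phi> (0, snd q)" "segment_path \<phi> q 1 = \<phi> q"
  by (simp_all add: segment_path_def)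

lemma continuous_map_segment_path:
  "continuous_map (prod_topology (mapping_space (top_of_set Delta2) X) (top_of_set Delta2)) (path_space X)
     (\<lambda>(\<phi>, q). segment_path \<phi> q)"
proof -
  let ?M = "mapping_space (top_of_set Delta2) X" and ?D = "top_of_set Delta2"
  let ?P = "prod_topology (prod_topology ?M ?D) unit_interval"
  have q: "continuous_map ?P euclidean (\<lambda>z. snd (fst z))"
    by (rule continuous_map_fst_compose[OF continuous_map_snd_real])
  have r: "continuous_map ?P euclidean snd" by (rule continuous_map_snd_real)
  have "continuous_map ?P euclidean (\<lambda>z. (snd z * fst (snd (fst z)), snd (snd (fst z))))"
  proof -
    have "continuous_map ?P euclideanreal (\<lambda>z. fst (snd (fst z)))" "continuous_map ?P euclideanreal (\<lambda>z. snd (snd (fst z)))"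
      using continuous_map_compose[OF q, of euclidean fst] continuous_map_compose[OF q, of euclidean snd]
      by (simp_all add: o_def continuous_on_fst continuous_on_snd)
    from continuous_map_pairedI[OF continuous_map_real_mult[OF r this(1)] this(2)]
    show ?thesis by simp
  qed
  moreover have "(snd z * fst (snd (fst z)), snd (snd (fst z))) \<in> Delta2" if "z \<in> topspace ?P" for z
    using that Delta2_scale by auto
  ultimately have "continuous_map ?P ?D (\<lambda>z. (snd z * fst (snd (fst z)), snd (snd (fst z))))"
    by (simp add: continuous_map_into_interval)
  then have "continuous_map ?P X (\<lambda>z. fst (fst z) (snd z * fst (snd (fst z)), snd (snd (fst z))))"
    by (rule continuous_map_Delta2_apply[OF continuous_map_fst_compose[OF continuous_map_fst]])
  then have "continuous_map (prod_topology ?M ?D) (path_space X)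
      (\<lambda>w. \<lambda>r\<in>{0..1}. fst w (r * fst (snd w), snd (snd w)))"
    by (intro continuous_map_path_curry) (simp add: case_prod_unfold)
  then show ?thesis by (simp add: segment_path_def case_prod_unfold)
qed

lemma segment_path_in_paths:
  "\<phi> \<in> maps (top_of_set Delta2) X \<Longrightarrow> q \<in> Delta2 \<Longrightarrow> segment_path \<phi> q \<in> paths X"
  using continuous_map_in_topspace[OF continuous_map_segment_path, of "(\<phi>, q)"]
  by (simp add: topspace_mapping_space)

lemma topspace_Phi_from [simp]:
  "topspace (Phi_from X x) = {\<phi> \<in> maps (top_of_set Delta2) X. \<phi> ` edge1 = {x}}"
  by (auto simp: Phi_from_def topspace_mapping_space)

lemma image_edge1_iff: "\<phi> ` edge1 = {x} \<longleftrightarrow> (\<forall>t\<in>{0..1}. \<phi> (0, t) = x)"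
  by (force simp: edge1_def image_iff)

lemma Delta2_snd: "q \<in> Delta2 \<Longrightarrow> snd q \<in> {0..1}"
  by (auto simp: Delta2_def)

lemma edge1_in_Delta2: "t \<in> {0..1} \<Longrightarrow> (0, t) \<in> Delta2"
  by (auto simp: Delta2_def)

text \<open>A map \<open>\<phi>\<close> on the triangle is lifted along the segments from \<open>(0, t)\<close> to \<open>(s, t)\<close>.\<close>

lemma (in path_lifting) continuous_lifting_of_homotopies: "continuous_lifting_of_homotopies Y X p"
  unfolding continuous_lifting_of_homotopies_def
proof
  fix y assume y: "y \<in> topspace Y"
  let ?D = "top_of_set Delta2"
  define lift where "lift = (\<lambda>\<phi>. \<lambda>q\<in>Delta2. path_lift Y p (segment_path \<phi> q) y 1)"
  have "continuous_map (prod_topology (Phi_from Y y) ?D) Y (\<lambda>w. fst w (snd w))"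
    by (rule continuous_map_Delta2_apply[OF _ continuous_map_snd])
      (rule continuous_map_fst_compose, simp add: Phi_from_def continuous_map_from_subtopology)
  from continuous_map_curry[OF continuous_map_compose[OF this p]]
  have "continuous_map (Phi_from Y y) (mapping_space ?D X) (compose Delta2 p)"
    by (simp add: compose_def[abs_def])
  then have 1: "continuous_map (Phi_from Y y) (Phi_from X (p y)) (compose Delta2 p)"
    unfolding Phi_from_def[of X] continuous_map_in_subtopology
    by (auto simp: image_edge1_iff compose_def edge1_in_Delta2)
  let ?Q = "prod_topology (Phi_from X (p y)) ?D"
  have seg: "continuous_map ?Q (path_space X) (\<lambda>w. segment_path (fst w) (snd w))"
  proof -
    have "continuous_map ?Q (prod_topology (mapping_space ?D X) ?D) (\<lambda>w. (fst w, snd w))"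
      by (intro continuous_map_pairedI continuous_map_snd continuous_map_fst_compose)
         (simp add: Phi_from_def continuous_map_from_subtopology)
    from continuous_map_compose[OF this continuous_map_segment_path] show ?thesis by (simp add: o_def case_prod_unfold)
  qed
  have "continuous_map ?Q Y (\<lambda>w. path_lift Y p (segment_path (fst w) (snd w)) y 1)"
    by (rule continuous_map_path_lift_end[OF seg _ y]) (auto simp: image_edge1_iff dest: Delta2_snd)
  from continuous_map_curry[OF this]
  have "continuous_map (Phi_from X (p y)) (mapping_space ?D Y) lift"
    by (simp add: lift_def)
  moreover have "lift \<phi> ` edge1 = {y}" if "\<phi> \<in> topspace (Phi_from X (p y))" for \<phi>
  proof -
    have "segment_path \<phi> (0, t) = (\<lambda>t\<in>{0..1}. p y)" if "t \<in> {0..1}" for t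
      using \<open>\<phi> \<in> _\<close> that by (auto simp: segment_path_def image_edge1_iff)
    then show ?thesis unfolding image_edge1_iff by (simp add: lift_def edge1_in_Delta2 path_lift_const[OF y])
  qed
  ultimately have 2: "continuous_map (Phi_from X (p y)) (Phi_from Y y) lift"
    unfolding Phi_from_def[of Y] continuous_map_in_subtopology by (simp add: Pi_iff)
  have 3: "lift (compose Delta2 p \<phi>) = \<phi>" if "\<phi> \<in> topspace (Phi_from Y y)" for \<phi>
  proof
    fix q
    have \<phi>: "\<phi> \<in> maps ?D Y" "\<And>t. t \<in> {0..1} \<Longrightarrow> \<phi> (0, t) = y"
      using that by (simp_all add: image_edge1_iff)
    show "lift (compose Delta2 p \<phi>) q = \<phi> q"
    proof (cases "q \<in> Delta2")
      case True
      have "segment_path (compose Delta2 p \<phi>) q = compose {0..1} p (segment_path \<phi> q)"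
        using Delta2_scale[of "fst q" "snd q"] True by (auto simp: segment_path_def compose_def fun_eq_iff)
      then show ?thesis
        using path_lift_unique[OF segment_path_in_paths[OF \<phi>(1) True]] \<phi>(2)[OF Delta2_snd[OF True]] True
        by (simp add: lift_def)
    next
      case False
      then show ?thesis using \<phi>(1) by (simp add: lift_def maps_def extensional_arb[of \<phi> Delta2 q])
    qed
  qed
  have 4: "compose Delta2 p (lift \<phi>) = \<phi>" if "\<phi> \<in> topspace (Phi_from X (p y))" for \<phi>
  proof
    fix q
    have \<phi>: "\<phi> \<in> maps ?D X" "\<And>t. t \<in> {0..1} \<Longrightarrow> \<phi> (0, t) = p y"
      using that by (simp_all add: image_edge1_iff)
    show "compose Delta2 p (lift \<phi>) q = \<phi> q"
    proof (cases "q \<in> Delta2")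
      case True
      then show ?thesis
        using path_lift_over(2)[OF y segment_path_in_paths[OF \<phi>(1) True], of 1] \<phi>(2)[OF Delta2_snd[OF True]]
        by (simp add: compose_def lift_def)
    next
      case False
      then show ?thesis using \<phi>(1) by (simp add: compose_def maps_def extensional_arb[of \<phi> Delta2 q])
    qed
  qed
  show "homeomorphic_map (Phi_from Y y) (Phi_from X (p y)) (compose Delta2 p)"
    unfolding homeomorphic_map_maps homeomorphic_maps_def using 1 2 3 4 by blast
qed

locale semicovering_map = path_lifting +
  assumes local_homeo: "local_homeomorphism Y X p"
begin

lemma semicovering: "semicovering Y X p"
  by (simp add: semicovering_def local_homeo lifts continuous_lifting_of_homotopies)

lemma sheet:
  assumes "y \<in> topspace Y"
  obtains U where "openin Y U" "y \<in> U" "inj_on p U" "openin X (p ` U)"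
    "\<And>V. openin Y V \<Longrightarrow> V \<subseteq> U \<Longrightarrow> openin X (p ` V)"
proof -
  obtain U where U: "openin Y U" "y \<in> U" "openin X (p ` U)"
    "homeomorphic_map (subtopology Y U) (subtopology X (p ` U)) p"
    using local_homeo assms unfolding local_homeomorphism_def by blast
  have "inj_on p U"
    using homeomorphic_imp_injective_map[OF U(4)] openin_subset[OF U(1)] by (simp add: Int_absorb1)
  moreover have "openin X (p ` V)" if "openin Y V" "V \<subseteq> U" for V
  proof -
    have "openin (subtopology X (p ` U)) (p ` V)"
      using homeomorphic_imp_open_map[OF U(4)] that openin_open_subtopology[OF U(1)] unfolding open_map_def by blast
    then show ?thesis using U(3) openin_open_subtopology by blast
  qed
  ultimately show ?thesis using that U by blast
qed

lemma continuous_map_into_fibre: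
  assumes f: "continuous_map Z Y f" and x: "\<And>z. z \<in> topspace Z \<Longrightarrow> p (f z) = x"
  shows "continuous_map Z (discrete_topology (fibre Y p x)) f"
proof (rule continuous_map_to_discrete)
  show "f \<in> topspace Z \<rightarrow> fibre Y p x"
    using continuous_map_in_topspace[OF f] x by (simp add: Pi_iff fibre_def)
  fix b assume "b \<in> fibre Y p x"
  then have b: "b \<in> topspace Y" "p b = x" by (simp_all add: fibre_def)
  obtain U where U: "openin Y U" "b \<in> U" "inj_on p U" by (rule sheet[OF b(1)]) blast
  have "{z \<in> topspace Z. f z = b} = {z \<in> topspace Z. f z \<in> U}"
    using inj_onD[OF U(3) _ _ U(2)] U(2) x b(2) by blast
  then show "openin Z {z \<in> topspace Z. f z = b}" using openin_continuous_map_preimage[OF f U(1)] by simp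
qed

lemma path_lift_end_cong:
  assumes "\<alpha> \<in> paths X" "\<beta> \<in> paths X" "path_class X \<alpha> = path_class X \<beta>" "y \<in> topspace Y" "\<alpha> 0 = p y"
  shows "path_lift Y p \<alpha> y 1 = path_lift Y p \<beta> y 1"
proof -
  obtain H where H: "continuous_map unit_interval (path_space_between X (\<alpha> 0) (\<alpha> 1)) H" "H 0 = \<alpha>" "H 1 = \<beta>"
    using path_class_eqE[OF assms(3,1,2)] .
  have H': "continuous_map unit_interval (path_space X) H"
    "\<And>t. t \<in> {0..1} \<Longrightarrow> H t 0 = p y" "\<And>t. t \<in> {0..1} \<Longrightarrow> H t 1 = \<alpha> 1"
    using H(1) assms(5) by (simp_all add: continuous_map_into_path_space_between)
  let ?e = "\<lambda>t. path_lift Y p (H t) y 1"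
  have "continuous_map unit_interval Y ?e"
    by (rule continuous_map_path_lift_end[OF H'(1) _ assms(4)]) (use H'(2) in auto)
  moreover have "p (?e t) = \<alpha> 1" if "t \<in> topspace unit_interval" for t
  proof -
    have t: "t \<in> {0..1}" using that by simp
    have "H t \<in> paths X" using continuous_map_in_topspace[OF H'(1)] t by simp
    from path_lift_over(2)[OF assms(4) this H'(2)[OF t], of 1] H'(3)[OF t] show ?thesis by simp
  qed
  ultimately have "continuous_map unit_interval (discrete_topology (fibre Y p (\<alpha> 1))) ?e"
    by (rule continuous_map_into_fibre)
  then have "connectedin (discrete_topology (fibre Y p (\<alpha> 1))) (?e ` {0..1})"
    by (rule connectedin_continuous_map_image) (simp add: connectedin_subtopology)
  then obtain a where "?e ` {0..1} \<subseteq> {a}" unfolding connectedin_discrete_topology by blast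
  then have "?e 0 = ?e 1" by (metis atLeastAtMost_iff image_subset_iff order_refl singletonD zero_le_one)
  then show ?thesis by (simp only: H(2,3))
qed

lemma monodromy_action_path_class:
  assumes "\<alpha> \<in> paths X" "y \<in> topspace Y" "\<alpha> 0 = p y"
  shows "monodromy_action Y p y (path_class X \<alpha>) = path_lift Y p \<alpha> y 1"
proof -
  let ?\<beta> = "SOME \<beta>. \<beta> \<in> path_class X \<alpha>"
  have \<beta>: "?\<beta> \<in> path_class X \<alpha>" by (rule someI[of "\<lambda>\<beta>. \<beta> \<in> path_class X \<alpha>"]) (rule path_class_refl[OF assms(1)])
  then have "path_lift Y p \<alpha> y 1 = path_lift Y p ?\<beta> y 1"
    using path_class_subset assms by (intro path_lift_end_cong) (auto simp: path_class_eq)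
  then show ?thesis by (simp add: monodromy_action_def)
qed

lemma monodromy_action_in_fibre:
  assumes "y \<in> fibre Y p x" "g \<in> pi_hom X x x'"
  shows "monodromy_action Y p y g \<in> fibre Y p x'"
proof -
  obtain \<alpha> where \<alpha>: "\<alpha> \<in> paths X" "\<alpha> 0 = x" "\<alpha> 1 = x'" "g = path_class X \<alpha>" by (rule pi_homE[OF assms(2)])
  have "y \<in> topspace Y" "\<alpha> 0 = p y" using assms(1) \<alpha>(2) by (auto simp: fibre_def)
  with path_lift_over[of y \<alpha> 1] \<alpha> show ?thesis by (simp add: monodromy_action_path_class fibre_def)
qed

lemma monodromy_action_comp:
  assumes "y \<in> fibre Y p x" "g \<in> pi_hom X x x'" "h \<in> pi_hom X x' x''"
  shows "monodromy_action Y p y (pi_comp X g h) = monodromy_action Y p (monodromy_action Y p y g) h"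
proof -
  obtain \<alpha> where \<alpha>: "\<alpha> \<in> paths X" "\<alpha> 0 = x" "\<alpha> 1 = x'" "g = path_class X \<alpha>" by (rule pi_homE[OF assms(2)])
  obtain \<beta> where \<beta>: "\<beta> \<in> paths X" "\<beta> 0 = x'" "\<beta> 1 = x''" "h = path_class X \<beta>" by (rule pi_homE[OF assms(3)])
  have y: "y \<in> topspace Y" "\<alpha> 0 = p y" using assms(1) \<alpha>(2) by (auto simp: fibre_def)
  let ?z = "path_lift Y p \<alpha> y 1"
  have z: "?z \<in> topspace Y" "\<beta> 0 = p ?z" using path_lift_over[OF y(1) \<alpha>(1) y(2), of 1] \<alpha> \<beta> by auto
  have "monodromy_action Y p y (pi_comp X g h) = path_lift Y p (path_concat \<alpha> \<beta>) y 1"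
    using \<alpha> \<beta> y by (simp add: pi_comp_path_class monodromy_action_path_class path_concat_in_paths)
  also have "\<dots> = path_lift Y p \<beta> ?z 1" using path_lift_concat[OF y(1) \<alpha>(1) y(2) \<beta>(1)] \<alpha> \<beta> by simp
  also have "\<dots> = monodromy_action Y p (monodromy_action Y p y g) h"
    using \<alpha> \<beta> y z by (simp add: monodromy_action_path_class)
  finally show ?thesis .
qed

lemma monodromy_action_one:
  assumes "y \<in> topspace Y"
  shows "monodromy_action Y p y (pi_one X (p y)) = y"
proof -
  have "p y \<in> topspace X" using continuous_map_in_topspace[OF p assms] .
  then show ?thesis
    using assms by (simp add: pi_one_def monodromy_action_path_class const_in_paths path_lift_const)
qed

lemma openin_pi_qtop_monodromy:
  assumes "y \<in> topspace Y" "z \<in> fibre Y p x"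
  shows "openin (pi_qtop X (p y) x) {g \<in> pi_hom X (p y) x. monodromy_action Y p y g = z}"
proof -
  let ?S = "path_space_between X (p y) x"
  have "continuous_map ?S Y (\<lambda>\<alpha>. path_lift Y p \<alpha> y 1)"
    using assms by (intro continuous_map_path_lift_end[OF continuous_map_from_path_space_between]) auto
  then have "continuous_map ?S (discrete_topology (fibre Y p x)) (\<lambda>\<alpha>. path_lift Y p \<alpha> y 1)"
    by (rule continuous_map_into_fibre) (use assms path_lift_over[of y _ 1] in auto)
  from openin_continuous_map_preimage[OF this, of "{z}"] assms(2)
  have "openin ?S {\<alpha> \<in> topspace ?S. path_lift Y p \<alpha> y 1 = z}" by simp
  also have "{\<alpha> \<in> topspace ?S. path_lift Y p \<alpha> y 1 = z} =
      {\<alpha> \<in> topspace ?S. path_class X \<alpha> \<in> {g \<in> pi_hom X (p y) x. monodromy_action Y p y g = z}}"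
    using assms(1) by (auto simp: pi_hom_def monodromy_action_path_class)
  finally show ?thesis unfolding pi_qtop_def openin_quotient_topology by (auto simp: pi_hom_def)
qed

end

lemma semicovering_map_iff: "semicovering_map Y X p \<longleftrightarrow> semicovering Y X p"
proof
  show "semicovering_map Y X p \<Longrightarrow> semicovering Y X p" by (rule semicovering_map.semicovering)
qed (simp add: semicovering_def semicovering_map_def path_lifting_def semicovering_map_axioms_def local_homeomorphism_def)

section \<open>The semicovering of an action of paths\<close>

lemma well_ended_end:
  assumes "well_ended X \<gamma>" "openin (path_space_from X (\<gamma> 0)) C" "\<gamma> \<in> C"
  obtains V where "openin X V" "\<gamma> 1 \<in> V" "\<And>b. b \<in> V \<Longrightarrow> \<exists>\<gamma>'\<in>C. \<gamma>' 1 = b"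
proof -
  obtain T where T: "openin (path_space X) T" "C = T \<inter> {\<alpha>. \<alpha> 0 = \<gamma> 0}"
    using assms(2) unfolding path_space_from_def openin_subtopology by blast
  then obtain V0 V1 where V: "openin X V0" "\<gamma> 0 \<in> V0" "openin X V1" "\<gamma> 1 \<in> V1"
    "\<forall>a\<in>V0. \<forall>b\<in>V1. \<exists>\<beta>\<in>T. \<beta> 0 = a \<and> \<beta> 1 = b"
    using assms(1,3) unfolding well_ended_def by blast
  show ?thesis by (rule that[OF V(3,4)]) (use V(2,5) T(2) in blast)
qed

lemma locally_well_ended_end:
  assumes "locally_well_ended X \<gamma>" "openin (path_space_from X (\<gamma> 0)) C" "\<gamma> \<in> C"
  obtains V where "openin X V" "\<gamma> 1 \<in> V" "\<forall>b\<in>V. \<exists>\<gamma>'\<in>C. well_ended X \<gamma>' \<and> \<gamma>' 1 = b"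
proof -
  obtain T where T: "openin (path_space X) T" "C = T \<inter> {\<alpha>. \<alpha> 0 = \<gamma> 0}"
    using assms(2) unfolding path_space_from_def openin_subtopology by blast
  then obtain V0 V1 where V: "openin X V0" "\<gamma> 0 \<in> V0" "openin X V1" "\<gamma> 1 \<in> V1"
    "\<forall>a\<in>V0. \<forall>b\<in>V1. \<exists>\<beta>\<in>T. well_ended X \<beta> \<and> \<beta> 0 = a \<and> \<beta> 1 = b"
    using assms(1,3) unfolding locally_well_ended_def by blast
  show ?thesis by (rule that[OF V(3,4)]) (use V(2,5) T(2) in blast)
qed

locale path_action =
  fixes X :: "'a topology" and F :: "'a \<Rightarrow> 'b set" and act :: "(real \<Rightarrow> 'a) \<Rightarrow> 'b \<Rightarrow> 'b"
  assumes wep: "locally_wep_connected X"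
    and disj: "disjoint_family_on F (topspace X)"
    and act_in: "\<And>\<alpha> u. \<alpha> \<in> paths X \<Longrightarrow> u \<in> F (\<alpha> 0) \<Longrightarrow> act \<alpha> u \<in> F (\<alpha> 1)"
    and act_const: "\<And>x u. x \<in> topspace X \<Longrightarrow> u \<in> F x \<Longrightarrow> act (\<lambda>t\<in>{0..1}. x) u = u"
    and act_concat: "\<And>\<alpha> \<beta> u. \<alpha> \<in> paths X \<Longrightarrow> \<beta> \<in> paths X \<Longrightarrow> \<alpha> 1 = \<beta> 0 \<Longrightarrow> u \<in> F (\<alpha> 0) \<Longrightarrow>
      act (path_concat \<alpha> \<beta>) u = act \<beta> (act \<alpha> u)"
    and act_cong: "\<And>\<alpha> \<beta> u. \<alpha> \<in> paths X \<Longrightarrow> \<beta> \<in> paths X \<Longrightarrow> path_class X \<alpha> = path_class X \<beta> \<Longrightarrow>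
      u \<in> F (\<alpha> 0) \<Longrightarrow> act \<alpha> u = act \<beta> u"
    and openin_act_loop: "\<And>x u v. x \<in> topspace X \<Longrightarrow> u \<in> F x \<Longrightarrow> v \<in> F x \<Longrightarrow>
      openin (path_space_between X x x) {\<alpha> \<in> topspace (path_space_between X x x). act \<alpha> u = v}"
begin

definition total :: "'b set" where
  "total = (\<Union>x\<in>topspace X. F x)"

definition proj :: "'b \<Rightarrow> 'a" where
  "proj = (\<lambda>u\<in>total. THE x. x \<in> topspace X \<and> u \<in> F x)"

text \<open>The finest topology that makes all maps \<open>\<alpha> \<mapsto> act \<alpha> u\<close> continuous.\<close>

definition total_top :: "'b topology" where
  "total_top = topology (\<lambda>V. V \<subseteq> total \<and> (\<forall>x\<in>topspace X. \<forall>u\<in>F x.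
     openin (path_space_from X x) {\<alpha> \<in> topspace (path_space_from X x). act \<alpha> u \<in> V}))"

lemma proj_eq: "x \<in> topspace X \<Longrightarrow> u \<in> F x \<Longrightarrow> proj u = x"
proof -
  assume x: "x \<in> topspace X" "u \<in> F x"
  then have "(THE x. x \<in> topspace X \<and> u \<in> F x) = x"
    using disj unfolding disjoint_family_on_def by (intro the_equality) blast+
  then show ?thesis using x by (auto simp: proj_def total_def)
qed

lemma totalE:
  assumes "u \<in> total" obtains "proj u \<in> topspace X" "u \<in> F (proj u)"
proof -
  obtain x where "x \<in> topspace X" "u \<in> F x" using assms unfolding total_def by blast
  then show ?thesis using that by (simp add: proj_eq)
qed

lemma totalI: "x \<in> topspace X \<Longrightarrow> u \<in> F x \<Longrightarrow> u \<in> total"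
  by (auto simp: total_def)

lemma path_ends_in_topspace: "\<alpha> \<in> paths X \<Longrightarrow> \<alpha> 0 \<in> topspace X \<and> \<alpha> 1 \<in> topspace X"
  using path_in_topspace[of \<alpha> X 0] path_in_topspace[of \<alpha> X 1] by simp

lemma act_in_total: "\<alpha> \<in> paths X \<Longrightarrow> u \<in> F (\<alpha> 0) \<Longrightarrow> act \<alpha> u \<in> total"
  using act_in totalI path_ends_in_topspace by blast

lemma proj_act: "\<alpha> \<in> paths X \<Longrightarrow> u \<in> F (\<alpha> 0) \<Longrightarrow> proj (act \<alpha> u) = \<alpha> 1"
  using act_in proj_eq path_ends_in_topspace by blast

lemma openin_total_top:
  "openin total_top V \<longleftrightarrow> V \<subseteq> total \<and> (\<forall>x\<in>topspace X. \<forall>u\<in>F x.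
     openin (path_space_from X x) {\<alpha> \<in> topspace (path_space_from X x). act \<alpha> u \<in> V})"
proof -
  have "istopology (\<lambda>V. V \<subseteq> total \<and> (\<forall>x\<in>topspace X. \<forall>u\<in>F x.
     openin (path_space_from X x) {\<alpha> \<in> topspace (path_space_from X x). act \<alpha> u \<in> V}))"
    (is "istopology ?P")
    unfolding istopology_def
  proof (rule conjI; intro allI impI)
    fix S T assume ST: "?P S" "?P T"
    have "{\<alpha> \<in> topspace (path_space_from X x). act \<alpha> u \<in> S \<inter> T} =
      {\<alpha> \<in> topspace (path_space_from X x). act \<alpha> u \<in> S} \<inter> {\<alpha> \<in> topspace (path_space_from X x). act \<alpha> u \<in> T}"
      for x u by blast
    then show "?P (S \<inter> T)" using ST by (simp only: openin_Int) blast
  next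
    fix K assume K: "\<forall>S\<in>K. ?P S"
    have "{\<alpha> \<in> topspace (path_space_from X x). act \<alpha> u \<in> \<Union>K} =
      (\<Union>S\<in>K. {\<alpha> \<in> topspace (path_space_from X x). act \<alpha> u \<in> S})" for x u by blast
    moreover have "openin (path_space_from X x) (\<Union>S\<in>K. {\<alpha> \<in> topspace (path_space_from X x). act \<alpha> u \<in> S})"
      if "x \<in> topspace X" "u \<in> F x" for x u
      using K that by (intro openin_Union) blast
    ultimately show "?P (\<Union>K)" using K by (simp only:) blast
  qed
  then show ?thesis unfolding total_top_def by (subst topology_inverse') blast+
qed

lemma topspace_total_top [simp]: "topspace total_top = total"
proof
  have "{\<alpha> \<in> topspace (path_space_from X x). act \<alpha> u \<in> total} = topspace (path_space_from X x)"
    if "u \<in> F x" for x u using that act_in_total by auto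
  then have "openin (path_space_from X x) {\<alpha> \<in> topspace (path_space_from X x). act \<alpha> u \<in> total}"
    if "u \<in> F x" for x u using that openin_topspace by metis
  then have "openin total_top total" unfolding openin_total_top by blast
  then show "total \<subseteq> topspace total_top" by (rule openin_subset)
  show "topspace total_top \<subseteq> total" using openin_topspace[of total_top] openin_total_top by blast
qed

lemma continuous_map_act:
  assumes "x \<in> topspace X" "u \<in> F x"
  shows "continuous_map (path_space_from X x) total_top (\<lambda>\<alpha>. act \<alpha> u)"
proof -
  have "(\<lambda>\<alpha>. act \<alpha> u) \<in> topspace (path_space_from X x) \<rightarrow> total" using assms act_in_total by auto
  then show ?thesis using assms unfolding continuous_map_def by (simp add: openin_total_top)
qed

lemma continuous_map_proj: "continuous_map total_top X proj"
proof -
  have "openin total_top {u \<in> total. proj u \<in> U}" if U: "openin X U" for U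
    unfolding openin_total_top
  proof (intro conjI ballI)
    fix x u assume xu: "x \<in> topspace X" "u \<in> F x"
    have "{\<alpha> \<in> topspace (path_space_from X x). act \<alpha> u \<in> {u \<in> total. proj u \<in> U}} =
        {\<alpha> \<in> topspace (path_space_from X x). \<alpha> 1 \<in> U}"
      using xu by (auto simp: act_in_total proj_act)
    then show "openin (path_space_from X x) {\<alpha> \<in> topspace (path_space_from X x). act \<alpha> u \<in> {u \<in> total. proj u \<in> U}}"
      using openin_continuous_map_preimage[OF continuous_map_path_eval[OF continuous_map_from_path_space_from, of 1] U]
      by simp
  qed blast
  moreover have "proj \<in> total \<rightarrow> topspace X" by (auto elim: totalE)
  ultimately show ?thesis unfolding continuous_map_def by simp
qed

lemma act_rev:
  assumes "\<alpha> \<in> paths X" "u \<in> F (\<alpha> 0)"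
  shows "act (path_rev \<alpha>) (act \<alpha> u) = u"
proof -
  have x: "\<alpha> 0 \<in> topspace X" using path_ends_in_topspace assms by blast
  have "act (path_rev \<alpha>) (act \<alpha> u) = act (path_concat \<alpha> (path_rev \<alpha>)) u"
    using assms by (simp add: act_concat path_rev_in_paths)
  also have "\<dots> = act (\<lambda>t\<in>{0..1}. \<alpha> 0) u"
    using assms x
    by (intro act_cong) (simp_all add: path_class_rev_right path_rev_in_paths path_concat_in_paths const_in_paths)
  also have "\<dots> = u" using assms x by (simp add: act_const)
  finally show ?thesis .
qed

lemma act_rev': "\<alpha> \<in> paths X \<Longrightarrow> u \<in> F (\<alpha> 1) \<Longrightarrow> act \<alpha> (act (path_rev \<alpha>) u) = u"
  using act_rev[of "path_rev \<alpha>" u] by (simp add: path_rev_in_paths path_rev_rev)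

lemma openin_act:
  assumes x: "x \<in> topspace X" "u \<in> F x" and y: "v \<in> F y"
  shows "openin (path_space_between X x y) {\<alpha> \<in> topspace (path_space_between X x y). act \<alpha> u = v}"
proof (cases "topspace (path_space_between X x y) = {}")
  case True
  then show ?thesis by (metis (lifting) Collect_empty_eq empty_iff openin_empty)
next
  case False
  then obtain \<beta> where \<beta>: "\<beta> \<in> paths X" "\<beta> 0 = x" "\<beta> 1 = y" by auto
  let ?w = "act (path_rev \<beta>) v"
  have w: "?w \<in> F x" using act_in[of "path_rev \<beta>" v] \<beta> y by (simp add: path_rev_in_paths)
  have "continuous_map (path_space_between X x y) (path_space X) (\<lambda>\<alpha>. path_concat \<alpha> (path_rev \<beta>))"
    by (rule continuous_map_path_concat[OF continuous_map_from_path_space_between])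
      (use \<beta> path_rev_in_paths in auto)
  then have "continuous_map (path_space_between X x y) (path_space_between X x x) (\<lambda>\<alpha>. path_concat \<alpha> (path_rev \<beta>))"
    unfolding continuous_map_into_path_space_between using \<beta> by simp
  from openin_continuous_map_preimage[OF this openin_act_loop[OF x w]]
  have "openin (path_space_between X x y) {\<alpha> \<in> topspace (path_space_between X x y).
      path_concat \<alpha> (path_rev \<beta>) \<in> {\<alpha> \<in> topspace (path_space_between X x x). act \<alpha> u = ?w}}" .
  also have "{\<alpha> \<in> topspace (path_space_between X x y).
      path_concat \<alpha> (path_rev \<beta>) \<in> {\<alpha> \<in> topspace (path_space_between X x x). act \<alpha> u = ?w}} =
    {\<alpha> \<in> topspace (path_space_between X x y). act \<alpha> u = v}"
  proof (rule Collect_cong, rule conj_cong[OF HOL.refl])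
    fix \<alpha> assume "\<alpha> \<in> topspace (path_space_between X x y)"
    then have \<alpha>: "\<alpha> \<in> paths X" "\<alpha> 0 = x" "\<alpha> 1 = y" by auto
    have "act (path_concat \<alpha> (path_rev \<beta>)) u = act (path_rev \<beta>) (act \<alpha> u)"
      using \<alpha> \<beta> x(2) by (intro act_concat) (simp_all add: path_rev_in_paths)
    moreover have "act (path_rev \<beta>) (act \<alpha> u) = ?w \<longleftrightarrow> act \<alpha> u = v"
      using act_rev'[OF \<beta>(1), of "act \<alpha> u"] act_rev'[OF \<beta>(1), of v] act_in[OF \<alpha>(1), of u] \<alpha>(2,3) \<beta>(3) x(2) y
      by metis
    ultimately show "path_concat \<alpha> (path_rev \<beta>) \<in> {\<alpha> \<in> topspace (path_space_between X x x). act \<alpha> u = ?w} \<longleftrightarrow>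
        act \<alpha> u = v"
      using \<alpha> \<beta> by (simp add: path_concat_in_paths path_rev_in_paths)
  qed
  finally show ?thesis .
qed

text \<open>
  \<open>act \<delta> u = act \<gamma> v\<close> says that the path \<open>\<delta>\<cdot>\<gamma>\<^sup>-\<close> takes \<open>u\<close> to \<open>v\<close>, which is an open condition
  on this path.
\<close>

lemma act_eq_nearby:
  assumes \<delta>: "\<delta> \<in> paths X" "u \<in> F (\<delta> 0)" and \<gamma>: "\<gamma> \<in> paths X" "v \<in> F (\<gamma> 0)"
    and eq: "\<delta> 1 = \<gamma> 1" "act \<delta> u = act \<gamma> v"
  obtains D C where "openin (path_space_from X (\<delta> 0)) D" "\<delta> \<in> D"
    "openin (path_space_from X (\<gamma> 0)) C" "\<gamma> \<in> C"
    "\<And>\<delta>' \<gamma>'. \<delta>' \<in> D \<Longrightarrow> \<gamma>' \<in> C \<Longrightarrow> \<delta>' 1 = \<gamma>' 1 \<Longrightarrow> act \<delta>' u = act \<gamma>' v"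
proof -
  define x y where "x = \<delta> 0" and "y = \<gamma> 0"
  let ?P = "prod_topology (path_space_from X x) (path_space_from X y)"
  let ?Z = "subtopology ?P {(\<delta>, \<gamma>). \<delta> 1 = \<gamma> 1}"
  let ?N = "{\<alpha> \<in> topspace (path_space_between X x y). act \<alpha> u = v}"
  have xy: "x \<in> topspace X" "y \<in> topspace X" "u \<in> F x" "v \<in> F y"
    using path_ends_in_topspace assms by (auto simp: x_def y_def)
  have f: "continuous_map ?Z (path_space X) (\<lambda>z. fst z)"
    by (intro continuous_map_from_subtopology continuous_map_fst_compose continuous_map_from_path_space_from)
  have g: "continuous_map ?Z (path_space X) (\<lambda>z. path_rev (snd z))"
    by (intro continuous_map_path_rev continuous_map_from_subtopology continuous_map_snd_compose continuous_map_from_path_space_from)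
  have "continuous_map ?Z (path_space X) (\<lambda>z. path_concat (fst z) (path_rev (snd z)))"
    by (rule continuous_map_path_concat[OF f g]) auto
  then have "continuous_map ?Z (path_space_between X x y) (\<lambda>z. path_concat (fst z) (path_rev (snd z)))"
    by (auto simp: continuous_map_into_path_space_between)
  from openin_continuous_map_preimage[OF this openin_act[OF xy(1,3,4)]]
  have "openin ?Z {z \<in> topspace ?Z. path_concat (fst z) (path_rev (snd z)) \<in> ?N}" .
  then obtain T where T: "openin ?P T"
    "{z \<in> topspace ?Z. path_concat (fst z) (path_rev (snd z)) \<in> ?N} = T \<inter> {(\<delta>, \<gamma>). \<delta> 1 = \<gamma> 1}"
    unfolding openin_subtopology by blast
  have "act (path_concat \<delta> (path_rev \<gamma>)) u = v"
    using assms by (simp add: act_concat act_rev path_rev_in_paths)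
  then have "(\<delta>, \<gamma>) \<in> {z \<in> topspace ?Z. path_concat (fst z) (path_rev (snd z)) \<in> ?N}"
    using assms by (simp add: x_def y_def path_concat_in_paths path_rev_in_paths)
  then have "(\<delta>, \<gamma>) \<in> T" unfolding T(2) by blast
  then obtain D C where DC: "openin (path_space_from X x) D" "openin (path_space_from X y) C" "\<delta> \<in> D" "\<gamma> \<in> C" "D \<times> C \<subseteq> T"
    using T(1) unfolding openin_prod_topology_alt by metis
  show ?thesis
  proof (rule that[of D C, folded x_def y_def])
    fix \<delta>' \<gamma>' assume *: "\<delta>' \<in> D" "\<gamma>' \<in> C" "\<delta>' 1 = \<gamma>' 1"
    have \<delta>': "\<delta>' \<in> paths X" "\<delta>' 0 = x" and \<gamma>': "\<gamma>' \<in> paths X" "\<gamma>' 0 = y"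
      using * openin_subset[OF DC(1)] openin_subset[OF DC(2)] by auto
    have "(\<delta>', \<gamma>') \<in> {z \<in> topspace ?Z. path_concat (fst z) (path_rev (snd z)) \<in> ?N}"
      unfolding T(2) using * DC(5) by blast
    then have "act (path_rev \<gamma>') (act \<delta>' u) = v"
      using \<delta>' \<gamma>' * xy(3) by (simp add: act_concat path_rev_in_paths)
    then show "act \<delta>' u = act \<gamma>' v"
      using act_rev'[OF \<gamma>'(1), of "act \<delta>' u"] act_in[OF \<delta>'(1), of u] \<delta>'(2) xy(3) *(3) by simp
  qed (rule DC)+
qed

text \<open>
  \<open>sheet W V u\<close> consists of the endpoints of the lifts at \<open>u\<close> of the paths in \<open>W\<close> that end in \<open>V\<close>.
\<close>

definition sheet :: "(real \<Rightarrow> 'a) set \<Rightarrow> 'a set \<Rightarrow> 'b \<Rightarrow> 'b set" where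
  "sheet W V u = {act \<gamma> u |\<gamma>. \<gamma> \<in> W \<and> \<gamma> 1 \<in> V}"

definition sheet_base :: "'a \<Rightarrow> (real \<Rightarrow> 'a) set \<Rightarrow> 'a set \<Rightarrow> 'b \<Rightarrow> bool" where
  "sheet_base x W V u \<longleftrightarrow> u \<in> F x \<and> openin (path_space_from X x) W \<and> openin X V \<and>
     (\<forall>b\<in>V. \<exists>\<gamma>\<in>W. well_ended X \<gamma> \<and> \<gamma> 1 = b) \<and>
     (\<forall>\<gamma>\<in>W. \<forall>\<gamma>'\<in>W. \<gamma> 1 = \<gamma>' 1 \<longrightarrow> act \<gamma> u = act \<gamma>' u)"

lemma sheet_baseD:
  assumes "sheet_base x W V u"
  shows "u \<in> F x" "openin (path_space_from X x) W" "openin X V"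
    "\<And>b. b \<in> V \<Longrightarrow> \<exists>\<gamma>\<in>W. well_ended X \<gamma> \<and> \<gamma> 1 = b"
    "\<And>\<gamma> \<gamma>'. \<gamma> \<in> W \<Longrightarrow> \<gamma>' \<in> W \<Longrightarrow> \<gamma> 1 = \<gamma>' 1 \<Longrightarrow> act \<gamma> u = act \<gamma>' u"
    "\<And>\<gamma>. \<gamma> \<in> W \<Longrightarrow> \<gamma> \<in> paths X \<and> \<gamma> 0 = x"
proof -
  note s = assms[unfolded sheet_base_def]
  show "u \<in> F x" using s by (elim conjE)
  show W: "openin (path_space_from X x) W" using s by (elim conjE)
  show "openin X V" using s by (elim conjE)
  show "\<gamma> \<in> paths X \<and> \<gamma> 0 = x" if "\<gamma> \<in> W" for \<gamma>
    using openin_subset[OF W] that by auto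
  show "\<exists>\<gamma>\<in>W. well_ended X \<gamma> \<and> \<gamma> 1 = b" if "b \<in> V" for b
    using s by (elim conjE) (rule bspec[OF _ that])
  have "\<forall>\<gamma>\<in>W. \<forall>\<gamma>'\<in>W. \<gamma> 1 = \<gamma>' 1 \<longrightarrow> act \<gamma> u = act \<gamma>' u" using s by (elim conjE)
  then show "act \<gamma> u = act \<gamma>' u" if "\<gamma> \<in> W" "\<gamma>' \<in> W" "\<gamma> 1 = \<gamma>' 1" for \<gamma> \<gamma>'
    using that by blast
qed

lemma sheetE:
  assumes "sheet_base x W V u" "z \<in> sheet W V u"
  obtains \<gamma> where "\<gamma> \<in> W" "\<gamma> 1 \<in> V" "z = act \<gamma> u" "well_ended X \<gamma>" "\<gamma> \<in> paths X" "\<gamma> 0 = x" "proj z = \<gamma> 1"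
proof -
  obtain \<beta> where \<beta>: "\<beta> \<in> W" "\<beta> 1 \<in> V" "z = act \<beta> u" using assms(2) by (auto simp: sheet_def)
  obtain \<gamma> where \<gamma>: "\<gamma> \<in> W" "well_ended X \<gamma>" "\<gamma> 1 = \<beta> 1" using sheet_baseD(4)[OF assms(1) \<beta>(2)] by blast
  have "z = act \<gamma> u" using sheet_baseD(5)[OF assms(1) \<gamma>(1) \<beta>(1) \<gamma>(3)] \<beta>(3) by simp
  moreover have "\<gamma> \<in> paths X" "\<gamma> 0 = x" using sheet_baseD(6)[OF assms(1) \<gamma>(1)] by blast+
  ultimately show ?thesis using that \<gamma> \<beta>(2) sheet_baseD(1)[OF assms(1)] by (simp add: proj_act)
qed

lemma sheet_base_in_topspace:
  assumes "sheet_base x W V u" "\<gamma> \<in> W" shows "x \<in> topspace X"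
  using sheet_baseD(6)[OF assms] path_ends_in_topspace by blast

lemma openin_sheet:
  assumes s: "sheet_base x W V u"
  shows "openin total_top (sheet W V u)"
  unfolding openin_total_top
proof (intro conjI ballI)
  show "sheet W V u \<subseteq> total"
  proof
    fix z assume "z \<in> sheet W V u"
    then obtain \<gamma> where "z = act \<gamma> u" "\<gamma> \<in> paths X" "\<gamma> 0 = x" by (rule sheetE[OF s])
    then show "z \<in> total" using act_in_total sheet_baseD(1)[OF s] by simp
  qed
  fix x' u' assume x': "x' \<in> topspace X" "u' \<in> F x'"
  let ?P = "path_space_from X x'" let ?O = "{\<delta> \<in> topspace ?P. act \<delta> u' \<in> sheet W V u}"
  show "openin ?P ?O"
  proof (subst openin_subopen, intro ballI)
    fix \<delta> assume "\<delta> \<in> ?O"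
    then have \<delta>: "\<delta> \<in> paths X" "\<delta> 0 = x'" "act \<delta> u' \<in> sheet W V u" by auto
    from \<delta>(3) obtain \<gamma> where \<gamma>: "\<gamma> \<in> W" "\<gamma> 1 \<in> V" "act \<delta> u' = act \<gamma> u" "well_ended X \<gamma>" "\<gamma> \<in> paths X" "\<gamma> 0 = x"
      "proj (act \<delta> u') = \<gamma> 1"
      by (rule sheetE[OF s])
    have "\<delta> 1 = \<gamma> 1" using \<gamma>(7) \<delta> x' by (simp add: proj_act)
    then obtain D C where DC: "openin (path_space_from X x') D" "\<delta> \<in> D"
      "openin (path_space_from X x) C" "\<gamma> \<in> C"
      "\<And>\<delta>' \<gamma>'. \<delta>' \<in> D \<Longrightarrow> \<gamma>' \<in> C \<Longrightarrow> \<delta>' 1 = \<gamma>' 1 \<Longrightarrow> act \<delta>' u' = act \<gamma>' u"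
      using act_eq_nearby[of \<delta> u' \<gamma> u] \<delta> \<gamma> x' sheet_baseD(1)[OF s] by metis
    have "openin (path_space_from X (\<gamma> 0)) (C \<inter> W)" using DC(3) sheet_baseD(2)[OF s] \<gamma>(6) by auto
    then obtain V' where V': "openin X V'" "\<gamma> 1 \<in> V'" "\<And>b. b \<in> V' \<Longrightarrow> \<exists>\<gamma>'\<in>C \<inter> W. \<gamma>' 1 = b"
      using well_ended_end[OF \<gamma>(4)] DC(4) \<gamma>(1) by blast
    let ?D = "D \<inter> {\<delta> \<in> topspace ?P. \<delta> 1 \<in> V' \<inter> V}"
    have "openin ?P ?D"
      using openin_continuous_map_preimage[OF continuous_map_path_eval[OF continuous_map_from_path_space_from, of 1]
          openin_Int[OF V'(1) sheet_baseD(3)[OF s]]] DC(1)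
      by (intro openin_Int) auto
    moreover have "\<delta> \<in> ?D" using \<delta> DC(2) V'(2) \<gamma>(2) \<open>\<delta> 1 = \<gamma> 1\<close> by auto
    moreover have "?D \<subseteq> ?O"
    proof
      fix \<delta>' assume \<delta>': "\<delta>' \<in> ?D"
      then obtain \<gamma>' where \<gamma>': "\<gamma>' \<in> C" "\<gamma>' \<in> W" "\<gamma>' 1 = \<delta>' 1" using V'(3) by blast
      have "act \<delta>' u' = act \<gamma>' u" using DC(5) \<delta>' \<gamma>' by auto
      then show "\<delta>' \<in> ?O" using \<delta>' \<gamma>' by (auto simp: sheet_def)
    qed
    ultimately show "\<exists>T. openin ?P T \<and> \<delta> \<in> T \<and> T \<subseteq> ?O" by blast
  qed
qed

lemma inj_on_proj_sheet:
  assumes s: "sheet_base x W V u"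
  shows "inj_on proj (sheet W V u)"
proof (rule inj_onI)
  fix z z' assume z: "z \<in> sheet W V u" "z' \<in> sheet W V u" "proj z = proj z'"
  obtain \<gamma> where \<gamma>: "\<gamma> \<in> W" "z = act \<gamma> u" "proj z = \<gamma> 1" using z(1) by (rule sheetE[OF s])
  obtain \<gamma>' where \<gamma>': "\<gamma>' \<in> W" "z' = act \<gamma>' u" "proj z' = \<gamma>' 1" using z(2) by (rule sheetE[OF s])
  show "z = z'" using sheet_baseD(5)[OF s \<gamma>(1) \<gamma>'(1)] \<gamma> \<gamma>' z(3) by simp
qed

lemma openin_proj_image:
  assumes s: "sheet_base x W V u" and Q: "openin total_top Q" "Q \<subseteq> sheet W V u"
  shows "openin X (proj ` Q)"
proof (subst openin_subopen, clarify)
  fix z assume z: "z \<in> Q"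
  then have "z \<in> sheet W V u" using Q(2) by blast
  then obtain \<gamma> where \<gamma>: "\<gamma> \<in> W" "z = act \<gamma> u" "well_ended X \<gamma>" "\<gamma> \<in> paths X" "\<gamma> 0 = x" "proj z = \<gamma> 1"
    by (rule sheetE[OF s])
  let ?C = "{\<gamma> \<in> topspace (path_space_from X x). act \<gamma> u \<in> Q}"
  have "openin (path_space_from X (\<gamma> 0)) ?C"
    using Q(1) sheet_base_in_topspace[OF s \<gamma>(1)] sheet_baseD(1)[OF s] \<gamma>(5) unfolding openin_total_top by blast
  moreover have "\<gamma> \<in> ?C" using \<gamma> z by simp
  ultimately obtain V' where V': "openin X V'" "\<gamma> 1 \<in> V'" "\<And>b. b \<in> V' \<Longrightarrow> \<exists>\<gamma>'\<in>?C. \<gamma>' 1 = b"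
    using well_ended_end[OF \<gamma>(3)] by blast
  have "b \<in> proj ` Q" if b: "b \<in> V'" for b
  proof -
    obtain \<gamma>' where "\<gamma>' \<in> ?C" "\<gamma>' 1 = b" using V'(3)[OF b] by blast
    then show ?thesis using sheet_baseD(1)[OF s] by (auto simp: proj_act intro!: rev_image_eqI[of "act \<gamma>' u"])
  qed
  then show "\<exists>T. openin X T \<and> proj z \<in> T \<and> T \<subseteq> proj ` Q" using V' \<gamma>(6) by auto
qed

text \<open>
  Through two points of a fibre there are sheets with the same \<open>W\<close> and \<open>V\<close>; they are disjoint if the
  points differ, which replaces the Hausdorff property in the proof that lifts are unique.
\<close>

lemma ex_sheets:
  assumes x: "x \<in> topspace X" and u: "u \<in> F x" and v: "v \<in> F x"
  obtains W V u0 v0 where "sheet_base x W V u0" "sheet_base x W V v0" "u \<in> sheet W V u0" "v \<in> sheet W V v0"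
    "u \<noteq> v \<longrightarrow> sheet W V u0 \<inter> sheet W V v0 = {}"
proof -
  obtain \<alpha> where \<alpha>: "locally_well_ended X \<alpha>" "\<alpha> 0 = x" "\<alpha> 1 = x"
    using wep x unfolding locally_wep_connected_def by blast
  have \<alpha>p: "\<alpha> \<in> paths X" using \<alpha>(1) by (simp add: locally_well_ended_def)
  have ex: "\<exists>W w0. w0 \<in> F x \<and> openin (path_space_from X x) W \<and> \<alpha> \<in> W \<and> act \<alpha> w0 = w \<and>
      (\<forall>\<gamma>\<in>W. \<forall>\<gamma>'\<in>W. \<gamma> 1 = \<gamma>' 1 \<longrightarrow> act \<gamma> w0 = act \<gamma>' w0)" if w: "w \<in> F x" for w
  proof -
    let ?w = "act (path_rev \<alpha>) w"
    have w0: "?w \<in> F x" using act_in[of "path_rev \<alpha>" w] w \<alpha> \<alpha>p by (simp add: path_rev_in_paths)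
    obtain D C where DC: "openin (path_space_from X (\<alpha> 0)) D" "\<alpha> \<in> D" "openin (path_space_from X (\<alpha> 0)) C" "\<alpha> \<in> C"
      "\<And>\<delta>' \<gamma>'. \<delta>' \<in> D \<Longrightarrow> \<gamma>' \<in> C \<Longrightarrow> \<delta>' 1 = \<gamma>' 1 \<Longrightarrow> act \<delta>' ?w = act \<gamma>' ?w"
      by (rule act_eq_nearby[of \<alpha> ?w \<alpha> ?w]) (use \<alpha>p w0 \<alpha>(2) in auto)
    have "act \<alpha> ?w = w" using act_rev'[OF \<alpha>p] w \<alpha>(3) by simp
    moreover have "openin (path_space_from X x) (D \<inter> C)" using DC(1,3) unfolding \<alpha>(2) by (rule openin_Int)
    moreover have "\<forall>\<gamma>\<in>D \<inter> C. \<forall>\<gamma>'\<in>D \<inter> C. \<gamma> 1 = \<gamma>' 1 \<longrightarrow> act \<gamma> ?w = act \<gamma>' ?w" using DC(5) by blast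
    ultimately show ?thesis using w0 DC(2,4) by blast
  qed
  obtain W1 u0 where 1: "u0 \<in> F x" "openin (path_space_from X x) W1" "\<alpha> \<in> W1" "act \<alpha> u0 = u"
    "\<forall>\<gamma>\<in>W1. \<forall>\<gamma>'\<in>W1. \<gamma> 1 = \<gamma>' 1 \<longrightarrow> act \<gamma> u0 = act \<gamma>' u0" using ex[OF u] by (elim exE conjE) (rule that; assumption)
  obtain W2 v0 where 2: "v0 \<in> F x" "openin (path_space_from X x) W2" "\<alpha> \<in> W2" "act \<alpha> v0 = v"
    "\<forall>\<gamma>\<in>W2. \<forall>\<gamma>'\<in>W2. \<gamma> 1 = \<gamma>' 1 \<longrightarrow> act \<gamma> v0 = act \<gamma>' v0" using ex[OF v] by (elim exE conjE) (rule that; assumption)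
  have W: "openin (path_space_from X x) (W1 \<inter> W2)" by (rule openin_Int[OF 1(2) 2(2)])
  have "openin (path_space_from X (\<alpha> 0)) (W1 \<inter> W2)" "\<alpha> \<in> W1 \<inter> W2" using W 1(3) 2(3) \<alpha>(2) by simp_all
  then obtain V where V: "openin X V" "\<alpha> 1 \<in> V" "\<forall>b\<in>V. \<exists>\<gamma>'\<in>W1 \<inter> W2. well_ended X \<gamma>' \<and> \<gamma>' 1 = b"
    by (rule locally_well_ended_end[OF \<alpha>(1)])
  have "\<forall>\<gamma>\<in>W1 \<inter> W2. \<forall>\<gamma>'\<in>W1 \<inter> W2. \<gamma> 1 = \<gamma>' 1 \<longrightarrow> act \<gamma> u0 = act \<gamma>' u0" using 1(5) by blast
  then have s1: "sheet_base x (W1 \<inter> W2) V u0" unfolding sheet_base_def using 1(1) W V(1,3) by (intro conjI)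
  have "\<forall>\<gamma>\<in>W1 \<inter> W2. \<forall>\<gamma>'\<in>W1 \<inter> W2. \<gamma> 1 = \<gamma>' 1 \<longrightarrow> act \<gamma> v0 = act \<gamma>' v0" using 2(5) by blast
  then have s2: "sheet_base x (W1 \<inter> W2) V v0" unfolding sheet_base_def using 2(1) W V(1,3) by (intro conjI)
  note s = s1 s2
  have "sheet (W1 \<inter> W2) V u0 \<inter> sheet (W1 \<inter> W2) V v0 = {}" if "u \<noteq> v"
  proof (rule ccontr)
    assume "sheet (W1 \<inter> W2) V u0 \<inter> sheet (W1 \<inter> W2) V v0 \<noteq> {}"
    then obtain z where z: "z \<in> sheet (W1 \<inter> W2) V u0" "z \<in> sheet (W1 \<inter> W2) V v0" by blast
    obtain \<gamma> where \<gamma>: "\<gamma> \<in> W1 \<inter> W2" "z = act \<gamma> u0" "\<gamma> \<in> paths X" "\<gamma> 0 = x" "proj z = \<gamma> 1"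
      using z(1) by (rule sheetE[OF s(1)])
    obtain \<gamma>' where \<gamma>': "\<gamma>' \<in> W1 \<inter> W2" "z = act \<gamma>' v0" "proj z = \<gamma>' 1"
      using z(2) by (rule sheetE[OF s(2)])
    have z_eq: "act \<gamma> v0 = z" using sheet_baseD(5)[OF s(2) \<gamma>(1) \<gamma>'(1)] \<gamma>(5) \<gamma>'(2,3) by simp
    have "u0 = act (path_rev \<gamma>) (act \<gamma> u0)" using act_rev[OF \<gamma>(3)] 1(1) \<gamma>(4) by simp
    also have "\<dots> = act (path_rev \<gamma>) (act \<gamma> v0)" by (simp only: z_eq \<gamma>(2)[symmetric])
    also have "\<dots> = v0" using act_rev[OF \<gamma>(3)] 2(1) \<gamma>(4) by simp
    finally show False using 1(4) 2(4) that by metis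
  qed
  moreover have "u \<in> sheet (W1 \<inter> W2) V u0" "v \<in> sheet (W1 \<inter> W2) V v0"
    unfolding sheet_def using 1(3) 1(4)[symmetric] 2(3) 2(4)[symmetric] V(2) by blast+
  ultimately show ?thesis using that s by blast
qed

lemma local_homeomorphism_proj: "local_homeomorphism total_top X proj"
  unfolding local_homeomorphism_def
proof (intro conjI ballI)
  fix u assume "u \<in> topspace total_top"
  then have "proj u \<in> topspace X" "u \<in> F (proj u)" by (auto elim: totalE)
  then obtain W V u0 where s: "sheet_base (proj u) W V u0" "u \<in> sheet W V u0"
    using ex_sheets[of "proj u" u u] by metis
  let ?S = "sheet W V u0"
  have S: "openin total_top ?S" by (rule openin_sheet[OF s(1)])
  have im: "openin X (proj ` ?S)" by (rule openin_proj_image[OF s(1) S]) blast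
  have "homeomorphic_map (subtopology total_top ?S) (subtopology X (proj ` ?S)) proj"
  proof (rule bijective_open_imp_homeomorphic_map)
    show "continuous_map (subtopology total_top ?S) (subtopology X (proj ` ?S)) proj"
      by (auto simp: continuous_map_in_subtopology continuous_map_from_subtopology continuous_map_proj)
    show "open_map (subtopology total_top ?S) (subtopology X (proj ` ?S)) proj"
      unfolding open_map_def openin_open_subtopology[OF S] openin_open_subtopology[OF im]
      using openin_proj_image[OF s(1)] by blast
    show "proj ` topspace (subtopology total_top ?S) = topspace (subtopology X (proj ` ?S))"
      using openin_subset[OF S] openin_subset[OF im] by auto
    show "inj_on proj (topspace (subtopology total_top ?S))"
      using inj_on_proj_sheet[OF s(1)] by (rule inj_on_subset) auto
  qed
  with S s(2) im show "\<exists>U. openin total_top U \<and> u \<in> U \<and> openin X (proj ` U) \<and>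
      homeomorphic_map (subtopology total_top U) (subtopology X (proj ` U)) proj"
    by (intro exI[of _ ?S] conjI)
qed (rule continuous_map_proj)

lemma lifts_agree:
  assumes Z: "connected_space Z" and f: "continuous_map Z total_top f" and g: "continuous_map Z total_top g"
    and eq: "\<And>z. z \<in> topspace Z \<Longrightarrow> proj (f z) = proj (g z)"
    and z0: "z0 \<in> topspace Z" "f z0 = g z0" and z: "z \<in> topspace Z"
  shows "f z = g z"
proof -
  let ?A = "{z \<in> topspace Z. f z = g z}" and ?B = "{z \<in> topspace Z. f z \<noteq> g z}"
  have sheets: "\<exists>U V. openin total_top U \<and> openin total_top V \<and> f z \<in> U \<and> g z \<in> V \<and> inj_on proj U \<and>
      (f z = g z \<longrightarrow> V = U) \<and> (f z \<noteq> g z \<longrightarrow> U \<inter> V = {})" if z: "z \<in> topspace Z" for z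
  proof -
    have "f z \<in> total" "g z \<in> total"
      using continuous_map_in_topspace[OF f z] continuous_map_in_topspace[OF g z] by simp_all
    then have "proj (f z) \<in> topspace X" "f z \<in> F (proj (f z))" "g z \<in> F (proj (f z))"
      using eq[OF z] by (auto elim: totalE)
    then obtain W V u v where s: "sheet_base (proj (f z)) W V u" "sheet_base (proj (f z)) W V v"
      "f z \<in> sheet W V u" "g z \<in> sheet W V v" "f z \<noteq> g z \<longrightarrow> sheet W V u \<inter> sheet W V v = {}"
      by (rule ex_sheets)
    show ?thesis
    proof (cases "f z = g z")
      case True
      show ?thesis
        by (rule exI[of _ "sheet W V u"], rule exI[of _ "sheet W V u"])
          (use True s openin_sheet inj_on_proj_sheet in auto)
    next
      case False
      show ?thesis
        by (rule exI[of _ "sheet W V u"], rule exI[of _ "sheet W V v"])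
          (use False s openin_sheet inj_on_proj_sheet in auto)
    qed
  qed
  have "openin Z ?A"
  proof (subst openin_subopen, intro ballI)
    fix z assume "z \<in> ?A"
    then have z: "z \<in> topspace Z" "f z = g z" by auto
    obtain U where U: "openin total_top U" "f z \<in> U" "inj_on proj U" using sheets[OF z(1)] by blast
    let ?T = "{w \<in> topspace Z. f w \<in> U} \<inter> {w \<in> topspace Z. g w \<in> U}"
    have "openin Z ?T" using f g U(1) by (intro openin_Int openin_continuous_map_preimage)
    moreover have "?T \<subseteq> ?A" using inj_onD[OF U(3)] eq by blast
    ultimately show "\<exists>T. openin Z T \<and> z \<in> T \<and> T \<subseteq> ?A" using z U(2) by (intro exI[of _ ?T]) auto
  qed
  moreover have "openin Z ?B"
  proof (subst openin_subopen, intro ballI)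
    fix z assume "z \<in> ?B"
    then have z: "z \<in> topspace Z" "f z \<noteq> g z" by auto
    obtain U V where U: "openin total_top U" "openin total_top V" "f z \<in> U" "g z \<in> V" "U \<inter> V = {}"
      using sheets[OF z(1)] z(2) by blast
    let ?T = "{w \<in> topspace Z. f w \<in> U} \<inter> {w \<in> topspace Z. g w \<in> V}"
    have "openin Z ?T" using f g U(1,2) by (intro openin_Int openin_continuous_map_preimage)
    moreover have "?T \<subseteq> ?B" using U(5) by auto
    ultimately show "\<exists>T. openin Z T \<and> z \<in> T \<and> T \<subseteq> ?B" using z U(3,4) by (intro exI[of _ ?T]) auto
  qed
  moreover have "?A \<inter> ?B = {}" "topspace Z \<subseteq> ?A \<union> ?B" "?A \<noteq> {}" using z0 by auto
  ultimately have "?B = {}" using Z unfolding connected_space_def by blast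
  then show ?thesis using z by blast
qed

definition lift :: "'b \<Rightarrow> (real \<Rightarrow> 'a) \<Rightarrow> real \<Rightarrow> 'b" where
  "lift u \<alpha> = (\<lambda>t\<in>{0..1}. act (\<lambda>s\<in>{0..1}. \<alpha> (t * s)) u)"

lemma initial_segment_in_paths:
  assumes "\<alpha> \<in> paths X" "t \<in> {0..1}"
  shows "(\<lambda>s\<in>{0..1}. \<alpha> (t * s)) \<in> paths X"
  by (rule reparam_in_paths[OF assms(1)])
    (use assms(2) in \<open>auto simp: continuous_map_into_interval mult_le_one intro!: continuous_intros\<close>)

lemma lift_0:
  assumes "\<alpha> \<in> paths X" "u \<in> F (\<alpha> 0)"
  shows "lift u \<alpha> 0 = u"
proof -
  have "lift u \<alpha> 0 = act (\<lambda>t\<in>{0..1}. \<alpha> 0) u" by (simp add: lift_def)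
  then show ?thesis using act_const[of "\<alpha> 0" u] path_ends_in_topspace[of \<alpha>] assms by simp
qed

lemma lift_1: "\<alpha> \<in> paths X \<Longrightarrow> lift u \<alpha> 1 = act \<alpha> u"
  by (simp add: lift_def path_eq_reparam_id)

lemma proj_lift:
  assumes "\<alpha> \<in> paths X" "u \<in> F (\<alpha> 0)"
  shows "compose {0..1} proj (lift u \<alpha>) = \<alpha>"
proof
  fix t :: real
  show "compose {0..1} proj (lift u \<alpha>) t = \<alpha> t"
  proof (cases "t \<in> {0..1}")
    case True
    have "proj (act (\<lambda>s\<in>{0..1}. \<alpha> (t * s)) u) = \<alpha> t"
      using proj_act[OF initial_segment_in_paths[OF assms(1) True], of u] assms(2) by simp
    then show ?thesis using True by (simp add: compose_def lift_def)
  next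
    case False
    then have "\<alpha> t = undefined" using assms(1) extensional_arb[of \<alpha> "{0..1}" t] unfolding paths_iff by blast
    then show ?thesis using False by (auto simp: compose_def)
  qed
qed

lemma continuous_map_lift:
  assumes x: "x \<in> topspace X" "u \<in> F x"
  shows "continuous_map (path_space_from X x) (path_space_from total_top u) (lift u)"
proof -
  let ?P = "path_space_from X x"
  have "continuous_map (prod_topology ?P unit_interval) (path_space X) (\<lambda>z. \<lambda>s\<in>{0..1}. fst z (snd z * s))"
  proof (rule continuous_map_path_reparam)
    show "continuous_map (prod_topology ?P unit_interval) (path_space X) fst"
      using continuous_map_fst_compose[OF continuous_map_from_path_space_from] .
    show "continuous_map (prod_topology (prod_topology ?P unit_interval) unit_interval) unit_interval
        (\<lambda>(z, s). snd z * s)"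
      unfolding continuous_map_into_interval case_prod_unfold
    proof (intro conjI ballI)
      show "continuous_map (prod_topology (prod_topology ?P unit_interval) unit_interval) euclideanreal
          (\<lambda>q. snd (fst q) * snd q)"
        by (rule continuous_map_real_mult[OF continuous_map_fst_compose[OF continuous_map_snd_real] continuous_map_snd_real])
    qed (auto simp: mult_le_one)
  qed
  then have "continuous_map (prod_topology ?P unit_interval) ?P (\<lambda>z. \<lambda>s\<in>{0..1}. fst z (snd z * s))"
    by (auto simp: continuous_map_into_path_space_from)
  from continuous_map_compose[OF this continuous_map_act[OF x]]
  have "continuous_map ?P (path_space total_top) (lift u)"
    unfolding lift_def[abs_def] by (intro continuous_map_path_curry) (simp add: o_def case_prod_unfold)
  then show ?thesis using x lift_0 by (simp add: continuous_map_into_path_space_from)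
qed

lemma lift_unique:
  assumes \<beta>: "\<beta> \<in> paths total_top"
  shows "lift (\<beta> 0) (compose {0..1} proj \<beta>) = \<beta>"
proof
  fix t :: real
  let ?\<alpha> = "compose {0..1} proj \<beta>"
  have "continuous_map unit_interval X (proj \<circ> \<beta>)"
    using \<beta> by (intro continuous_map_compose[OF _ continuous_map_proj]) (simp add: paths_iff)
  then have "continuous_map unit_interval X ?\<alpha>" by (rule continuous_map_eq) (simp add: compose_def)
  then have \<alpha>: "?\<alpha> \<in> paths X" by (simp add: paths_iff)
  have \<beta>0: "proj (\<beta> 0) \<in> topspace X" "\<beta> 0 \<in> F (proj (\<beta> 0))" "?\<alpha> 0 = proj (\<beta> 0)"
    using path_in_topspace[OF \<beta>, of 0] by (auto simp: compose_def elim: totalE)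
  let ?L = "lift (\<beta> 0) ?\<alpha>"
  have "?L \<in> paths total_top"
    using continuous_map_in_topspace[OF continuous_map_lift[OF \<beta>0(1,2)], of ?\<alpha>] \<alpha> \<beta>0(3) by simp
  then have L: "continuous_map unit_interval total_top ?L" by (simp add: paths_iff)
  have pL: "compose {0..1} proj ?L = ?\<alpha>" using proj_lift[OF \<alpha>] \<beta>0 by simp
  show "?L t = \<beta> t"
  proof (cases "t \<in> {0..1}")
    case True
    show ?thesis
    proof (rule lifts_agree[OF _ L])
      show "connected_space unit_interval" 
        using connectedin_iff_connected[of "{0..1::real}"] by (simp add: connectedin_def)
      show "continuous_map unit_interval total_top \<beta>" using \<beta> by (simp add: paths_iff)
      show "?L 0 = \<beta> 0" using lift_0[OF \<alpha>] \<beta>0 by simp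
      show "proj (?L z) = proj (\<beta> z)" if "z \<in> topspace unit_interval" for z
        using fun_cong[OF pL, of z] that by (simp add: compose_def)
    qed (use True in auto)
  next
    case False
    then show ?thesis using \<beta> by (auto simp: lift_def paths_iff extensional_def)
  qed
qed

lemma homeomorphic_maps_lift:
  assumes x: "x \<in> topspace X" "u \<in> F x"
  shows "homeomorphic_maps (path_space_from total_top u) (path_space_from X x) (compose {0..1} proj) (lift u)"
  unfolding homeomorphic_maps_def
proof (intro conjI ballI)
  have "continuous_map (prod_topology (path_space_from total_top u) unit_interval) total_top (\<lambda>z. fst z (snd z))"
    by (rule continuous_map_path_apply[OF continuous_map_fst_compose[OF continuous_map_from_path_space_from] continuous_map_snd])
  from continuous_map_compose[OF this continuous_map_proj]
  have "continuous_map (path_space_from total_top u) (path_space X) (\<lambda>\<beta>. \<lambda>t\<in>{0..1}. proj (\<beta> t))"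
    by (intro continuous_map_path_curry) (simp add: o_def case_prod_unfold)
  then show "continuous_map (path_space_from total_top u) (path_space_from X x) (compose {0..1} proj)"
    using proj_eq[OF x] by (simp add: continuous_map_into_path_space_from compose_def[abs_def])
  show "lift u (compose {0..1} proj \<beta>) = \<beta>" if "\<beta> \<in> topspace (path_space_from total_top u)" for \<beta>
    using lift_unique[of \<beta>] that by auto
  show "compose {0..1} proj (lift u \<alpha>) = \<alpha>" if "\<alpha> \<in> topspace (path_space_from X x)" for \<alpha>
    using proj_lift[of \<alpha> u] that x by auto
qed (rule continuous_map_lift[OF x])

sublocale semicovering_map total_top X proj
proof
  show "continuous_lifting_of_paths total_top X proj"
    unfolding continuous_lifting_of_paths_def
    by (metis homeomorphic_maps_lift homeomorphic_maps_imp_map totalE topspace_total_top)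
  show "continuous_map total_top X proj" by (rule continuous_map_proj)
  show "local_homeomorphism total_top X proj" by (rule local_homeomorphism_proj)
qed

lemma path_lift_end:
  assumes "\<alpha> \<in> paths X" "u \<in> F (\<alpha> 0)"
  shows "path_lift total_top proj \<alpha> u 1 = act \<alpha> u"
proof -
  have x: "\<alpha> 0 \<in> topspace X" using path_ends_in_topspace assms by blast
  have "homeomorphic_maps (path_space_from total_top u) (path_space_from X (proj u)) (compose {0..1} proj) (lift u)"
    unfolding proj_eq[OF x assms(2)] by (rule homeomorphic_maps_lift[OF x assms(2)])
  then have "path_lift total_top proj \<alpha> u = lift u \<alpha>"
    by (rule path_lift_eq[OF _ assms(1)]) (rule proj_eq[OF x assms(2), symmetric])
  then show ?thesis by (simp add: lift_1 assms(1))
qed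

lemma fibre_proj:
  assumes "x \<in> topspace X"
  shows "fibre total_top proj x = F x"
proof
  show "fibre total_top proj x \<subseteq> F x" unfolding fibre_def topspace_total_top using totalE by blast
  show "F x \<subseteq> fibre total_top proj x"
    unfolding fibre_def topspace_total_top using proj_eq[OF assms] totalI[OF assms] by blast
qed

end

section \<open>Categories and the monodromy functor\<close>

lemma categoryD:
  assumes "category C"
  shows "\<And>a. a \<in> Obj C \<Longrightarrow> Ident C a \<in> Hom C a a"
    and "\<And>a b c f g. a \<in> Obj C \<Longrightarrow> b \<in> Obj C \<Longrightarrow> c \<in> Obj C \<Longrightarrow> f \<in> Hom C a b \<Longrightarrow> g \<in> Hom C b c \<Longrightarrow>
      Comp C a b c f g \<in> Hom C a c"
    and "\<And>a b f. a \<in> Obj C \<Longrightarrow> b \<in> Obj C \<Longrightarrow> f \<in> Hom C a b \<Longrightarrow> Comp C a a b (Ident C a) f = f"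
    and "\<And>a b f. a \<in> Obj C \<Longrightarrow> b \<in> Obj C \<Longrightarrow> f \<in> Hom C a b \<Longrightarrow> Comp C a b b f (Ident C b) = f"
    and "\<And>a b c d f g h. a \<in> Obj C \<Longrightarrow> b \<in> Obj C \<Longrightarrow> c \<in> Obj C \<Longrightarrow> d \<in> Obj C \<Longrightarrow>
      f \<in> Hom C a b \<Longrightarrow> g \<in> Hom C b c \<Longrightarrow> h \<in> Hom C c d \<Longrightarrow>
      Comp C a c d (Comp C a b c f g) h = Comp C a b d f (Comp C b c d g h)"
  using assms unfolding category_def by blast+

lemma is_functorD:
  assumes "is_functor C D F"
  shows "\<And>a. a \<in> Obj C \<Longrightarrow> fobj F a \<in> Obj D"
    and "\<And>a b f. a \<in> Obj C \<Longrightarrow> b \<in> Obj C \<Longrightarrow> f \<in> Hom C a b \<Longrightarrow>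
      farr F (a, b, f) \<in> Hom D (fobj F a) (fobj F b)"
    and "\<And>a. a \<in> Obj C \<Longrightarrow> farr F (a, a, Ident C a) = Ident D (fobj F a)"
    and "\<And>a b c f g. a \<in> Obj C \<Longrightarrow> b \<in> Obj C \<Longrightarrow> c \<in> Obj C \<Longrightarrow> f \<in> Hom C a b \<Longrightarrow> g \<in> Hom C b c \<Longrightarrow>
      farr F (a, c, Comp C a b c f g) =
      Comp D (fobj F a) (fobj F b) (fobj F c) (farr F (a, b, f)) (farr F (b, c, g))"
  using assms unfolding is_functor_def by blast+

lemma isomorphism_of_categoriesI:
  assumes C: "category C" and D: "category D" and F: "is_functor C D F"
    and obj: "bij_betw (fobj F) (Obj C) (Obj D)"
    and arr: "\<And>a b. a \<in> Obj C \<Longrightarrow> b \<in> Obj C \<Longrightarrow>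
      bij_betw (\<lambda>f. farr F (a, b, f)) (Hom C a b) (Hom D (fobj F a) (fobj F b))"
  shows "isomorphism_of_categories C D F"
proof -
  define o' where "o' = inv_into (Obj C) (fobj F)"
  define h where "h = (\<lambda>(x, y, g). inv_into (Hom C (o' x) (o' y)) (\<lambda>f. farr F (o' x, o' y, f)) g)"
  let ?G = "\<lparr>fobj = o', farr = h\<rparr>"
  have o1: "o' x \<in> Obj C" and o2: "fobj F (o' x) = x" if "x \<in> Obj D" for x
    using that obj unfolding o'_def bij_betw_def by (auto intro: inv_into_into f_inv_into_f)
  have o3: "o' (fobj F a) = a" if "a \<in> Obj C" for a
    using that obj unfolding o'_def bij_betw_def by (simp add: inv_into_f_f)
  have h: "h (x, y, g) \<in> Hom C (o' x) (o' y) \<and> farr F (o' x, o' y, h (x, y, g)) = g"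
    if "x \<in> Obj D" "y \<in> Obj D" "g \<in> Hom D x y" for x y g
  proof -
    have "g \<in> (\<lambda>f. farr F (o' x, o' y, f)) ` Hom C (o' x) (o' y)"
      using arr[OF o1[OF that(1)] o1[OF that(2)]] that o2 unfolding bij_betw_def by simp
    then show ?thesis unfolding h_def prod.case by (intro conjI inv_into_into f_inv_into_f)
  qed
  have h_eq: "h (x, y, g) = f"
    if "x \<in> Obj D" "y \<in> Obj D" "f \<in> Hom C (o' x) (o' y)" "farr F (o' x, o' y, f) = g" for x y g f
    unfolding h_def prod.case
    by (rule inv_into_f_eq[OF bij_betw_imp_inj_on[OF arr[OF o1[OF that(1)] o1[OF that(2)]]] that(3,4)])
  have "is_functor D C ?G"
    unfolding is_functor_def functor_struct.simps
  proof (intro conjI ballI)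
    fix a b c f g assume *: "a \<in> Obj D" "b \<in> Obj D" "c \<in> Obj D" "f \<in> Hom D a b" "g \<in> Hom D b c"
    note f = h[OF *(1,2,4)] and g = h[OF *(2,3,5)]
    show "h (a, c, Comp D a b c f g) = Comp C (o' a) (o' b) (o' c) (h (a, b, f)) (h (b, c, g))"
      by (rule h_eq[OF *(1,3)])
        (use f g * o1 o2 in \<open>simp_all add: categoryD(2)[OF C] is_functorD(4)[OF F]\<close>)
  next
    fix a assume a: "a \<in> Obj D"
    show "h (a, a, Ident D a) = Ident C (o' a)"
      by (rule h_eq[OF a a]) (use a o1 o2 in \<open>simp_all add: categoryD(1)[OF C] is_functorD(3)[OF F]\<close>)
  qed (use o1 h in auto)
  moreover have "h (fobj F a, fobj F b, farr F (a, b, f)) = f" if "a \<in> Obj C" "b \<in> Obj C" "f \<in> Hom C a b" for a b f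
    by (rule h_eq) (use that o3 is_functorD(1)[OF F] in simp_all)
  ultimately show ?thesis
    unfolding isomorphism_of_categories_def arrows_def
    using C D F o2 o3 h by (intro conjI exI[of _ ?G]) auto
qed

lemma category_TopFunc:
  fixes C :: "('o, 'm, 'y) top_cat_struct_scheme" and D :: "('p, 'n, 'z) top_cat_struct_scheme"
  assumes D: "category D"
  shows "category (TopFunc C D)"
proof -
  have F: "is_functor C D F" if "F \<in> Obj (TopFunc C D)" for F
    using that by (simp add: TopFunc_def is_top_functor_def)
  have nat: "\<eta> a \<in> Hom D (fobj F a) (fobj G a)" if "\<eta> \<in> Hom (TopFunc C D) F G" "a \<in> Obj C" for \<eta> F G a
    using that by (auto simp: TopFunc_def natural_transformations_def)
  have ext: "\<eta> \<in> extensional (Obj C)" if "\<eta> \<in> Hom (TopFunc C D) F G" for \<eta> F G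
    using that by (auto simp: TopFunc_def natural_transformations_def PiE_def)
  have eq: "Comp D (fobj F a) (fobj F b) (fobj G b) (farr F (a, b, f)) (\<eta> b) =
      Comp D (fobj F a) (fobj G a) (fobj G b) (\<eta> a) (farr G (a, b, f))"
    if "\<eta> \<in> Hom (TopFunc C D) F G" "a \<in> Obj C" "b \<in> Obj C" "f \<in> Hom C a b" for \<eta> F G a b f
    using that by (auto simp: TopFunc_def natural_transformations_def)
  have ident: "Ident (TopFunc C D) F = (\<lambda>a\<in>Obj C. Ident D (fobj F a))" for F by (simp add: TopFunc_def)
  have comp: "Comp (TopFunc C D) F G H \<eta> \<theta> =
      (\<lambda>a\<in>Obj C. Comp D (fobj F a) (fobj G a) (fobj H a) (\<eta> a) (\<theta> a))" for F G H \<eta> \<theta>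
    by (simp add: TopFunc_def)
  have hom: "Hom (TopFunc C D) F G = natural_transformations C D F G" for F G by (simp add: TopFunc_def)
  show ?thesis
    unfolding category_def
  proof (intro conjI ballI)
    fix F assume "F \<in> Obj (TopFunc C D)"
    note F = F[OF this]
    show "Ident (TopFunc C D) F \<in> Hom (TopFunc C D) F F"
      unfolding ident hom natural_transformations_def
      using is_functorD(1,2)[OF F] by (auto simp: categoryD(1,3,4)[OF D])
  next
    fix F G H \<eta> \<theta> assume FGH: "F \<in> Obj (TopFunc C D)" "G \<in> Obj (TopFunc C D)" "H \<in> Obj (TopFunc C D)"
      and \<eta>: "\<eta> \<in> Hom (TopFunc C D) F G" and \<theta>: "\<theta> \<in> Hom (TopFunc C D) G H"
    note o = is_functorD(1)[OF F[OF FGH(1)]] is_functorD(1)[OF F[OF FGH(2)]] is_functorD(1)[OF F[OF FGH(3)]]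
    note m = is_functorD(2)[OF F[OF FGH(1)]] is_functorD(2)[OF F[OF FGH(2)]] is_functorD(2)[OF F[OF FGH(3)]]
    show "Comp (TopFunc C D) F G H \<eta> \<theta> \<in> Hom (TopFunc C D) F H"
      unfolding comp hom natural_transformations_def
    proof (intro CollectI conjI ballI)
      show "(\<lambda>a\<in>Obj C. Comp D (fobj F a) (fobj G a) (fobj H a) (\<eta> a) (\<theta> a)) \<in> (\<Pi>\<^sub>E a\<in>Obj C. Hom D (fobj F a) (fobj H a))"
        using nat[OF \<eta>] nat[OF \<theta>] o by (auto intro!: categoryD(2)[OF D])
      fix a b f assume ab: "a \<in> Obj C" "b \<in> Obj C" and f: "f \<in> Hom C a b"
      note o' = o(1)[OF ab(1)] o(2)[OF ab(1)] o(3)[OF ab(1)] o(1)[OF ab(2)] o(2)[OF ab(2)] o(3)[OF ab(2)]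
      note m' = m(1)[OF ab f] m(2)[OF ab f] m(3)[OF ab f]
      note n = nat[OF \<eta> ab(1)] nat[OF \<eta> ab(2)] nat[OF \<theta> ab(1)] nat[OF \<theta> ab(2)]
      have "Comp D (fobj F a) (fobj F b) (fobj H b) (farr F (a, b, f)) (Comp D (fobj F b) (fobj G b) (fobj H b) (\<eta> b) (\<theta> b))
        = Comp D (fobj F a) (fobj G b) (fobj H b) (Comp D (fobj F a) (fobj F b) (fobj G b) (farr F (a, b, f)) (\<eta> b)) (\<theta> b)"
        using o' m' n by (intro categoryD(5)[OF D, symmetric])
      also have "\<dots> = Comp D (fobj F a) (fobj G b) (fobj H b) (Comp D (fobj F a) (fobj G a) (fobj G b) (\<eta> a) (farr G (a, b, f))) (\<theta> b)"
        by (simp only: eq[OF \<eta> ab f])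
      also have "\<dots> = Comp D (fobj F a) (fobj G a) (fobj H b) (\<eta> a) (Comp D (fobj G a) (fobj G b) (fobj H b) (farr G (a, b, f)) (\<theta> b))"
        using o' m' n by (intro categoryD(5)[OF D])
      also have "\<dots> = Comp D (fobj F a) (fobj G a) (fobj H b) (\<eta> a) (Comp D (fobj G a) (fobj H a) (fobj H b) (\<theta> a) (farr H (a, b, f)))"
        by (simp only: eq[OF \<theta> ab f])
      also have "\<dots> = Comp D (fobj F a) (fobj H a) (fobj H b) (Comp D (fobj F a) (fobj G a) (fobj H a) (\<eta> a) (\<theta> a)) (farr H (a, b, f))"
        using o' m' n by (intro categoryD(5)[OF D, symmetric])
      finally show "Comp D (fobj F a) (fobj F b) (fobj H b) (farr F (a, b, f))
          ((\<lambda>a\<in>Obj C. Comp D (fobj F a) (fobj G a) (fobj H a) (\<eta> a) (\<theta> a)) b) =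
        Comp D (fobj F a) (fobj H a) (fobj H b)
          ((\<lambda>a\<in>Obj C. Comp D (fobj F a) (fobj G a) (fobj H a) (\<eta> a) (\<theta> a)) a) (farr H (a, b, f))"
        using ab by simp
    qed
  next
    fix F G \<eta> assume FG: "F \<in> Obj (TopFunc C D)" "G \<in> Obj (TopFunc C D)" and \<eta>: "\<eta> \<in> Hom (TopFunc C D) F G"
    note o = is_functorD(1)[OF F[OF FG(1)]] is_functorD(1)[OF F[OF FG(2)]]
    show "Comp (TopFunc C D) F F G (Ident (TopFunc C D) F) \<eta> = \<eta>"
      unfolding comp ident using o nat[OF \<eta>]
      by (intro extensionalityI[OF restrict_extensional ext[OF \<eta>]]) (simp add: categoryD(3)[OF D])
    show "Comp (TopFunc C D) F G G \<eta> (Ident (TopFunc C D) G) = \<eta>"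
      unfolding comp ident using o nat[OF \<eta>]
      by (intro extensionalityI[OF restrict_extensional ext[OF \<eta>]]) (simp add: categoryD(4)[OF D])
  next
    fix F G H K \<eta> \<theta> \<kappa> assume FG: "F \<in> Obj (TopFunc C D)" "G \<in> Obj (TopFunc C D)" "H \<in> Obj (TopFunc C D)" "K \<in> Obj (TopFunc C D)"
      and n: "\<eta> \<in> Hom (TopFunc C D) F G" "\<theta> \<in> Hom (TopFunc C D) G H" "\<kappa> \<in> Hom (TopFunc C D) H K"
    show "Comp (TopFunc C D) F H K (Comp (TopFunc C D) F G H \<eta> \<theta>) \<kappa> =
        Comp (TopFunc C D) F G K \<eta> (Comp (TopFunc C D) G H K \<theta> \<kappa>)"
      unfolding comp using FG[THEN F, THEN is_functorD(1)] nat[OF n(1)] nat[OF n(2)] nat[OF n(3)]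
      by (intro restrict_ext) (simp add: categoryD(5)[OF D])
  qed
qed

lemma category_TopSet: "category TopSet"
  unfolding category_def TopSet_def top_cat_struct.simps cat_struct.simps
proof (intro conjI ballI)
  fix A B C :: "'b set" and f g assume "f \<in> A \<rightarrow>\<^sub>E B" "g \<in> B \<rightarrow>\<^sub>E C"
  then show "compose A g f \<in> A \<rightarrow>\<^sub>E C" by (auto simp: compose_def)
next
  fix A B :: "'b set" and f assume f: "f \<in> A \<rightarrow>\<^sub>E B"
  then have "f \<in> extensional A" by (simp add: PiE_def)
  with f show "compose A f (\<lambda>x\<in>A. x) = f" "compose A (\<lambda>x\<in>B. x) f = f"
    by (auto simp: compose_def intro!: extensionalityI[of _ A])
next
  fix A B C D :: "'b set" and f g h assume "f \<in> A \<rightarrow>\<^sub>E B"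
  then show "compose A h (compose A g f) = compose A (compose B h g) f"
    by (auto simp: compose_def intro!: restrict_ext)
qed auto

lemma category_full_subcategory: "category C \<Longrightarrow> category (full_subcategory C P)"
  unfolding category_def full_subcategory_def by simp

lemma SCov_simps [simp]:
  "E \<in> Obj (SCov X) \<longleftrightarrow> snd E \<in> extensional (topspace (fst E)) \<and> semicovering (fst E) X (snd E)"
  "Hom (SCov X) E E' = {f \<in> maps (fst E) (fst E'). \<forall>y\<in>topspace (fst E). snd E' (f y) = snd E y}"
  "Ident (SCov X) E = (\<lambda>y\<in>topspace (fst E). y)"
  "Comp (SCov X) E E' E'' f g = compose (topspace (fst E)) g f"
  by (simp_all add: SCov_def case_prod_unfold)

lemma mapsD:
  assumes "f \<in> maps A B"
  shows "f \<in> extensional (topspace A)" "continuous_map A B f" "y \<in> topspace A \<Longrightarrow> f y \<in> topspace B"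
  using assms by (auto simp: maps_def continuous_map_in_topspace)

lemma category_SCov:
  fixes X :: "'a topology"
  shows "category (SCov X :: ('b topology \<times> ('b \<Rightarrow> 'a), 'b \<Rightarrow> 'b) cat_struct)"
  unfolding category_def
proof (intro conjI ballI; unfold SCov_simps(2-4))
  fix E :: "'b topology \<times> ('b \<Rightarrow> 'a)"
  have "continuous_map (fst E) (fst E) (\<lambda>y\<in>topspace (fst E). y)"
    by (rule continuous_map_eq[of "fst E" "fst E" "\<lambda>y. y"]) simp_all
  then show "(\<lambda>y\<in>topspace (fst E). y) \<in> {f \<in> maps (fst E) (fst E). \<forall>y\<in>topspace (fst E). snd E (f y) = snd E y}"
    by (simp add: maps_def)
next
  fix E E' E'' :: "'b topology \<times> ('b \<Rightarrow> 'a)" and f g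
  assume f: "f \<in> {f \<in> maps (fst E) (fst E'). \<forall>y\<in>topspace (fst E). snd E' (f y) = snd E y}"
    and g: "g \<in> {f \<in> maps (fst E') (fst E''). \<forall>y\<in>topspace (fst E'). snd E'' (f y) = snd E' y}"
  from f g have f1: "f \<in> maps (fst E) (fst E')" and g1: "g \<in> maps (fst E') (fst E'')" by auto
  have "continuous_map (fst E) (fst E'') (g \<circ> f)"
    by (rule continuous_map_compose[OF mapsD(2)[OF f1] mapsD(2)[OF g1]])
  then have "continuous_map (fst E) (fst E'') (compose (topspace (fst E)) g f)"
    by (rule continuous_map_eq) (simp add: compose_def)
  then show "compose (topspace (fst E)) g f \<in> {f \<in> maps (fst E) (fst E''). \<forall>y\<in>topspace (fst E). snd E'' (f y) = snd E y}"
    using f g mapsD(3)[OF f1] by (simp add: maps_def compose_def)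
next
  fix E E' :: "'b topology \<times> ('b \<Rightarrow> 'a)" and f
  assume "f \<in> {f \<in> maps (fst E) (fst E'). \<forall>y\<in>topspace (fst E). snd E' (f y) = snd E y}"
  then have f: "f \<in> maps (fst E) (fst E')" by simp
  show "compose (topspace (fst E)) f (\<lambda>y\<in>topspace (fst E). y) = f"
    "compose (topspace (fst E)) (\<lambda>y\<in>topspace (fst E'). y) f = f"
    using mapsD(1,3)[OF f] by (auto simp: compose_def intro!: extensionalityI[of _ "topspace (fst E)"])
next
  fix E E' :: "'b topology \<times> ('b \<Rightarrow> 'a)" and f g h :: "'b \<Rightarrow> 'b"
  assume "f \<in> {f \<in> maps (fst E) (fst E'). \<forall>y\<in>topspace (fst E). snd E' (f y) = snd E y}"
  then have f: "f \<in> maps (fst E) (fst E')" by simp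
  show "compose (topspace (fst E)) h (compose (topspace (fst E)) g f) =
      compose (topspace (fst E)) (compose (topspace (fst E')) h g) f"
    using mapsD(3)[OF f] by (auto simp: compose_def intro!: restrict_ext)
qed

lemma pi_tau_simps [simp]:
  "Obj (pi_tau X) = topspace X" "Hom (pi_tau X) = pi_hom X" "Ident (pi_tau X) = pi_one X"
  "Comp (pi_tau X) a b c = pi_comp X" "HomTop (pi_tau X) = pi_tau_top X"
  by (simp_all add: pi_tau_def)

lemma TopSet_simps [simp]:
  "Obj TopSet = UNIV" "Hom TopSet A B = A \<rightarrow>\<^sub>E B" "Ident TopSet A = (\<lambda>x\<in>A. x)"
  "Comp TopSet A B C f g = compose A g f"
  "HomTop TopSet A B = product_topology (\<lambda>_. discrete_topology B) A"
  by (simp_all add: TopSet_def)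

lemma mem_arrows_pi_tau:
  "(x, y, g) \<in> arrows (pi_tau X) \<longleftrightarrow> x \<in> topspace X \<and> y \<in> topspace X \<and> g \<in> pi_hom X x y"
  by (simp add: arrows_def)

lemma topspace_pi_qtop: "topspace (pi_qtop X x y) = pi_hom X x y"
  using quotient_imp_surjective_map[OF quotient_map_quotient_topology[of "path_space_between X x y" "path_class X"]]
  unfolding pi_qtop_def pi_hom_def by simp

lemma carrier_pi_group [simp]: "carrier (pi_group X x) = pi_hom X x x"
  and mult_pi_group [simp]: "g \<otimes>\<^bsub>pi_group X x\<^esub> h = pi_comp X g h"
  and one_pi_group [simp]: "\<one>\<^bsub>pi_group X x\<^esub> = pi_one X x"
  by (simp_all add: pi_group_def)

lemma topspace_pi_tau_top:
  assumes x: "x \<in> topspace X"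
  shows "topspace (pi_tau_top X x y) = pi_hom X x y"
proof -
  let ?T = "tau_topology (pi_group X x) (pi_qtop X x x)"
  have T: "topspace ?T = pi_hom X x x"
    using topspace_tau_topology[OF group_pi_group[OF x], of "pi_qtop X x x"] by (simp add: topspace_pi_qtop)
  show ?thesis
  proof (cases "x = y")
    case True
    then show ?thesis using T by (simp add: pi_tau_top_def)
  next
    case False
    have "topspace (pi_tau_top X x y) = \<Union> {(\<lambda>u. pi_comp X u g) ` U |U g. openin ?T U \<and> g \<in> pi_hom X x y}"
      using False by (simp add: pi_tau_top_def)
    also have "\<dots> = pi_hom X x y"
    proof
      show "\<Union> {(\<lambda>u. pi_comp X u g) ` U |U g. openin ?T U \<and> g \<in> pi_hom X x y} \<subseteq> pi_hom X x y"
      proof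
        fix h assume "h \<in> \<Union> {(\<lambda>u. pi_comp X u g) ` U |U g. openin ?T U \<and> g \<in> pi_hom X x y}"
        then obtain U g u where U: "openin ?T U" "u \<in> U" and h: "g \<in> pi_hom X x y" "h = pi_comp X u g" by auto
        have "u \<in> pi_hom X x x" using openin_subset[OF U(1)] U(2) T by auto
        then show "h \<in> pi_hom X x y" unfolding h(2) using h(1) by (rule pi_comp_in_pi_hom)
      qed
      show "pi_hom X x y \<subseteq> \<Union> {(\<lambda>u. pi_comp X u g) ` U |U g. openin ?T U \<and> g \<in> pi_hom X x y}"
      proof
        fix g assume g: "g \<in> pi_hom X x y"
        have "openin ?T (pi_hom X x x)" using openin_topspace[of ?T] T by simp
        moreover have "g \<in> (\<lambda>u. pi_comp X u g) ` pi_hom X x x"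
          using pi_one_in_pi_hom[OF x] pi_comp_one_left[OF g] by (intro image_eqI[of _ _ "pi_one X x"]) simp_all
        ultimately show "g \<in> \<Union> {(\<lambda>u. pi_comp X u g) ` U |U g. openin ?T U \<and> g \<in> pi_hom X x y}"
          using g by (intro UnionI[of "(\<lambda>u. pi_comp X u g) ` pi_hom X x x"] CollectI
              exI[of _ "pi_hom X x x"] exI[of _ g]) auto
      qed
    qed
    finally show ?thesis .
  qed
qed

context semicovering_map
begin

lemma openin_pi_tau_monodromy:
  assumes x: "x \<in> topspace X" and y: "y \<in> fibre Y p x" and z: "z \<in> fibre Y p x'"
  shows "openin (pi_tau_top X x x') {g \<in> pi_hom X x x'. monodromy_action Y p y g = z}"
proof -
  let ?T = "tau_topology (pi_group X x) (pi_qtop X x x)"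
  have loop: "openin ?T {g \<in> pi_hom X x x. monodromy_action Y p y g = z}"
    if yz: "y \<in> fibre Y p x" "z \<in> fibre Y p x" for y z
  proof -
    have "openin ?T {g \<in> carrier (pi_group X x). (\<lambda>g y. monodromy_action Y p y g) g y = z}"
    proof (rule openin_tau_topology_action[OF group_pi_group[OF x] _ _ _ _ _ yz])
      show "monodromy_action Y p b g \<in> fibre Y p x"
        if "g \<in> carrier (pi_group X x)" "b \<in> fibre Y p x" for g b
        using monodromy_action_in_fibre[OF that(2)] that(1) by simp
      show "monodromy_action Y p b (g \<otimes>\<^bsub>pi_group X x\<^esub> h) = monodromy_action Y p (monodromy_action Y p b g) h"
        if "g \<in> carrier (pi_group X x)" "h \<in> carrier (pi_group X x)" "b \<in> fibre Y p x" for g h b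
        using monodromy_action_comp[OF that(3)] that(1,2) by simp
      show "monodromy_action Y p b \<one>\<^bsub>pi_group X x\<^esub> = b" if "b \<in> fibre Y p x" for b
        using monodromy_action_one[of b] that by (simp add: fibre_def)
      show "openin (pi_qtop X x x) {g \<in> carrier (pi_group X x). monodromy_action Y p b g = c}"
        if "b \<in> fibre Y p x" "c \<in> fibre Y p x" for b c
        using openin_pi_qtop_monodromy[of b c x] that by (simp add: fibre_def)
    qed (simp add: topspace_pi_qtop)
    then show ?thesis by simp
  qed
  show ?thesis
  proof (cases "x = x'")
    case True
    then show ?thesis using loop[OF y] z by (simp add: pi_tau_top_def)
  next
    case False
    let ?O = "{g \<in> pi_hom X x x'. monodromy_action Y p y g = z}"
    let ?U = "{u \<in> pi_hom X x x. monodromy_action Y p y u = y}"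
    show ?thesis
    proof (subst openin_subopen, intro ballI)
      fix g assume g: "g \<in> ?O"
      have "openin (pi_tau_top X x x') ((\<lambda>u. pi_comp X u g) ` ?U)"
        using False loop[OF y y] g unfolding pi_tau_top_def
        by (simp, intro topology_generated_by_Basis) blast
      moreover have "g \<in> (\<lambda>u. pi_comp X u g) ` ?U"
      proof (rule image_eqI[of _ _ "pi_one X x"])
        show "g = pi_comp X (pi_one X x) g" using pi_comp_one_left[of g X x x'] g by simp
        show "pi_one X x \<in> ?U" using monodromy_action_one[of y] y pi_one_in_pi_hom[OF x] by (simp add: fibre_def)
      qed
      moreover have "(\<lambda>u. pi_comp X u g) ` ?U \<subseteq> ?O"
        using g pi_comp_in_pi_hom[of _ X x x g x'] monodromy_action_comp[OF y, of _ x g x'] by auto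
      ultimately show "\<exists>T. openin (pi_tau_top X x x') T \<and> g \<in> T \<and> T \<subseteq> ?O" by blast
    qed
  qed
qed

lemma monodromy_functor_fobj [simp]:
  "x \<in> topspace X \<Longrightarrow> fobj (monodromy_functor X (Y, p)) x = fibre Y p x"
  by (simp add: monodromy_functor_def)

lemma monodromy_functor_farr:
  "x \<in> topspace X \<Longrightarrow> x' \<in> topspace X \<Longrightarrow> g \<in> pi_hom X x x' \<Longrightarrow>
     farr (monodromy_functor X (Y, p)) (x, x', g) = (\<lambda>y\<in>fibre Y p x. monodromy_action Y p y g)"
  by (simp add: monodromy_functor_def mem_arrows_pi_tau)

lemma monodromy_functor_in_TopFunc:
  "monodromy_functor X (Y, p) \<in> Obj (TopFunc (pi_tau X) TopSet)"
proof -
  let ?M = "monodromy_functor X (Y, p)"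
  have "is_functor (pi_tau X) TopSet ?M"
    unfolding is_functor_def
  proof (intro conjI ballI; unfold pi_tau_simps TopSet_simps)
    fix x x' g assume x: "x \<in> topspace X" "x' \<in> topspace X" and g: "g \<in> pi_hom X x x'"
    then show "farr ?M (x, x', g) \<in> fobj ?M x \<rightarrow>\<^sub>E fobj ?M x'"
      by (auto simp: monodromy_functor_farr monodromy_action_in_fibre)
    fix x'' h assume h: "x'' \<in> topspace X" "h \<in> pi_hom X x' x''"
    show "farr ?M (x, x'', pi_comp X g h) = compose (fobj ?M x) (farr ?M (x', x'', h)) (farr ?M (x, x', g))"
      using x g h pi_comp_in_pi_hom[OF g h(2)] monodromy_action_in_fibre[OF _ g] monodromy_action_comp[OF _ g h(2)]
      by (auto simp: monodromy_functor_farr compose_def intro!: restrict_ext)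
  next
    fix x assume x: "x \<in> topspace X"
    show "farr ?M (x, x, pi_one X x) = (\<lambda>y\<in>fobj ?M x. y)"
      using x pi_one_in_pi_hom[OF x] monodromy_action_one
      by (auto simp: monodromy_functor_farr fibre_def intro!: restrict_ext)
  qed simp
  moreover have "continuous_map (pi_tau_top X x x') (product_topology (\<lambda>_. discrete_topology (fobj ?M x')) (fobj ?M x))
      (\<lambda>g. farr ?M (x, x', g))" if x: "x \<in> topspace X" "x' \<in> topspace X" for x x'
    unfolding continuous_map_componentwise
  proof (intro conjI ballI)
    show "(\<lambda>g. farr ?M (x, x', g)) ` topspace (pi_tau_top X x x') \<subseteq> extensional (fobj ?M x)"
      using x by (auto simp: topspace_pi_tau_top monodromy_functor_farr)
    fix y assume "y \<in> fobj ?M x"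
    then have y: "y \<in> fibre Y p x" using x by simp
    have "continuous_map (pi_tau_top X x x') (discrete_topology (fibre Y p x')) (monodromy_action Y p y)"
      using openin_pi_tau_monodromy[OF x(1) y] monodromy_action_in_fibre[OF y]
      by (intro continuous_map_to_discrete) (auto simp: topspace_pi_tau_top[OF x(1)])
    then have "continuous_map (pi_tau_top X x x') (discrete_topology (fibre Y p x')) (\<lambda>g. farr ?M (x, x', g) y)"
      by (rule continuous_map_eq) (simp add: topspace_pi_tau_top[OF x(1)] monodromy_functor_farr[OF x] y)
    then show "continuous_map (pi_tau_top X x x') (discrete_topology (fobj ?M x')) (\<lambda>g. farr ?M (x, x', g) y)"
      using x by simp
  qed
  moreover have "fobj ?M \<in> extensional (topspace X)" "farr ?M \<in> extensional (arrows (pi_tau X))"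
    by (simp_all add: monodromy_functor_def)
  ultimately show ?thesis by (simp add: TopFunc_def is_top_functor_def)
qed

lemma disjoint_values_monodromy_functor: "disjoint_values X (monodromy_functor X (Y, p))"
  by (auto simp: disjoint_values_def disjoint_family_on_def fibre_def)

text \<open>The topology of a semicovering of a locally wep-connected space is determined by its monodromy.\<close>

lemma openin_iff_monodromy:
  assumes wep: "locally_wep_connected X"
  shows "openin Y V \<longleftrightarrow> V \<subseteq> topspace Y \<and> (\<forall>y\<in>topspace Y. openin (path_space_from X (p y))
    {\<alpha> \<in> topspace (path_space_from X (p y)). monodromy_action Y p y (path_class X \<alpha>) \<in> V})"
proof (intro iffI conjI ballI)
  have eq: "{\<alpha> \<in> topspace (path_space_from X (p y)). monodromy_action Y p y (path_class X \<alpha>) \<in> V} =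
      {\<alpha> \<in> topspace (path_space_from X (p y)). path_lift Y p \<alpha> y 1 \<in> V}" if "y \<in> topspace Y" for y
    using that by (auto simp: monodromy_action_path_class)
  {
    assume V: "openin Y V"
    then show "V \<subseteq> topspace Y" by (rule openin_subset)
    fix y assume y: "y \<in> topspace Y"
    have "continuous_map (path_space_from X (p y)) Y (\<lambda>\<alpha>. path_lift Y p \<alpha> y 1)"
      by (rule continuous_map_path_lift_end[OF continuous_map_from_path_space_from _ y]) simp
    from openin_continuous_map_preimage[OF this V]
    show "openin (path_space_from X (p y)) {\<alpha> \<in> topspace (path_space_from X (p y)). monodromy_action Y p y (path_class X \<alpha>) \<in> V}"
      unfolding eq[OF y] .
  }
  assume *: "V \<subseteq> topspace Y \<and> (\<forall>y\<in>topspace Y. openin (path_space_from X (p y))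
    {\<alpha> \<in> topspace (path_space_from X (p y)). monodromy_action Y p y (path_class X \<alpha>) \<in> V})"
  show "openin Y V"
  proof (subst openin_subopen, intro ballI)
    fix y assume yV: "y \<in> V"
    with * have y: "y \<in> topspace Y" by blast
    let ?x = "p y"
    have x: "?x \<in> topspace X" by (rule continuous_map_in_topspace[OF p y])
    obtain \<alpha> where \<alpha>: "locally_well_ended X \<alpha>" "\<alpha> 0 = ?x" "\<alpha> 1 = ?x"
      using wep x unfolding locally_wep_connected_def by blast
    have \<alpha>p: "\<alpha> \<in> paths X" using \<alpha>(1) by (simp add: locally_well_ended_def)
    define z where "z = path_lift Y p (path_rev \<alpha>) y 1"
    have r: "path_rev \<alpha> \<in> paths X" "path_rev \<alpha> 0 = p y" using \<alpha> path_rev_in_paths[OF \<alpha>p] by simp_all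
    have z: "z \<in> topspace Y" "p z = ?x"
      using path_lift_over[OF y r, of 1] \<alpha> by (simp_all add: z_def)
    have "path_lift Y p \<alpha> z 1 = path_lift Y p (path_concat (path_rev \<alpha>) \<alpha>) y 1"
      using path_lift_concat[OF y r \<alpha>p] by (simp add: z_def)
    also have "\<dots> = path_lift Y p (\<lambda>t\<in>{0..1}. ?x) y 1"
      using path_class_rev_left[OF \<alpha>p] \<alpha> r y
      by (intro path_lift_end_cong) (simp_all add: path_concat_in_paths \<alpha>p const_in_paths x)
    also have "\<dots> = y" by (simp add: path_lift_const[OF y])
    finally have lift: "path_lift Y p \<alpha> z 1 = y" .
    obtain U where U: "openin Y U" "y \<in> U" "inj_on p U" "\<And>W. openin Y W \<Longrightarrow> W \<subseteq> U \<Longrightarrow> openin X (p ` W)"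
      by (rule sheet[OF y]) blast
    let ?A = "{\<gamma> \<in> topspace (path_space_from X ?x). path_lift Y p \<gamma> z 1 \<in> V} \<inter>
      {\<gamma> \<in> topspace (path_space_from X ?x). path_lift Y p \<gamma> z 1 \<in> U}"
    have "openin (path_space_from X ?x) ?A"
    proof (rule openin_Int)
      show "openin (path_space_from X ?x) {\<gamma> \<in> topspace (path_space_from X ?x). path_lift Y p \<gamma> z 1 \<in> V}"
        using * z(1) eq[OF z(1)] unfolding z(2)[symmetric] by metis
      have "continuous_map (path_space_from X ?x) Y (\<lambda>\<alpha>. path_lift Y p \<alpha> z 1)"
        by (rule continuous_map_path_lift_end[OF continuous_map_from_path_space_from _ z(1)]) (simp add: z(2))
      from openin_continuous_map_preimage[OF this U(1)]
      show "openin (path_space_from X ?x) {\<gamma> \<in> topspace (path_space_from X ?x). path_lift Y p \<gamma> z 1 \<in> U}" .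
    qed
    then have "openin (path_space_from X (\<alpha> 0)) ?A" unfolding \<alpha>(2) .
    moreover have "\<alpha> \<in> ?A" using lift \<alpha> \<alpha>p yV U(2) by simp
    ultimately obtain W where W: "openin X W" "\<alpha> 1 \<in> W" "\<forall>b\<in>W. \<exists>\<gamma>\<in>?A. well_ended X \<gamma> \<and> \<gamma> 1 = b"
      by (rule locally_well_ended_end[OF \<alpha>(1)])
    let ?N = "U \<inter> {u \<in> topspace Y. p u \<in> W}"
    have "openin Y ?N" by (rule openin_Int[OF U(1) openin_continuous_map_preimage[OF p W(1)]])
    moreover have "y \<in> ?N" using U(2) y W(2) \<alpha>(3) by simp
    moreover have "?N \<subseteq> V"
    proof
      fix u assume u: "u \<in> ?N"
      then obtain \<gamma> where \<gamma>: "\<gamma> \<in> ?A" "\<gamma> 1 = p u" using W(3) by blast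
      have "p (path_lift Y p \<gamma> z 1) = p u" using path_lift_over(2)[OF z(1), of \<gamma> 1] \<gamma> z(2) by simp
      then have "path_lift Y p \<gamma> z 1 = u" by (rule inj_onD[OF U(3)]) (use \<gamma> u in auto)
      then show "u \<in> V" using \<gamma> by blast
    qed
    ultimately show "\<exists>T. openin Y T \<and> y \<in> T \<and> T \<subseteq> V" by blast
  qed
qed

end

lemma semicovering_mapI: "semicovering Y X p \<Longrightarrow> semicovering_map Y X p"
  by (simp add: semicovering_map_iff)

lemma monodromy_simps [simp]:
  "fobj (monodromy X) = monodromy_functor X"
  "farr (monodromy X) (E, E', f) = (\<lambda>x\<in>topspace X. restrict f (fibre (fst E) (snd E) x))"
  by (simp_all add: monodromy_def case_prod_unfold)

lemma monodromy_action_natural: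
  assumes E: "semicovering Y X p" and E': "semicovering Y' X p'"
    and f: "continuous_map Y Y' f" "\<And>y. y \<in> topspace Y \<Longrightarrow> p' (f y) = p y"
    and y: "y \<in> fibre Y p x" and g: "g \<in> pi_hom X x x'"
  shows "f (monodromy_action Y p y g) = monodromy_action Y' p' (f y) g"
proof -
  interpret E: semicovering_map Y X p by (rule semicovering_mapI[OF E])
  interpret E': semicovering_map Y' X p' by (rule semicovering_mapI[OF E'])
  obtain \<alpha> where \<alpha>: "\<alpha> \<in> paths X" "\<alpha> 0 = x" "\<alpha> 1 = x'" "g = path_class X \<alpha>" by (rule pi_homE[OF g])
  have yY: "y \<in> topspace Y" and \<alpha>0: "\<alpha> 0 = p y" using y \<alpha>(2) by (auto simp: fibre_def)
  let ?L = "path_lift Y p \<alpha> y" let ?\<beta> = "compose {0..1} f ?L"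
  note L = E.path_lift[OF yY \<alpha>(1) \<alpha>0]
  have "continuous_map unit_interval Y' (f \<circ> ?L)"
    by (rule continuous_map_compose[OF _ f(1)]) (use L(1) in \<open>simp add: paths_iff\<close>)
  then have "continuous_map unit_interval Y' ?\<beta>" by (rule continuous_map_eq) (simp add: compose_def)
  then have \<beta>: "?\<beta> \<in> paths Y'" by (simp add: paths_iff)
  have "compose {0..1} p' ?\<beta> = compose {0..1} p ?L"
    using f(2) path_in_topspace[OF L(1)] by (auto simp: compose_def intro!: restrict_ext)
  then have "path_lift Y' p' \<alpha> (f y) = ?\<beta>"
    using E'.path_lift_unique[OF \<beta>] L(2,3) by (simp add: compose_def)
  moreover have "f y \<in> topspace Y'" "\<alpha> 0 = p' (f y)"
    using continuous_map_in_topspace[OF f(1) yY] f(2)[OF yY] \<alpha>0 by simp_all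
  ultimately show ?thesis
    using \<alpha>(1,4) yY \<alpha>0 by (simp add: E.monodromy_action_path_class E'.monodromy_action_path_class compose_def)
qed

lemma is_functor_monodromy:
  fixes X :: "'a topology"
  shows "is_functor (SCov X) (TopFunc (pi_tau X) (TopSet :: ('b set, 'b \<Rightarrow> 'b) top_cat_struct)) (monodromy X)"
  unfolding is_functor_def monodromy_simps
proof (intro conjI ballI)
  fix E :: "'b topology \<times> ('b \<Rightarrow> 'a)" assume E: "E \<in> Obj (SCov X)"
  obtain Y p where Yp: "E = (Y, p)" by fastforce
  interpret semicovering_map Y X p using E by (intro semicovering_mapI) (simp add: Yp)
  show "monodromy_functor X E \<in> Obj (TopFunc (pi_tau X) TopSet)"
    unfolding Yp by (rule monodromy_functor_in_TopFunc)
  show "(\<lambda>x\<in>topspace X. restrict (Ident (SCov X) E) (fibre (fst E) (snd E) x)) =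
      Ident (TopFunc (pi_tau X) TopSet) (monodromy_functor X E)"
    by (auto simp: TopFunc_def Yp fibre_def intro!: restrict_ext)
next
  fix E E' :: "'b topology \<times> ('b \<Rightarrow> 'a)" and f
  assume EE: "E \<in> Obj (SCov X)" "E' \<in> Obj (SCov X)" and f: "f \<in> Hom (SCov X) E E'"
  obtain Y p where Yp: "E = (Y, p)" by fastforce
  obtain Y' p' where Yp': "E' = (Y', p')" by fastforce
  have s: "semicovering Y X p" "semicovering Y' X p'" using EE by (simp_all add: Yp Yp')
  interpret E: semicovering_map Y X p by (rule semicovering_mapI[OF s(1)])
  interpret E': semicovering_map Y' X p' by (rule semicovering_mapI[OF s(2)])
  have fm: "f \<in> maps Y Y'" and fp: "\<And>y. y \<in> topspace Y \<Longrightarrow> p' (f y) = p y" using f by (simp_all add: Yp Yp')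
  have ff: "f y \<in> fibre Y' p' x" if "y \<in> fibre Y p x" for x y
    using that mapsD(3)[OF fm] fp by (simp add: fibre_def)
  have "(\<lambda>x\<in>topspace X. restrict f (fibre Y p x)) \<in>
      natural_transformations (pi_tau X) TopSet (monodromy_functor X (Y, p)) (monodromy_functor X (Y', p'))"
    unfolding natural_transformations_def
  proof (intro CollectI conjI ballI; unfold pi_tau_simps TopSet_simps)
    show "(\<lambda>x\<in>topspace X. restrict f (fibre Y p x)) \<in>
        (\<Pi>\<^sub>E x\<in>topspace X. fobj (monodromy_functor X (Y, p)) x \<rightarrow>\<^sub>E fobj (monodromy_functor X (Y', p')) x)"
      using ff by auto
    fix x x' g assume x: "x \<in> topspace X" "x' \<in> topspace X" and g: "g \<in> pi_hom X x x'"
    show "compose (fobj (monodromy_functor X (Y, p)) x) ((\<lambda>x\<in>topspace X. restrict f (fibre Y p x)) x')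
          (farr (monodromy_functor X (Y, p)) (x, x', g)) =
        compose (fobj (monodromy_functor X (Y, p)) x) (farr (monodromy_functor X (Y', p')) (x, x', g))
          ((\<lambda>x\<in>topspace X. restrict f (fibre Y p x)) x)"
      using x g ff E.monodromy_action_in_fibre[OF _ g] monodromy_action_natural[OF s mapsD(2)[OF fm] fp _ g]
      by (auto simp: E.monodromy_functor_farr E'.monodromy_functor_farr compose_def intro!: restrict_ext)
  qed
  then show "(\<lambda>x\<in>topspace X. restrict f (fibre (fst E) (snd E) x)) \<in>
      Hom (TopFunc (pi_tau X) TopSet) (monodromy_functor X E) (monodromy_functor X E')"
    by (simp add: TopFunc_def Yp Yp')
next
  fix E E' E'' :: "'b topology \<times> ('b \<Rightarrow> 'a)" and f g
  assume EE: "E \<in> Obj (SCov X)" "E' \<in> Obj (SCov X)" "E'' \<in> Obj (SCov X)"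
    and f: "f \<in> Hom (SCov X) E E'" and g: "g \<in> Hom (SCov X) E' E''"
  have M: "fobj (monodromy_functor X E) x = fibre (fst E) (snd E) x" if "x \<in> topspace X"
    for x and E :: "'b topology \<times> ('b \<Rightarrow> 'a)"
    using that by (simp add: monodromy_functor_def case_prod_unfold)
  have fm: "f \<in> maps (fst E) (fst E')" using f by simp
  have ff: "f y \<in> fibre (fst E') (snd E') x" if "y \<in> fibre (fst E) (snd E) x" for x y
    using that f mapsD(3)[OF fm] by (simp add: fibre_def)
  show "(\<lambda>x\<in>topspace X. restrict (Comp (SCov X) E E' E'' f g) (fibre (fst E) (snd E) x)) =
      Comp (TopFunc (pi_tau X) TopSet) (monodromy_functor X E) (monodromy_functor X E') (monodromy_functor X E'')
        (\<lambda>x\<in>topspace X. restrict f (fibre (fst E) (snd E) x)) (\<lambda>x\<in>topspace X. restrict g (fibre (fst E') (snd E') x))"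
    using ff by (auto simp: TopFunc_def M compose_def fibre_def intro!: restrict_ext)
qed

lemma monodromy_functor_inj:
  assumes wep: "locally_wep_connected X"
    and E: "semicovering Y X p" "p \<in> extensional (topspace Y)"
    and E': "semicovering Y' X p'" "p' \<in> extensional (topspace Y')"
    and eq: "monodromy_functor X (Y, p) = monodromy_functor X (Y', p')"
  shows "(Y, p) = (Y', p')"
proof -
  interpret E: semicovering_map Y X p by (rule semicovering_mapI[OF E(1)])
  interpret E': semicovering_map Y' X p' by (rule semicovering_mapI[OF E'(1)])
  have fib: "fibre Y p x = fibre Y' p' x" if "x \<in> topspace X" for x
    using arg_cong[OF eq, of "\<lambda>F. fobj F x"] that by simp
  have "y \<in> topspace Y \<longleftrightarrow> y \<in> topspace Y'" "y \<in> topspace Y \<Longrightarrow> p y = p' y" for y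
    using fib[of "p y"] fib[of "p' y"] continuous_map_in_topspace[OF E.p, of y] continuous_map_in_topspace[OF E'.p, of y]
    by (auto simp: fibre_def)
  then have top: "topspace Y = topspace Y'" and p: "\<And>y. y \<in> topspace Y \<Longrightarrow> p y = p' y" by auto
  have pp: "p = p'" using E(2) E'(2) p unfolding top by (intro extensionalityI)
  have act: "monodromy_action Y p y (path_class X \<alpha>) = monodromy_action Y' p' y (path_class X \<alpha>)"
    if "y \<in> topspace Y" "\<alpha> \<in> topspace (path_space_from X (p y))" for y \<alpha>
  proof -
    have \<alpha>: "\<alpha> \<in> paths X" "\<alpha> 0 = p y" using that(2) by simp_all
    have x: "p y \<in> topspace X" "\<alpha> 1 \<in> topspace X"
      using path_in_topspace[OF \<alpha>(1), of 0] path_in_topspace[OF \<alpha>(1), of 1] \<alpha>(2) by simp_all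
    have g: "path_class X \<alpha> \<in> pi_hom X (p y) (\<alpha> 1)" using path_class_in_pi_hom[OF \<alpha>(1)] \<alpha>(2) by simp
    have farr_eq: "farr (monodromy_functor X (Y, p)) (p y, \<alpha> 1, path_class X \<alpha>) y =
        farr (monodromy_functor X (Y', p')) (p y, \<alpha> 1, path_class X \<alpha>) y"
      using eq by simp
    have "y \<in> fibre Y p (p y)" "y \<in> fibre Y' p' (p y)" using that(1) top pp by (auto simp: fibre_def)
    then show ?thesis
      using farr_eq unfolding E.monodromy_functor_farr[OF x g] E'.monodromy_functor_farr[OF x g] by simp
  qed
  have "openin Y V \<longleftrightarrow> openin Y' V" for V
  proof -
    have "{\<alpha> \<in> topspace (path_space_from X (p y)). monodromy_action Y p y (path_class X \<alpha>) \<in> V} =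
        {\<alpha> \<in> topspace (path_space_from X (p' y)). monodromy_action Y' p' y (path_class X \<alpha>) \<in> V}"
      if "y \<in> topspace Y" for y
      using act[OF that] unfolding pp by (intro Collect_cong conj_cong) simp_all
    then show ?thesis
      unfolding E.openin_iff_monodromy[OF wep, of V] E'.openin_iff_monodromy[OF wep, of V] top[symmetric]
      by (simp add: pp cong: ball_cong)
  qed
  then show ?thesis using pp by (simp add: topology_eq)
qed

lemma TopFuncD:
  assumes "F \<in> Obj (TopFunc (pi_tau X) TopSet)"
  shows "\<And>x x' g. x \<in> topspace X \<Longrightarrow> x' \<in> topspace X \<Longrightarrow> g \<in> pi_hom X x x' \<Longrightarrow>
      farr F (x, x', g) \<in> fobj F x \<rightarrow>\<^sub>E fobj F x'"
    and "\<And>x. x \<in> topspace X \<Longrightarrow> farr F (x, x, pi_one X x) = (\<lambda>u\<in>fobj F x. u)"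
    and "\<And>x x' x'' g h. x \<in> topspace X \<Longrightarrow> x' \<in> topspace X \<Longrightarrow> x'' \<in> topspace X \<Longrightarrow> g \<in> pi_hom X x x' \<Longrightarrow>
      h \<in> pi_hom X x' x'' \<Longrightarrow>
      farr F (x, x'', pi_comp X g h) = compose (fobj F x) (farr F (x', x'', h)) (farr F (x, x', g))"
    and "\<And>x x'. x \<in> topspace X \<Longrightarrow> x' \<in> topspace X \<Longrightarrow>
      continuous_map (pi_tau_top X x x') (product_topology (\<lambda>_. discrete_topology (fobj F x')) (fobj F x))
        (\<lambda>g. farr F (x, x', g))"
    and "fobj F \<in> extensional (topspace X)" "farr F \<in> extensional (arrows (pi_tau X))"
  using is_functorD(2-4)[of "pi_tau X" TopSet F] assms
  by (simp_all add: TopFunc_def is_top_functor_def)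

lemma path_action_TopFunc:
  assumes wep: "locally_wep_connected X" and F: "F \<in> Obj (TopFunc (pi_tau X) TopSet)"
    and disj: "disjoint_values X F"
  shows "path_action X (fobj F) (\<lambda>\<alpha> u. farr F (\<alpha> 0, \<alpha> 1, path_class X \<alpha>) u)"
proof
  note F = TopFuncD[OF F]
  have ends: "\<alpha> 0 \<in> topspace X" "\<alpha> 1 \<in> topspace X" if "\<alpha> \<in> paths X" for \<alpha>
    using path_in_topspace[OF that, of 0] path_in_topspace[OF that, of 1] by simp_all
  show "locally_wep_connected X" by (rule wep)
  show "disjoint_family_on (fobj F) (topspace X)" using disj by (simp add: disjoint_values_def)
  show "farr F (\<alpha> 0, \<alpha> 1, path_class X \<alpha>) u \<in> fobj F (\<alpha> 1)" if "\<alpha> \<in> paths X" "u \<in> fobj F (\<alpha> 0)" for \<alpha> u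
    using PiE_mem[OF F(1)[OF ends[OF that(1)] path_class_in_pi_hom[OF that(1)]] that(2)] .
  show "farr F ((\<lambda>t\<in>{0..1::real}. x) 0, (\<lambda>t\<in>{0..1::real}. x) 1, path_class X (\<lambda>t\<in>{0..1}. x)) u = u"
    if "x \<in> topspace X" "u \<in> fobj F x" for x u
    using F(2)[OF that(1)] that(2) by (simp add: pi_one_def)
  show "farr F (path_concat \<alpha> \<beta> 0, path_concat \<alpha> \<beta> 1, path_class X (path_concat \<alpha> \<beta>)) u =
      farr F (\<beta> 0, \<beta> 1, path_class X \<beta>) (farr F (\<alpha> 0, \<alpha> 1, path_class X \<alpha>) u)"
    if "\<alpha> \<in> paths X" "\<beta> \<in> paths X" "\<alpha> 1 = \<beta> 0" "u \<in> fobj F (\<alpha> 0)" for \<alpha> \<beta> u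
  proof -
    have "path_class X \<alpha> \<in> pi_hom X (\<alpha> 0) (\<beta> 0)" using path_class_in_pi_hom[OF that(1)] that(3) by simp
    from F(3)[OF ends(1)[OF that(1)] ends[OF that(2)] this path_class_in_pi_hom[OF that(2)]]
    show ?thesis using that by (simp add: pi_comp_path_class compose_def)
  qed
  show "farr F (\<alpha> 0, \<alpha> 1, path_class X \<alpha>) u = farr F (\<beta> 0, \<beta> 1, path_class X \<beta>) u"
    if "\<alpha> \<in> paths X" "\<beta> \<in> paths X" "path_class X \<alpha> = path_class X \<beta>" "u \<in> fobj F (\<alpha> 0)" for \<alpha> \<beta> u
    using path_class_eq_ends[OF that(3,1)] that(3) by simp
  show "openin (path_space_between X x x)
      {\<alpha> \<in> topspace (path_space_between X x x). farr F (\<alpha> 0, \<alpha> 1, path_class X \<alpha>) u = v}"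
    if x: "x \<in> topspace X" and uv: "u \<in> fobj F x" "v \<in> fobj F x" for x u v
  proof -
    let ?T = "tau_topology (pi_group X x) (pi_qtop X x x)" and ?S = "path_space_between X x x"
    have "continuous_map ?T (product_topology (\<lambda>_. discrete_topology (fobj F x)) (fobj F x)) (\<lambda>g. farr F (x, x, g))"
      using F(4)[OF x x] by (simp add: pi_tau_top_def)
    then have c: "continuous_map ?T (discrete_topology (fobj F x)) (\<lambda>g. farr F (x, x, g) u)"
      using uv(1) unfolding continuous_map_componentwise by blast
    have T: "topspace ?T = pi_hom X x x"
      using topspace_pi_tau_top[OF x, of x] by (simp add: pi_tau_top_def)
    have "openin ?T {g \<in> pi_hom X x x. farr F (x, x, g) u = v}"
      using openin_continuous_map_preimage[OF c, of "{v}"] uv(2) T by simp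
    then have "openin (pi_qtop X x x) {g \<in> pi_hom X x x. farr F (x, x, g) u = v}"
      by (rule openin_tau_topologyD[OF group_pi_group[OF x], rotated]) (simp add: topspace_pi_qtop)
    then have "openin ?S {\<alpha> \<in> topspace ?S. path_class X \<alpha> \<in> {g \<in> pi_hom X x x. farr F (x, x, g) u = v}}"
      unfolding pi_qtop_def openin_quotient_topology by blast
    also have "{\<alpha> \<in> topspace ?S. path_class X \<alpha> \<in> {g \<in> pi_hom X x x. farr F (x, x, g) u = v}} =
        {\<alpha> \<in> topspace ?S. farr F (\<alpha> 0, \<alpha> 1, path_class X \<alpha>) u = v}"
      using path_class_in_pi_hom[of _ X] by (intro Collect_cong conj_cong) fastforce+
    finally show ?thesis .
  qed
qed

lemma monodromy_functor_surj:
  assumes wep: "locally_wep_connected X" and F: "F \<in> Obj (TopFunc (pi_tau X) TopSet)"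
    and disj: "disjoint_values X F"
  obtains Y p where "semicovering Y X p" "p \<in> extensional (topspace Y)" "monodromy_functor X (Y, p) = F"
proof -
  interpret path_action X "fobj F" "\<lambda>\<alpha> u. farr F (\<alpha> 0, \<alpha> 1, path_class X \<alpha>) u"
    by (rule path_action_TopFunc[OF assms])
  note F = TopFuncD[OF F]
  let ?M = "monodromy_functor X (total_top, proj)"
  have "fobj ?M = fobj F"
    by (rule extensionalityI[of _ "topspace X"]) (simp_all add: F(5) fibre_proj monodromy_functor_def)
  moreover have "farr ?M = farr F"
  proof (rule extensionalityI[of _ "arrows (pi_tau X)"])
    fix a assume a: "a \<in> arrows (pi_tau X)"
    obtain x x' g where a_eq: "a = (x, x', g)" using prod_cases3 by blast
    have x: "x \<in> topspace X" "x' \<in> topspace X" and g: "g \<in> pi_hom X x x'"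
      using a by (simp_all add: a_eq mem_arrows_pi_tau)
    obtain \<alpha> where \<alpha>: "\<alpha> \<in> paths X" "\<alpha> 0 = x" "\<alpha> 1 = x'" "g = path_class X \<alpha>" by (rule pi_homE[OF g])
    have "monodromy_action total_top proj u g = farr F (x, x', g) u" if "u \<in> fobj F x" for u
    proof -
      have "u \<in> topspace total_top" "\<alpha> 0 = proj u" using that \<alpha>(2) x by (simp_all add: totalI proj_eq)
      then show ?thesis
        using monodromy_action_path_class[OF \<alpha>(1), of u] path_lift_end[OF \<alpha>(1), of u] that \<alpha> by simp
    qed
    then have "farr ?M (x, x', g) = (\<lambda>u\<in>fobj F x. farr F (x, x', g) u)"
      by (simp add: monodromy_functor_farr[OF x g] fibre_proj[OF x(1)] cong: restrict_cong)
    also have "\<dots> = farr F (x, x', g)" using F(1)[OF x g] by (simp add: PiE_def extensional_restrict)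
    finally show "farr ?M a = farr F a" by (simp add: a_eq)
  qed (simp_all add: F(6) monodromy_functor_def)
  ultimately have "?M = F" by simp
  moreover have "proj \<in> extensional (topspace total_top)" by (simp add: proj_def)
  ultimately show ?thesis using that semicovering by blast
qed

lemma monodromy_fully_faithful:
  assumes wep: "locally_wep_connected X" and E: "E \<in> Obj (SCov X)" and E': "E' \<in> Obj (SCov X)"
  shows "bij_betw (\<lambda>f. farr (monodromy X) (E, E', f)) (Hom (SCov X) E E')
    (Hom (TopFunc (pi_tau X) TopSet) (fobj (monodromy X) E) (fobj (monodromy X) E'))"
proof (rule bij_betw_imageI)
  obtain Y p where Yp: "E = (Y, p)" by fastforce
  obtain Y' p' where Yp': "E' = (Y', p')" by fastforce
  have s: "semicovering Y X p" "semicovering Y' X p'" using E E' by (simp_all add: Yp Yp')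
  interpret E: semicovering_map Y X p by (rule semicovering_mapI[OF s(1)])
  interpret E': semicovering_map Y' X p' by (rule semicovering_mapI[OF s(2)])
  have pX: "p y \<in> topspace X" if "y \<in> topspace Y" for y by (rule continuous_map_in_topspace[OF E.p that])
  let ?r = "\<lambda>f. \<lambda>x\<in>topspace X. restrict f (fibre Y p x)"
  show "inj_on (\<lambda>f. farr (monodromy X) (E, E', f)) (Hom (SCov X) E E')"
  proof (rule inj_onI)
    fix f g assume fg: "f \<in> Hom (SCov X) E E'" "g \<in> Hom (SCov X) E E'"
      and "farr (monodromy X) (E, E', f) = farr (monodromy X) (E, E', g)"
    then have eq: "?r f = ?r g" by (simp add: Yp)
    have "f y = g y" if y: "y \<in> topspace Y" for y
      using fun_cong[OF fun_cong[OF eq, of "p y"], of y] pX[OF y] y by (simp add: fibre_def)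
    then show "f = g" using fg mapsD(1) by (intro extensionalityI[of _ "topspace Y"]) (auto simp: Yp)
  qed
  show "(\<lambda>f. farr (monodromy X) (E, E', f)) ` Hom (SCov X) E E' =
      Hom (TopFunc (pi_tau X) TopSet) (fobj (monodromy X) E) (fobj (monodromy X) E')" (is "?L = ?R")
  proof
    show "?L \<subseteq> ?R" using is_functorD(2)[OF is_functor_monodromy E E'] by blast
    show "?R \<subseteq> ?L"
    proof
      fix \<eta> assume "\<eta> \<in> ?R"
      then have "\<eta> \<in> natural_transformations (pi_tau X) TopSet (monodromy_functor X (Y, p)) (monodromy_functor X (Y', p'))"
        by (simp add: TopFunc_def Yp Yp')
      then have \<eta>: "\<eta> \<in> (\<Pi>\<^sub>E x\<in>topspace X. fobj (monodromy_functor X (Y, p)) x \<rightarrow>\<^sub>E fobj (monodromy_functor X (Y', p')) x)"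
        and nat: "\<And>x x' g. x \<in> topspace X \<Longrightarrow> x' \<in> topspace X \<Longrightarrow> g \<in> pi_hom X x x' \<Longrightarrow>
          compose (fobj (monodromy_functor X (Y, p)) x) (\<eta> x') (farr (monodromy_functor X (Y, p)) (x, x', g)) =
          compose (fobj (monodromy_functor X (Y, p)) x) (farr (monodromy_functor X (Y', p')) (x, x', g)) (\<eta> x)"
        by (simp_all add: natural_transformations_def)
      have \<eta>x: "\<eta> x \<in> fibre Y p x \<rightarrow>\<^sub>E fibre Y' p' x" if "x \<in> topspace X" for x
        using PiE_mem[OF \<eta> that] that by simp
      define f where "f = (\<lambda>y\<in>topspace Y. \<eta> (p y) y)"
      have f: "f y \<in> topspace Y'" "p' (f y) = p y" if y: "y \<in> topspace Y" for y
        using PiE_mem[OF \<eta>x[OF pX[OF y]], of y] y by (simp_all add: f_def fibre_def)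
      have act: "f (monodromy_action Y p y (path_class X \<alpha>)) = monodromy_action Y' p' (f y) (path_class X \<alpha>)"
        if y: "y \<in> topspace Y" and \<alpha>: "\<alpha> \<in> topspace (path_space_from X (p y))" for y \<alpha>
      proof -
        have \<alpha>p: "\<alpha> \<in> paths X" "\<alpha> 0 = p y" using \<alpha> by simp_all
        have x': "\<alpha> 1 \<in> topspace X" using path_in_topspace[OF \<alpha>p(1), of 1] by simp
        have g: "path_class X \<alpha> \<in> pi_hom X (p y) (\<alpha> 1)" using path_class_in_pi_hom[OF \<alpha>p(1)] \<alpha>p(2) by simp
        have yf: "y \<in> fibre Y p (p y)" using y by (simp add: fibre_def)
        have m: "monodromy_action Y p y (path_class X \<alpha>) \<in> fibre Y p (\<alpha> 1)"
          by (rule E.monodromy_action_in_fibre[OF yf g])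
        have "f (monodromy_action Y p y (path_class X \<alpha>)) = \<eta> (\<alpha> 1) (monodromy_action Y p y (path_class X \<alpha>))"
          using m by (simp add: f_def fibre_def)
        also have "\<dots> = monodromy_action Y' p' (\<eta> (p y) y) (path_class X \<alpha>)"
          using fun_cong[OF nat[OF pX[OF y] x' g], of y] yf PiE_mem[OF \<eta>x[OF pX[OF y]] yf]
          by (simp add: compose_def pX[OF y] E.monodromy_functor_farr[OF pX[OF y] x' g]
              E'.monodromy_functor_farr[OF pX[OF y] x' g])
        finally show ?thesis using y by (simp add: f_def)
      qed
      have "continuous_map Y Y' f"
        unfolding continuous_map_def
      proof (intro conjI allI impI)
        show "f \<in> topspace Y \<rightarrow> topspace Y'" using f by blast
        fix V assume V: "openin Y' V"
        show "openin Y {y \<in> topspace Y. f y \<in> V}"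
          unfolding E.openin_iff_monodromy[OF wep]
        proof (intro conjI ballI)
          fix y assume y: "y \<in> topspace Y"
          have "{\<alpha> \<in> topspace (path_space_from X (p y)). monodromy_action Y p y (path_class X \<alpha>) \<in> {y \<in> topspace Y. f y \<in> V}} =
              {\<alpha> \<in> topspace (path_space_from X (p' (f y))). monodromy_action Y' p' (f y) (path_class X \<alpha>) \<in> V}"
          proof (intro Collect_cong conj_cong)
            fix \<alpha> assume "\<alpha> \<in> topspace (path_space_from X (p' (f y)))"
            then have \<alpha>: "\<alpha> \<in> topspace (path_space_from X (p y))" by (simp add: f(2)[OF y])
            have "monodromy_action Y p y (path_class X \<alpha>) \<in> topspace Y"
              using E.monodromy_action_in_fibre[of y "p y" "path_class X \<alpha>" "\<alpha> 1"] path_class_in_pi_hom[of \<alpha> X] y \<alpha>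
              by (simp add: fibre_def)
            then show "monodromy_action Y p y (path_class X \<alpha>) \<in> {y \<in> topspace Y. f y \<in> V} \<longleftrightarrow>
                monodromy_action Y' p' (f y) (path_class X \<alpha>) \<in> V"
              using act[OF y \<alpha>] by simp
          qed (simp add: f(2)[OF y])
          then show "openin (path_space_from X (p y)) {\<alpha> \<in> topspace (path_space_from X (p y)).
              monodromy_action Y p y (path_class X \<alpha>) \<in> {y \<in> topspace Y. f y \<in> V}}"
            using V f(1)[OF y] f(2)[OF y] unfolding E'.openin_iff_monodromy[OF wep, of V] by metis
        qed blast
      qed
      then have "f \<in> Hom (SCov X) E E'" using f(2) by (simp add: Yp Yp' maps_def f_def)
      moreover have "\<eta> = ?r f"
      proof (rule extensionalityI[of _ "topspace X"])
        show "\<eta> \<in> extensional (topspace X)" using \<eta> by (simp add: PiE_def)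
        fix x assume x: "x \<in> topspace X"
        show "\<eta> x = ?r f x"
        proof (rule extensionalityI[of _ "fibre Y p x"])
          show "\<eta> x \<in> extensional (fibre Y p x)" using \<eta>x[OF x] by (simp add: PiE_def)
        qed (use x in \<open>auto simp: f_def fibre_def\<close>)
      qed simp
      ultimately show "\<eta> \<in> ?L" by (intro image_eqI[of _ _ f]) (simp_all add: Yp)
    qed
  qed
qed

lemma isomorphism_monodromy:
  fixes X :: "'a topology"
  assumes wep: "locally_wep_connected X"
  shows "isomorphism_of_categories (SCov X)
    (full_subcategory (TopFunc (pi_tau X) (TopSet :: ('b set, 'b \<Rightarrow> 'b) top_cat_struct)) (disjoint_values X))
    (monodromy X)"
proof (rule isomorphism_of_categoriesI[OF category_SCov])
  let ?T = "TopFunc (pi_tau X) (TopSet :: ('b set, 'b \<Rightarrow> 'b) top_cat_struct)"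
  let ?C = "SCov X :: ('b topology \<times> ('b \<Rightarrow> 'a), 'b \<Rightarrow> 'b) cat_struct"
  let ?D = "full_subcategory ?T (disjoint_values X)"
  have D: "Obj ?D = {F \<in> Obj ?T. disjoint_values X F}" "Hom ?D = Hom ?T" "Ident ?D = Ident ?T" "Comp ?D = Comp ?T"
    by (simp_all add: full_subcategory_def)
  show "category ?D" by (intro category_full_subcategory category_TopFunc category_TopSet)
  have disj: "disjoint_values X (fobj (monodromy X) E)" if "E \<in> Obj ?C" for E :: "'b topology \<times> ('b \<Rightarrow> 'a)"
    using semicovering_map.disjoint_values_monodromy_functor[OF semicovering_mapI, of "fst E" X "snd E"] that by simp
  show F: "is_functor ?C ?D (monodromy X)"
    using is_functor_monodromy[of X] disj unfolding is_functor_def D by blast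
  show "bij_betw (fobj (monodromy X)) (Obj ?C) (Obj ?D)"
  proof (rule bij_betw_imageI)
    show "inj_on (fobj (monodromy X)) (Obj ?C)"
    proof (rule inj_onI)
      fix E E' :: "'b topology \<times> ('b \<Rightarrow> 'a)"
      assume "E \<in> Obj ?C" "E' \<in> Obj ?C" "fobj (monodromy X) E = fobj (monodromy X) E'"
      then show "E = E'"
        using monodromy_functor_inj[OF wep, of "fst E" "snd E" "fst E'" "snd E'"] by simp
    qed
    show "fobj (monodromy X) ` Obj ?C = Obj ?D"
    proof
      show "fobj (monodromy X) ` Obj ?C \<subseteq> Obj ?D" using is_functorD(1)[OF F] by blast
      show "Obj ?D \<subseteq> fobj (monodromy X) ` Obj ?C"
      proof
        fix F assume "F \<in> Obj ?D"
        then obtain Y p where "semicovering Y X p" "p \<in> extensional (topspace Y)" "monodromy_functor X (Y, p) = F"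
          using monodromy_functor_surj[OF wep] unfolding D by blast
        then show "F \<in> fobj (monodromy X) ` Obj ?C" by (intro image_eqI[of _ _ "(Y, p)"]) simp_all
      qed
    qed
  qed
  show "bij_betw (\<lambda>f. farr (monodromy X) (E, E', f)) (Hom ?C E E')
      (Hom ?D (fobj (monodromy X) E) (fobj (monodromy X) E'))"
    if "E \<in> Obj ?C" "E' \<in> Obj ?C" for E E' :: "'b topology \<times> ('b \<Rightarrow> 'a)"
    unfolding D by (rule monodromy_fully_faithful[OF wep that])
qed

definition disjoint_copy ::
  "'a topology \<Rightarrow> ('a, (real \<Rightarrow> 'a) set, 'c set, 'c \<Rightarrow> 'c) functor_struct \<Rightarrow>
   ('a, (real \<Rightarrow> 'a) set, ('a \<times> 'c) set, 'a \<times> 'c \<Rightarrow> 'a \<times> 'c) functor_struct" where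
  "disjoint_copy X F =
     \<lparr>fobj = (\<lambda>x\<in>topspace X. {x} \<times> fobj F x),
      farr = (\<lambda>(x, x', g)\<in>arrows (pi_tau X). \<lambda>q\<in>{x} \<times> fobj F x. (x', farr F (x, x', g) (snd q)))\<rparr>"

lemma disjoint_copy_simps:
  "x \<in> topspace X \<Longrightarrow> fobj (disjoint_copy X F) x = {x} \<times> fobj F x"
  "x \<in> topspace X \<Longrightarrow> x' \<in> topspace X \<Longrightarrow> g \<in> pi_hom X x x' \<Longrightarrow>
     farr (disjoint_copy X F) (x, x', g) = (\<lambda>q\<in>{x} \<times> fobj F x. (x', farr F (x, x', g) (snd q)))"
  by (simp_all add: disjoint_copy_def mem_arrows_pi_tau)

lemma disjoint_copy_in_TopFunc:
  assumes F: "F \<in> Obj (TopFunc (pi_tau X) TopSet)"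
  shows "disjoint_copy X F \<in> Obj (TopFunc (pi_tau X) TopSet)"
proof -
  note F = TopFuncD[OF F]
  let ?M = "disjoint_copy X F"
  have "is_functor (pi_tau X) TopSet ?M"
    unfolding is_functor_def
  proof (intro conjI ballI; unfold pi_tau_simps TopSet_simps)
    fix x x' g assume x: "x \<in> topspace X" "x' \<in> topspace X" and g: "g \<in> pi_hom X x x'"
    note Fg = PiE_mem[OF F(1)[OF x g]]
    show "farr ?M (x, x', g) \<in> fobj ?M x \<rightarrow>\<^sub>E fobj ?M x'"
      using x g Fg by (auto simp: disjoint_copy_simps)
    fix x'' h assume h: "x'' \<in> topspace X" "h \<in> pi_hom X x' x''"
    show "farr ?M (x, x'', pi_comp X g h) = compose (fobj ?M x) (farr ?M (x', x'', h)) (farr ?M (x, x', g))"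
      using x g h Fg pi_comp_in_pi_hom[OF g h(2)] F(3)[OF x h(1) g h(2)]
      by (auto simp: disjoint_copy_simps compose_def intro!: restrict_ext)
  next
    fix x assume x: "x \<in> topspace X"
    show "farr ?M (x, x, pi_one X x) = (\<lambda>y\<in>fobj ?M x. y)"
      using x pi_one_in_pi_hom[OF x] F(2)[OF x] by (auto simp: disjoint_copy_simps intro!: restrict_ext)
  qed simp
  moreover have "continuous_map (pi_tau_top X x x') (product_topology (\<lambda>_. discrete_topology (fobj ?M x')) (fobj ?M x))
      (\<lambda>g. farr ?M (x, x', g))" if x: "x \<in> topspace X" "x' \<in> topspace X" for x x'
    unfolding continuous_map_componentwise
  proof (intro conjI ballI)
    show "(\<lambda>g. farr ?M (x, x', g)) ` topspace (pi_tau_top X x x') \<subseteq> extensional (fobj ?M x)"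
      using x by (auto simp: topspace_pi_tau_top disjoint_copy_simps)
    fix q assume q: "q \<in> fobj ?M x"
    then have u: "snd q \<in> fobj F x" "q \<in> {x} \<times> fobj F x" using x by (auto simp: disjoint_copy_simps)
    have "continuous_map (pi_tau_top X x x') (discrete_topology (fobj F x')) (\<lambda>g. farr F (x, x', g) (snd q))"
      using F(4)[OF x] u(1) unfolding continuous_map_componentwise by blast
    moreover have "continuous_map (discrete_topology (fobj F x')) (discrete_topology ({x'} \<times> fobj F x')) (Pair x')"
      by simp
    ultimately have "continuous_map (pi_tau_top X x x') (discrete_topology ({x'} \<times> fobj F x'))
        (Pair x' \<circ> (\<lambda>g. farr F (x, x', g) (snd q)))"
      by (rule continuous_map_compose)
    then have "continuous_map (pi_tau_top X x x') (discrete_topology ({x'} \<times> fobj F x')) (\<lambda>g. farr ?M (x, x', g) q)"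
      by (rule continuous_map_eq) (use u in \<open>simp add: topspace_pi_tau_top[OF x(1)] disjoint_copy_simps(2)[OF x]\<close>)
    then show "continuous_map (pi_tau_top X x x') (discrete_topology (fobj ?M x')) (\<lambda>g. farr ?M (x, x', g) q)"
      by (simp add: disjoint_copy_simps(1)[OF x(2)])
  qed
  moreover have "fobj ?M \<in> extensional (topspace X)" "farr ?M \<in> extensional (arrows (pi_tau X))"
    by (simp_all add: disjoint_copy_def)
  ultimately show ?thesis by (simp add: TopFunc_def is_top_functor_def)
qed

lemma disjoint_values_disjoint_copy: "disjoint_values X (disjoint_copy X F)"
  by (auto simp: disjoint_values_def disjoint_family_on_def disjoint_copy_simps)

lemma eq_disjoint_copy_iff:
  assumes F: "F \<in> Obj (TopFunc (pi_tau X) TopSet)" and M: "M \<in> Obj (TopFunc (pi_tau X) TopSet)"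
  shows "(\<forall>x\<in>topspace X. fobj M x = {x} \<times> fobj F x) \<and> set_natural_iso (pi_tau X) M F (\<lambda>x. snd) \<longleftrightarrow>
    M = disjoint_copy X F"
proof
  assume M_eq: "M = disjoint_copy X F"
  have "bij_betw snd ({x} \<times> fobj F x) (fobj F x)" for x
    by (auto simp: bij_betw_def inj_on_def image_iff)
  then show "(\<forall>x\<in>topspace X. fobj M x = {x} \<times> fobj F x) \<and> set_natural_iso (pi_tau X) M F (\<lambda>x. snd)"
    by (auto simp: M_eq set_natural_iso_def disjoint_copy_simps)
next
  note M = TopFuncD[OF M]
  assume *: "(\<forall>x\<in>topspace X. fobj M x = {x} \<times> fobj F x) \<and> set_natural_iso (pi_tau X) M F (\<lambda>x. snd)"
  then have obj: "fobj M x = {x} \<times> fobj F x" if "x \<in> topspace X" for x using that by blast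
  have nat: "snd (farr M (x, x', g) q) = farr F (x, x', g) (snd q)"
    if "x \<in> topspace X" "x' \<in> topspace X" "g \<in> pi_hom X x x'" "q \<in> fobj M x" for x x' g q
    using * that unfolding set_natural_iso_def by simp
  have "fobj M = fobj (disjoint_copy X F)"
    by (rule extensionalityI[of _ "topspace X"]) (simp_all add: M(5) obj disjoint_copy_def)
  moreover have "farr M = farr (disjoint_copy X F)"
  proof (rule extensionalityI[of _ "arrows (pi_tau X)"])
    fix a assume a: "a \<in> arrows (pi_tau X)"
    obtain x x' g where a_eq: "a = (x, x', g)" using prod_cases3 by blast
    have x: "x \<in> topspace X" "x' \<in> topspace X" and g: "g \<in> pi_hom X x x'"
      using a by (simp_all add: a_eq mem_arrows_pi_tau)
    have "farr M (x, x', g) = (\<lambda>q\<in>{x} \<times> fobj F x. (x', farr F (x, x', g) (snd q)))"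
    proof (rule extensionalityI[of _ "fobj M x"])
      show "farr M (x, x', g) \<in> extensional (fobj M x)" using M(1)[OF x g] by (simp add: PiE_def)
      show "(\<lambda>q\<in>{x} \<times> fobj F x. (x', farr F (x, x', g) (snd q))) \<in> extensional (fobj M x)"
        by (simp add: obj[OF x(1)])
      fix q assume q: "q \<in> fobj M x"
      have "farr M (x, x', g) q \<in> {x'} \<times> fobj F x'" using PiE_mem[OF M(1)[OF x g] q] obj[OF x(2)] by simp
      then have "farr M (x, x', g) q = (x', farr F (x, x', g) (snd q))"
        using nat[OF x g q] by (metis SigmaE singletonD snd_conv)
      then show "farr M (x, x', g) q = (\<lambda>q\<in>{x} \<times> fobj F x. (x', farr F (x, x', g) (snd q))) q"
        using q obj[OF x(1)] by simp
    qed
    then show "farr M a = farr (disjoint_copy X F) a" by (simp add: a_eq disjoint_copy_simps(2)[OF x g])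
  qed (simp_all add: M(6) disjoint_copy_def)
  ultimately show "M = disjoint_copy X F" by simp
qed

theorem theorem7p1:
  fixes X :: "'a topology"
  assumes "locally_wep_connected X"
  shows "is_functor (SCov X) (TopFunc (pi_tau X) (TopSet :: ('b set, 'b \<Rightarrow> 'b) top_cat_struct))
           (monodromy X)
       \<and> isomorphism_of_categories (SCov X)
           (full_subcategory (TopFunc (pi_tau X) (TopSet :: ('b set, 'b \<Rightarrow> 'b) top_cat_struct))
              (disjoint_values X))
           (monodromy X)
       \<and> (\<forall>F \<in> Obj (TopFunc (pi_tau X) (TopSet :: ('c set, 'c \<Rightarrow> 'c) top_cat_struct)).
            \<exists>!E \<in> Obj (SCov X :: (('a \<times> 'c) topology \<times> ('a \<times> 'c \<Rightarrow> 'a), 'a \<times> 'c \<Rightarrow> 'a \<times> 'c) cat_struct).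
              (\<forall>x\<in>topspace X. fobj (fobj (monodromy X) E) x = {x} \<times> fobj F x) \<and>
              set_natural_iso (pi_tau X) (fobj (monodromy X) E) F (\<lambda>x. snd))"
proof (intro conjI ballI)
  show "is_functor (SCov X) (TopFunc (pi_tau X) (TopSet :: ('b set, 'b \<Rightarrow> 'b) top_cat_struct)) (monodromy X)"
    by (rule is_functor_monodromy)
  show "isomorphism_of_categories (SCov X)
      (full_subcategory (TopFunc (pi_tau X) (TopSet :: ('b set, 'b \<Rightarrow> 'b) top_cat_struct)) (disjoint_values X))
      (monodromy X)"
    by (rule isomorphism_monodromy[OF assms])
  fix F assume F: "F \<in> Obj (TopFunc (pi_tau X) (TopSet :: ('c set, 'c \<Rightarrow> 'c) top_cat_struct))"
  let ?S = "Obj (SCov X :: (('a \<times> 'c) topology \<times> ('a \<times> 'c \<Rightarrow> 'a), 'a \<times> 'c \<Rightarrow> 'a \<times> 'c) cat_struct)"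
  let ?P = "\<lambda>E. (\<forall>x\<in>topspace X. fobj (fobj (monodromy X) E) x = {x} \<times> fobj F x) \<and>
    set_natural_iso (pi_tau X) (fobj (monodromy X) E) F (\<lambda>x. snd)"
  have P: "?P E \<longleftrightarrow> fobj (monodromy X) E = disjoint_copy X F" if "E \<in> ?S" for E
    by (rule eq_disjoint_copy_iff[OF F is_functorD(1)[OF is_functor_monodromy that]])
  obtain Y p where Yp: "semicovering Y X p" "p \<in> extensional (topspace Y)"
    "monodromy_functor X (Y, p) = disjoint_copy X F"
    by (rule monodromy_functor_surj[OF assms disjoint_copy_in_TopFunc[OF F] disjoint_values_disjoint_copy])
  show "\<exists>!E. E \<in> ?S \<and> ?P E"
  proof (rule ex1I)
    have S: "(Y, p) \<in> ?S" using Yp by simp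
    then show "(Y, p) \<in> ?S \<and> ?P (Y, p)" using P[OF S] Yp(3) by simp
    fix E assume E: "E \<in> ?S \<and> ?P E"
    then have "monodromy_functor X (fst E, snd E) = monodromy_functor X (Y, p)" using P[of E] Yp(3) by simp
    then have "(fst E, snd E) = (Y, p)"
      using E Yp(1,2) by (intro monodromy_functor_inj[OF assms]) simp_all
    then show "E = (Y, p)" by simp
  qed
qed

end
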